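(* Let $S$ be a complex manifold and let $(F,h)\to X\times S$ be a holomorphic hermitian vector bundle such that the restrictions $(F_s,h_s)$, $s\in S$, are simple Hermite-Einstein vector bundles over a compact Kähler manifold $(X,g)$, and such that all $\det(F_s)$ are isomorphic to a fixed line bundle $L$ on $X$. Then, locally with respect to $S$, the metric $h$ can be rescaled such that all harmonic projections $H(\rho_{k\overline l})(s)$ vanish; that is, every point of $S$ has a coordinate neighborhood $U$ and a smooth real function $\varphi$ on $U$ such that for the metric $\exp(\varphi(s))\,h$ on $F|_{X\times U}$ one has $H(\rho_{k\overline l})(s)=0$ for all $s\in U$ and all $k,l$.
   Context: $F_s=F|_{X\times\{s\}}$, $h_s=h|_{F_s}$. For a hermitian metric $h$ on $F$, $\Omega^h$ is the curvature form of its Chern connection on $X\times S$; in local holomorphic coordinates $(z^\alpha)$ on $X$ and $(s^k)$ on $S$, $R^h_{A\overline B}=-\partial_{\overline B}\theta^h_A$ with $\theta^h=\partial h\cdot h^{-1}$ are its $\mathrm{End}(F)$-valued components. Hermite-Einstein means $g^{\overline\beta\alpha}R^h_{\alpha\overline\beta}|_s=\lambda\cdot\mathrm{id}_{F_s}$ with $\lambda$ a constant; multiplying $h$ by a positive function of $s$ only preserves this. Simple means that the only holomorphic endomorphisms of $F_s$ are multiples of the identity. $\rho_{k\overline l}:=\partial_{\overline l}\lrcorner(\partial_k\lrcorner\,\Omega^h)=R^h_{k\overline l}$, restricted to $X\times\{s\}$, is a smooth section of $\mathrm{End}(F_s)$, and $H(\rho_{k\overline l})(s)$ is its harmonic projection,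 i.e. its $L_2$-orthogonal projection (with respect to $g,h_s$) onto the kernel of $\Box=\overline\partial^*\overline\partial$ on sections of $\mathrm{End}(F_s)$. *)

theory Defs
  imports "HOL-Analysis.Analysis"
begin

section \<open>Smooth and holomorphic functions on open subsets of complex n-space\<close>

primrec Ck_on :: "nat \<Rightarrow> ('a::real_normed_vector \<Rightarrow> 'b::real_normed_vector) \<Rightarrow> 'a set \<Rightarrow> bool" where
  "Ck_on 0 f V \<longleftrightarrow> continuous_on V f"
| "Ck_on (Suc k) f V \<longleftrightarrow>
     (\<forall>x\<in>V. f differentiable (at x)) \<and>
     (\<forall>v. Ck_on k (\<lambda>x. frechet_derivative f (at x) v) V)"

text \<open>Meant for open \<open>V\<close>, since derivatives are taken in the whole space.\<close>

definition smooth_on :: "('a::real_normed_vector \<Rightarrow> 'b::real_normed_vector) \<Rightarrow> 'a set \<Rightarrow> bool" where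
  "smooth_on f V \<longleftrightarrow> (\<forall>k. Ck_on k f V)"

text \<open>The Wirtinger operators: with \<open>z\<^sub>j = x\<^sub>j + \<i> y\<^sub>j\<close>, the directions \<open>axis j 1\<close> and \<open>axis j \<i>\<close>
  are those of \<open>x\<^sub>j\<close> and \<open>y\<^sub>j\<close>.\<close>

definition dz :: "'n \<Rightarrow> (complex^'n::finite \<Rightarrow> complex) \<Rightarrow> complex^'n \<Rightarrow> complex" where
  "dz j f z = (frechet_derivative f (at z) (axis j 1) - \<i> * frechet_derivative f (at z) (axis j \<i>)) / 2"

definition dzb :: "'n \<Rightarrow> (complex^'n::finite \<Rightarrow> complex) \<Rightarrow> complex^'n \<Rightarrow> complex" where
  "dzb j f z = (frechet_derivative f (at z) (axis j 1) + \<i> * frechet_derivative f (at z) (axis j \<i>)) / 2"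

definition dz_mat :: "'n \<Rightarrow> (complex^'n::finite \<Rightarrow> complex^'r::finite^'r) \<Rightarrow> complex^'n \<Rightarrow> complex^'r^'r" where
  "dz_mat j M z = (\<chi> a b. dz j (\<lambda>w. M w $ a $ b) z)"

definition dzb_mat :: "'n \<Rightarrow> (complex^'n::finite \<Rightarrow> complex^'r::finite^'r) \<Rightarrow> complex^'n \<Rightarrow> complex^'r^'r" where
  "dzb_mat j M z = (\<chi> a b. dzb j (\<lambda>w. M w $ a $ b) z)"

definition holo_on :: "(complex^'n::finite \<Rightarrow> complex) \<Rightarrow> (complex^'n) set \<Rightarrow> bool" where
  "holo_on f V \<longleftrightarrow> smooth_on f V \<and> (\<forall>z\<in>V. \<forall>j. dzb j f z = 0)"


section \<open>Complex manifolds\<close>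

text \<open>A manifold is a whole type, with its given topology, together with a holomorphic atlas
  (not assumed to be maximal).  A chart is a pair of its domain and its coordinate map.\<close>

type_synonym ('b, 'n) chart = "'b set \<times> ('b \<Rightarrow> complex^'n)"

definition chart_inv :: "('b, 'n::finite) chart \<Rightarrow> complex^'n \<Rightarrow> 'b" where
  "chart_inv c = inv_into (fst c) (snd c)"

definition topological_chart :: "('b::topological_space, 'n::finite) chart \<Rightarrow> bool" where
  "topological_chart c \<longleftrightarrow> open (fst c) \<and> open (snd c ` fst c) \<and>
     homeomorphism (fst c) (snd c ` fst c) (snd c) (chart_inv c)"

definition holo_transition :: "('b, 'n::finite) chart \<Rightarrow> ('b, 'n) chart \<Rightarrow> bool" where
  "holo_transition c c' \<longleftrightarrow>
     (\<forall>j. holo_on (\<lambda>z. snd c' (chart_inv c z) $ j) (snd c ` (fst c \<inter> fst c')))"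

definition holo_charts :: "('b::topological_space, 'n::finite) chart set \<Rightarrow> ('b, 'n) chart set" where
  "holo_charts A =
     {c. topological_chart c \<and> (\<forall>c'\<in>A. holo_transition c c' \<and> holo_transition c' c)}"

definition complex_atlas :: "('b::topological_space, 'n::finite) chart set \<Rightarrow> bool" where
  "complex_atlas A \<longleftrightarrow> A \<subseteq> holo_charts A \<and> (\<Union>c\<in>A. fst c) = UNIV"

definition smooth_fun :: "('b, 'n::finite) chart set \<Rightarrow> 'b set \<Rightarrow> ('b \<Rightarrow> 'c::real_normed_vector) \<Rightarrow> bool" where
  "smooth_fun A W f \<longleftrightarrow> (\<forall>c\<in>A. smooth_on (f \<circ> chart_inv c) (snd c ` (fst c \<inter> W)))"

definition holo_mat_fun :: "('b, 'n::finite) chart set \<Rightarrow> 'b set \<Rightarrow> ('b \<Rightarrow> complex^'r::finite^'r) \<Rightarrow> bool" where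
  "holo_mat_fun A W M \<longleftrightarrow>
     (\<forall>c\<in>A. \<forall>a b. holo_on (\<lambda>z. M (chart_inv c z) $ a $ b) (snd c ` (fst c \<inter> W)))"

text \<open>Coordinates on a product are indexed by \<open>'n + 'm\<close>: \<open>Inl \<alpha>\<close> stands for \<open>z\<^sup>\<alpha>\<close>,
  \<open>Inr k\<close> for \<open>s\<^sup>k\<close>.\<close>

definition prod_chart :: "('x, 'n::finite) chart \<Rightarrow> ('s, 'm::finite) chart \<Rightarrow> ('x \<times> 's, 'n + 'm) chart" where
  "prod_chart c d =
     (fst c \<times> fst d, \<lambda>(x, s). \<chi> j. case j of Inl \<alpha> \<Rightarrow> snd c x $ \<alpha> | Inr k \<Rightarrow> snd d s $ k)"

definition prod_atlas :: "('x, 'n::finite) chart set \<Rightarrow> ('s, 'm::finite) chart set \<Rightarrow> ('x \<times> 's, 'n + 'm) chart set" where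
  "prod_atlas A B = (\<lambda>(c, d). prod_chart c d) ` (A \<times> B)"


section \<open>Holomorphic vector bundles and hermitian metrics\<close>

text \<open>A bundle is given by local holomorphic frames \<open>e\<^sup>i = (e\<^sup>i\<^sub>a)\<close> over open sets \<open>bdom i\<close>
  covering the base, through the frame changes
    \<open>e\<^sup>i\<^sub>a = (\<Sum>b. frame_change i j x $ a $ b * e\<^sup>j\<^sub>b)\<close>.
  Thus coefficient vectors are rows.  A metric has matrices \<open>h i $ a $ b = h(e\<^sup>i\<^sub>a, e\<^sup>i\<^sub>b)\<close>, an
  endomorphism \<open>T\<close> has matrices with \<open>T e\<^sup>i\<^sub>a = (\<Sum>b. T i $ a $ b * e\<^sup>i\<^sub>b)\<close>; with these conventions
  the Chern connection matrix is \<open>\<partial>h \<cdot> h\<^sup>-\<^sup>1\<close>.\<close>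

record ('b, 'i, 'r::finite) vbundle =
  idx :: "'i set"
  bdom :: "'i \<Rightarrow> 'b set"
  frame_change :: "'i \<Rightarrow> 'i \<Rightarrow> 'b \<Rightarrow> complex^'r^'r"

definition holo_bundle :: "('b::topological_space, 'n::finite) chart set \<Rightarrow> ('b, 'i, 'r::finite) vbundle \<Rightarrow> bool" where
  "holo_bundle A E \<longleftrightarrow>
     (\<forall>i\<in>idx E. open (bdom E i)) \<and> (\<Union>i\<in>idx E. bdom E i) = UNIV \<and>
     (\<forall>i\<in>idx E. \<forall>x\<in>bdom E i. frame_change E i i x = mat 1) \<and>
     (\<forall>i\<in>idx E. \<forall>j\<in>idx E. \<forall>k\<in>idx E. \<forall>x\<in>bdom E i \<inter> bdom E j \<inter> bdom E k.
        frame_change E i j x ** frame_change E j k x = frame_change E i k x) \<and>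
     (\<forall>i\<in>idx E. \<forall>j\<in>idx E. holo_mat_fun A (bdom E i \<inter> bdom E j) (frame_change E i j))"

text \<open>An isomorphism \<open>\<Phi>\<close> has matrices with \<open>\<Phi>(e\<^sup>i\<^sub>a) = (\<Sum>b. T i j $ a $ b * f\<^sup>j\<^sub>b)\<close>, where
  \<open>e\<^sup>i\<close> and \<open>f\<^sup>j\<close> are the frames of the two bundles.\<close>

definition bundle_iso ::
  "('b, 'n::finite) chart set \<Rightarrow> ('b, 'i, 'r::finite) vbundle \<Rightarrow> ('b, 'j, 'r) vbundle \<Rightarrow> bool" where
  "bundle_iso A E E' \<longleftrightarrow> (\<exists>T.
     (\<forall>i\<in>idx E. \<forall>j\<in>idx E'. holo_mat_fun A (bdom E i \<inter> bdom E' j) (T i j) \<and>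
        (\<forall>x\<in>bdom E i \<inter> bdom E' j. invertible (T i j x))) \<and>
     (\<forall>i\<in>idx E. \<forall>i'\<in>idx E. \<forall>j\<in>idx E'. \<forall>j'\<in>idx E'.
        \<forall>x\<in>bdom E i \<inter> bdom E i' \<inter> bdom E' j \<inter> bdom E' j'.
          T i' j' x = frame_change E i' i x ** T i j x ** frame_change E' j j' x))"

definition det_bundle :: "('b, 'i, 'r::finite) vbundle \<Rightarrow> ('b, 'i, 1) vbundle" where
  "det_bundle E = \<lparr>idx = idx E, bdom = bdom E, frame_change = (\<lambda>i j x. mat (det (frame_change E i j x)))\<rparr>"

definition ctranspose :: "complex^'r::finite^'r \<Rightarrow> complex^'r^'r" where
  "ctranspose M = (\<chi> a b. cnj (M $ b $ a))"

definition hermitian_pos_def :: "complex^'r::finite^'r \<Rightarrow> bool" where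
  "hermitian_pos_def M \<longleftrightarrow> ctranspose M = M \<and>
     (\<forall>v. v \<noteq> 0 \<longrightarrow> 0 < Re (\<Sum>a\<in>UNIV. \<Sum>b\<in>UNIV. v $ a * M $ a $ b * cnj (v $ b)))"

definition hermitian_metric ::
  "('b, 'n::finite) chart set \<Rightarrow> ('b, 'i, 'r::finite) vbundle \<Rightarrow> ('i \<Rightarrow> 'b \<Rightarrow> complex^'r^'r) \<Rightarrow> bool" where
  "hermitian_metric A E h \<longleftrightarrow>
     (\<forall>i\<in>idx E. smooth_fun A (bdom E i) (h i) \<and> (\<forall>x\<in>bdom E i. hermitian_pos_def (h i x))) \<and>
     (\<forall>i\<in>idx E. \<forall>j\<in>idx E. \<forall>x\<in>bdom E i \<inter> bdom E j.
        h i x = frame_change E i j x ** h j x ** ctranspose (frame_change E i j x))"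

text \<open>Restriction of a bundle and a metric on \<open>X \<times> S\<close> to \<open>X \<times> {s} = X\<close>.\<close>

definition slice_bundle :: "('x \<times> 's, 'i, 'r::finite) vbundle \<Rightarrow> 's \<Rightarrow> ('x, 'i, 'r) vbundle" where
  "slice_bundle F s =
     \<lparr>idx = idx F, bdom = (\<lambda>i. {x. (x, s) \<in> bdom F i}), frame_change = (\<lambda>i j x. frame_change F i j (x, s))\<rparr>"

definition slice_metric :: "('i \<Rightarrow> 'x \<times> 's \<Rightarrow> complex^'r::finite^'r) \<Rightarrow> 's \<Rightarrow> 'i \<Rightarrow> 'x \<Rightarrow> complex^'r^'r" where
  "slice_metric h s = (\<lambda>i x. h i (x, s))"

text \<open>The component \<open>R\<^sub>A\<^sub>B = - \<partial>\<^sub>B(\<partial>\<^sub>A h \<cdot> h\<^sup>-\<^sup>1)\<close> (index \<open>B\<close> conjugated) of the curvature of the Chern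
  connection, in the chart \<open>c\<close> and in the frame in which the metric has the matrix \<open>H\<close>.\<close>

definition curvature ::
  "('b, 'n::finite) chart \<Rightarrow> ('b \<Rightarrow> complex^'r::finite^'r) \<Rightarrow> 'n \<Rightarrow> 'n \<Rightarrow> 'b \<Rightarrow> complex^'r^'r" where
  "curvature c H a b x =
     - dzb_mat b (\<lambda>z. dz_mat a (H \<circ> chart_inv c) z ** matrix_inv (H (chart_inv c z))) (snd c x)"


section \<open>Kaehler manifolds\<close>

text \<open>The holomorphic tangent bundle; its frames are the \<open>\<partial>/\<partial>z\<^sup>\<alpha>\<close>, one frame for each chart.\<close>

definition tangent_bundle :: "('x, 'n::finite) chart set \<Rightarrow> ('x, ('x, 'n) chart, 'n) vbundle" where
  "tangent_bundle A =
     \<lparr>idx = A, bdom = fst,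
      frame_change = (\<lambda>c c' x. \<chi> \<alpha> \<beta>. dz \<alpha> (\<lambda>z. snd c' (chart_inv c z) $ \<beta>) (snd c x))\<rparr>"

text \<open>The condition on the derivatives is \<open>d\<omega> = 0\<close> for \<open>\<omega> = \<i> (\<Sum>\<alpha> \<beta>. g $ \<alpha> $ \<beta> dz\<^sup>\<alpha> \<and> cnj dz\<^sup>\<beta>)\<close>.\<close>

definition kaehler_metric ::
  "('x, 'n::finite) chart set \<Rightarrow> (('x, 'n) chart \<Rightarrow> 'x \<Rightarrow> complex^'n^'n) \<Rightarrow> bool" where
  "kaehler_metric A g \<longleftrightarrow> hermitian_metric A (tangent_bundle A) g \<and>
     (\<forall>c\<in>A. \<forall>x\<in>fst c. \<forall>\<alpha> \<beta> \<gamma>.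
        dz \<gamma> (\<lambda>z. g c (chart_inv c z) $ \<alpha> $ \<beta>) (snd c x) =
        dz \<alpha> (\<lambda>z. g c (chart_inv c z) $ \<gamma> $ \<beta>) (snd c x))"

text \<open>The measure of the volume form \<open>\<omega>\<^sup>n / n!\<close>, which is \<open>2\<^sup>n det g\<close> times Lebesgue measure in a
  chart.  On a second countable manifold exactly one measure has this property.\<close>

definition kaehler_volume ::
  "('x::topological_space, 'n::finite) chart set \<Rightarrow> (('x, 'n) chart \<Rightarrow> 'x \<Rightarrow> complex^'n^'n) \<Rightarrow> 'x measure \<Rightarrow> bool" where
  "kaehler_volume A g M \<longleftrightarrow> sets M = sets borel \<and>
     (\<forall>c\<in>A. \<forall>E\<in>sets borel. E \<subseteq> fst c \<longrightarrow>
        emeasure M E = (\<integral>\<^sup>+z\<in>snd c ` E. ennreal (2 ^ CARD('n) * Re (det (g c (chart_inv c z)))) \<partial>lborel))"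


section \<open>Endomorphisms, the Hermite-Einstein condition and simplicity\<close>

text \<open>Sections are extended by \<open>0\<close> outside the domains of the frames, so that equal sections are
  equal as functions.\<close>

definition End_sections ::
  "('b, 'n::finite) chart set \<Rightarrow> ('b, 'i, 'r::finite) vbundle \<Rightarrow> ('i \<Rightarrow> 'b \<Rightarrow> complex^'r^'r) set" where
  "End_sections A E =
     {T. (\<forall>i\<in>idx E. smooth_fun A (bdom E i) (T i)) \<and>
         (\<forall>i\<in>idx E. \<forall>j\<in>idx E. \<forall>x\<in>bdom E i \<inter> bdom E j.
            T i x ** frame_change E i j x = frame_change E i j x ** T j x) \<and>
         (\<forall>i x. \<not> (i \<in> idx E \<and> x \<in> bdom E i) \<longrightarrow> T i x = 0)}"

definition simple_bundle :: "('b, 'n::finite) chart set \<Rightarrow> ('b, 'i, 'r::finite) vbundle \<Rightarrow> bool" where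
  "simple_bundle A E \<longleftrightarrow>
     (\<forall>T\<in>End_sections A E. (\<forall>i\<in>idx E. holo_mat_fun A (bdom E i) (T i)) \<longrightarrow>
        (\<exists>\<mu>. \<forall>i\<in>idx E. \<forall>x\<in>bdom E i. T i x = mat \<mu>))"

text \<open>If \<open>g $ \<alpha> $ \<beta>\<close> are the components of the metric (\<open>\<beta>\<close> conjugated), the contravariant
  component \<open>g\<^sup>\<beta>\<^sup>\<alpha>\<close> (\<open>\<beta>\<close> conjugated) is \<open>matrix_inv g $ \<beta> $ \<alpha>\<close>.\<close>

definition hermite_einstein ::
  "('x, 'n::finite) chart set \<Rightarrow> (('x, 'n) chart \<Rightarrow> 'x \<Rightarrow> complex^'n^'n) \<Rightarrow>
   ('x, 'i, 'r::finite) vbundle \<Rightarrow> ('i \<Rightarrow> 'x \<Rightarrow> complex^'r^'r) \<Rightarrow> bool" where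
  "hermite_einstein A g E h \<longleftrightarrow>
     (\<exists>\<mu>::complex. \<forall>c\<in>A. \<forall>i\<in>idx E. \<forall>x\<in>fst c \<inter> bdom E i.
        (\<Sum>\<alpha>\<in>UNIV. \<Sum>\<beta>\<in>UNIV. map_matrix ((*) (matrix_inv (g c x) $ \<beta> $ \<alpha>)) (curvature c (h i) \<alpha> \<beta> x)) = mat \<mu>)"


section \<open>Harmonic projection\<close>

text \<open>The inner products below are computed in an arbitrary frame and chart at the point; the values
  do not depend on these.\<close>

definition frame_at :: "('b, 'i, 'r::finite) vbundle \<Rightarrow> 'b \<Rightarrow> 'i" where
  "frame_at E x = (SOME i. i \<in> idx E \<and> x \<in> bdom E i)"

definition chart_at :: "('b, 'n::finite) chart set \<Rightarrow> 'b \<Rightarrow> ('b, 'n) chart" where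
  "chart_at A x = (SOME c. c \<in> A \<and> x \<in> fst c)"

text \<open>Pointwise inner product \<open>tr(T \<circ> T'\<^sup>*)\<close>: the adjoint of \<open>T'\<close> with respect to \<open>h\<close> has the
  matrix \<open>h \<cdot> ctranspose T' \<cdot> h\<^sup>-\<^sup>1\<close>.\<close>

definition End_inner ::
  "('b, 'i, 'r::finite) vbundle \<Rightarrow> ('i \<Rightarrow> 'b \<Rightarrow> complex^'r^'r) \<Rightarrow>
   ('i \<Rightarrow> 'b \<Rightarrow> complex^'r^'r) \<Rightarrow> ('i \<Rightarrow> 'b \<Rightarrow> complex^'r^'r) \<Rightarrow> 'b \<Rightarrow> complex" where
  "End_inner E h T T' x =
     (let i = frame_at E x in trace (T i x ** h i x ** ctranspose (T' i x) ** matrix_inv (h i x)))"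

definition End_L2 ::
  "'x measure \<Rightarrow> ('x, 'i, 'r::finite) vbundle \<Rightarrow> ('i \<Rightarrow> 'x \<Rightarrow> complex^'r^'r) \<Rightarrow>
   ('i \<Rightarrow> 'x \<Rightarrow> complex^'r^'r) \<Rightarrow> ('i \<Rightarrow> 'x \<Rightarrow> complex^'r^'r) \<Rightarrow> complex" where
  "End_L2 vol E h T T' = (LINT x|vol. End_inner E h T T' x)"

text \<open>An \<open>End(E)\<close>-valued (0,1)-form has, in the chart \<open>c\<close> and the frame \<open>i\<close>, the coefficient
  \<open>\<eta> c i \<beta> x\<close> at the conjugate of \<open>dz\<^sup>\<beta>\<close>.\<close>

type_synonym ('x, 'n, 'i, 'r) End_form = "('x, 'n) chart \<Rightarrow> 'i \<Rightarrow> 'n \<Rightarrow> 'x \<Rightarrow> complex^'r^'r"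

definition dbar :: "('i \<Rightarrow> 'x \<Rightarrow> complex^'r::finite^'r) \<Rightarrow> ('x, 'n::finite, 'i, 'r) End_form" where
  "dbar T = (\<lambda>c i \<beta> x. dzb_mat \<beta> (T i \<circ> chart_inv c) (snd c x))"

definition End_form_inner ::
  "('x, 'n::finite) chart set \<Rightarrow> (('x, 'n) chart \<Rightarrow> 'x \<Rightarrow> complex^'n^'n) \<Rightarrow>
   ('x, 'i, 'r::finite) vbundle \<Rightarrow> ('i \<Rightarrow> 'x \<Rightarrow> complex^'r^'r) \<Rightarrow>
   ('x, 'n, 'i, 'r) End_form \<Rightarrow> ('x, 'n, 'i, 'r) End_form \<Rightarrow> 'x \<Rightarrow> complex" where
  "End_form_inner A g E h \<eta> \<xi> x =
     (let c = chart_at A x; i = frame_at E x in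
        \<Sum>\<alpha>\<in>UNIV. \<Sum>\<beta>\<in>UNIV. matrix_inv (g c x) $ \<beta> $ \<alpha> *
          trace (\<eta> c i \<beta> x ** h i x ** ctranspose (\<xi> c i \<alpha> x) ** matrix_inv (h i x)))"

definition End_form_L2 ::
  "('x, 'n::finite) chart set \<Rightarrow> (('x, 'n) chart \<Rightarrow> 'x \<Rightarrow> complex^'n^'n) \<Rightarrow> 'x measure \<Rightarrow>
   ('x, 'i, 'r::finite) vbundle \<Rightarrow> ('i \<Rightarrow> 'x \<Rightarrow> complex^'r^'r) \<Rightarrow>
   ('x, 'n, 'i, 'r) End_form \<Rightarrow> ('x, 'n, 'i, 'r) End_form \<Rightarrow> complex" where
  "End_form_L2 A g vol E h \<eta> \<xi> = (LINT x|vol. End_form_inner A g E h \<eta> \<xi> x)"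

text \<open>The graph of the formal adjoint of \<open>dbar\<close>: \<open>dbar\<^sup>* \<eta> = T\<close>.\<close>

definition dbar_adjoint ::
  "('x, 'n::finite) chart set \<Rightarrow> (('x, 'n) chart \<Rightarrow> 'x \<Rightarrow> complex^'n^'n) \<Rightarrow> 'x measure \<Rightarrow>
   ('x, 'i, 'r::finite) vbundle \<Rightarrow> ('i \<Rightarrow> 'x \<Rightarrow> complex^'r^'r) \<Rightarrow>
   ('x, 'n, 'i, 'r) End_form \<Rightarrow> ('i \<Rightarrow> 'x \<Rightarrow> complex^'r^'r) \<Rightarrow> bool" where
  "dbar_adjoint A g vol E h \<eta> T \<longleftrightarrow> T \<in> End_sections A E \<and>
     (\<forall>T'\<in>End_sections A E. End_form_L2 A g vol E h (dbar T') \<eta> = End_L2 vol E h T' T)"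

text \<open>The kernel of the Laplacian \<open>dbar\<^sup>* dbar\<close>.\<close>

definition harmonic_End_sections ::
  "('x, 'n::finite) chart set \<Rightarrow> (('x, 'n) chart \<Rightarrow> 'x \<Rightarrow> complex^'n^'n) \<Rightarrow> 'x measure \<Rightarrow>
   ('x, 'i, 'r::finite) vbundle \<Rightarrow> ('i \<Rightarrow> 'x \<Rightarrow> complex^'r^'r) \<Rightarrow> ('i \<Rightarrow> 'x \<Rightarrow> complex^'r^'r) set" where
  "harmonic_End_sections A g vol E h =
     {T \<in> End_sections A E. dbar_adjoint A g vol E h (dbar T) (\<lambda>i x. 0)}"

definition harmonic_projection ::
  "('x, 'n::finite) chart set \<Rightarrow> (('x, 'n) chart \<Rightarrow> 'x \<Rightarrow> complex^'n^'n) \<Rightarrow> 'x measure \<Rightarrow>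
   ('x, 'i, 'r::finite) vbundle \<Rightarrow> ('i \<Rightarrow> 'x \<Rightarrow> complex^'r^'r) \<Rightarrow>
   ('i \<Rightarrow> 'x \<Rightarrow> complex^'r^'r) \<Rightarrow> ('i \<Rightarrow> 'x \<Rightarrow> complex^'r^'r)" where
  "harmonic_projection A g vol E h T =
     (THE P. P \<in> harmonic_End_sections A g vol E h \<and>
        (\<forall>Q\<in>harmonic_End_sections A g vol E h. End_L2 vol E h (\<lambda>i x. T i x - P i x) Q = 0))"

text \<open>The section \<open>\<rho>\<^sub>k\<^sub>l\<close> (\<open>l\<close> conjugated) over \<open>X \<times> {s}\<close>, for the chart \<open>d\<close> of \<open>S\<close>.  It does
  not depend on the chart of \<open>X\<close>.\<close>

definition rho ::
  "('x, 'n::finite) chart set \<Rightarrow> ('s, 'm::finite) chart \<Rightarrow> ('x \<times> 's, 'i, 'r::finite) vbundle \<Rightarrow>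
   ('i \<Rightarrow> 'x \<times> 's \<Rightarrow> complex^'r^'r) \<Rightarrow> 'm \<Rightarrow> 'm \<Rightarrow> 's \<Rightarrow> 'i \<Rightarrow> 'x \<Rightarrow> complex^'r^'r" where
  "rho A d F h k l s = (\<lambda>i x.
     if i \<in> idx F \<and> (x, s) \<in> bdom F i
     then curvature (prod_chart (chart_at A x) d) (h i) (Inr k) (Inr l) (x, s) else 0)"

definition rescale_metric ::
  "('s \<Rightarrow> real) \<Rightarrow> ('i \<Rightarrow> 'x \<times> 's \<Rightarrow> complex^'r::finite^'r) \<Rightarrow> 'i \<Rightarrow> 'x \<times> 's \<Rightarrow> complex^'r^'r" where
  "rescale_metric \<phi> h = (\<lambda>i (x, s). exp (\<phi> s) *\<^sub>R h i (x, s))"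

end

theory Submission
  imports Defs
begin

text \<open>
  Since \<open>F\<^sub>s\<close> is simple, its harmonic endomorphisms are the multiples of the identity, so
  \<open>H(\<rho>\<^sub>k\<^sub>l)(s) = 0\<close> means that the integral of \<open>tr \<rho>\<^sub>k\<^sub>l\<close> over \<open>X\<close> vanishes.  In a local frame
  \<open>tr \<rho>\<^sub>k\<^sub>l\<close> is minus the mixed second derivative \<open>\<partial>\<^sub>k\<partial>\<^sub>l\<close> of \<open>ln det h\<close> (\<open>l\<close> conjugated), and another frame
  changes \<open>ln det h\<close> by a function that is pluriharmonic in \<open>s\<close>.  By compactness finitely many sets
  \<open>N\<^sub>p \<times> U\<close>, each inside the domain of a frame \<open>i\<^sub>p\<close>, cover \<open>X \<times> U\<close>.  With bounded weights \<open>\<eta>\<^sub>p\<close> that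
  vanish outside \<open>N\<^sub>p\<close> and add up to \<open>1\<close>, the function \<open>\<Phi>(s) = \<Sum>\<^sub>p \<integral> \<eta>\<^sub>p ln det h\<^sub>i (\<cdot>, s)\<close> (with \<open>i = i\<^sub>p\<close>) has
  mixed derivatives \<open>- \<integral> tr \<rho>\<^sub>k\<^sub>l\<close>, and \<open>\<phi> = - \<Phi> / (r Vol(X))\<close> is the required function.
\<close>

section \<open>Calculus of the classes \<open>Ck_on\<close>\<close>

text \<open>The harmonic projection is a definite description over the kernel of a weakly defined
  Laplacian. Testing harmonicity of T against T itself makes the integral of |dbar T|^2 vanish. The
  integrand is continuous and non-negative and the volume charges every nonempty open set, so dbar T
  = 0 everywhere; this is how simplicity comes to apply.

  The obstacle is that ln det h depends on the frame, so it cannot be integrated over X as it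
  stands; only its mixed derivatives in s are invariant. Averaging local choices repairs this: the
  weights do not depend on s, so they pass through derivatives in s, and they are never
  differentiated along X, so normalized indicators of the covering sets suffice. Each weight
  vanishes off a compact set inside one chart, and this compactness gives the uniformity in x needed
  to differentiate under the integral.

  The constant in \<phi> comes from ln det(e^\<phi> h) = r \<phi> + ln det h: rescaling subtracts r
  times the mixed derivative of \<phi> from the trace at every point of X.\<close>

abbreviation fder :: "('a::real_normed_vector \<Rightarrow> 'b::real_normed_vector) \<Rightarrow> 'a \<Rightarrow> 'a \<Rightarrow> 'b" where
  "fder f x \<equiv> frechet_derivative f (at x)"

lemma frechet_derivative_cong_open:
  assumes "open V" "x \<in> V" "\<And>y. y \<in> V \<Longrightarrow> f y = g y"
  shows "fder f x = fder g x"
proof -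
  have "(f has_derivative f') (at x) \<longleftrightarrow> (g has_derivative f') (at x)" for f'
    using has_derivative_transform_within_open[of f f' x UNIV V g]
      has_derivative_transform_within_open[of g f' x UNIV V f] assms by auto
  then show ?thesis unfolding frechet_derivative_def by simp
qed

lemma differentiable_cong_open:
  assumes "f differentiable (at x)" "open V" "x \<in> V" "\<And>y. y \<in> V \<Longrightarrow> f y = g y"
  shows "g differentiable (at x)"
  using assms has_derivative_transform_within_open unfolding differentiable_def by blast

lemma Ck_on_cong:
  assumes "open V" "\<And>x. x \<in> V \<Longrightarrow> f x = g x" "Ck_on k f V"
  shows "Ck_on k g V"
  using assms
proof (induction k arbitrary: f g)
  case 0
  then show ?case by (simp cong: continuous_on_cong)
next
  case (Suc k)
  have eq: "fder f x = fder g x" if "x \<in> V" for x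
    by (rule frechet_derivative_cong_open[OF Suc.prems(1) that Suc.prems(2)])
  have "Ck_on k (\<lambda>x. fder g x v) V" for v
    by (rule Suc.IH[OF Suc.prems(1), of "\<lambda>x. fder f x v"])
      (use Suc.prems(3) eq in auto)
  moreover have "g differentiable (at x)" if "x \<in> V" for x
    by (rule differentiable_cong_open[OF _ Suc.prems(1) that Suc.prems(2)]) (use Suc.prems(3) that in auto)
  ultimately show ?case by simp
qed

lemma Ck_on_subset: "Ck_on k f V \<Longrightarrow> W \<subseteq> V \<Longrightarrow> Ck_on k f W"
  by (induction k arbitrary: f) (auto intro: continuous_on_subset)

lemma differentiable_at_imp_continuous_on:
  "(\<And>x. x \<in> V \<Longrightarrow> f differentiable (at x)) \<Longrightarrow> continuous_on V f"
  by (simp add: continuous_at_imp_continuous_on differentiable_imp_continuous_within)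

lemma Ck_on_SucD: "Ck_on (Suc k) f V \<Longrightarrow> Ck_on k f V"
  by (induction k arbitrary: f) (auto intro: differentiable_at_imp_continuous_on)

lemma Ck_on_imp_continuous_on: "Ck_on k f V \<Longrightarrow> continuous_on V f"
  by (induction k arbitrary: f) (auto intro: differentiable_at_imp_continuous_on)

lemma Ck_on_const: "Ck_on k (\<lambda>x. c) V"
  by (induction k arbitrary: c) auto

text \<open>Replaces the chosen \<open>frechet_derivative\<close> in the recursion by any explicit
  derivative \<open>f'\<close>, so that each closure rule below reduces to a differentiation rule
  and an induction on k.\<close>

lemma Ck_on_SucI:
  assumes "open V" "\<And>x. x \<in> V \<Longrightarrow> (f has_derivative f' x) (at x)" "\<And>v. Ck_on k (\<lambda>x. f' x v) V"
  shows "Ck_on (Suc k) f V"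
proof -
  have "Ck_on k (\<lambda>x. fder f x v) V" for v
    by (rule Ck_on_cong[OF assms(1) _ assms(3)[of v]]) (simp add: frechet_derivative_at[OF assms(2), symmetric])
  then show ?thesis using assms(2) by (auto simp: differentiable_def)
qed

lemma Ck_on_SucD2:
  assumes "Ck_on (Suc k) f V" "x \<in> V"
  shows "(f has_derivative fder f x) (at x)"
  using assms frechet_derivative_works by auto

lemma Ck_on_bounded_linear_comp:
  assumes "bounded_linear L" "open V" "Ck_on k f V"
  shows "Ck_on k (\<lambda>x. L (f x)) V"
  using assms(3)
proof (induction k arbitrary: f)
  case 0
  then show ?case using bounded_linear.continuous_on[OF assms(1)] by simp
next
  case (Suc k)
  show ?case
    by (rule Ck_on_SucI[OF assms(2) bounded_linear.has_derivative[OF assms(1) Ck_on_SucD2[OF Suc.prems]]])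
      (use Suc in auto)
qed

lemma Ck_on_bounded_linear:
  assumes "bounded_linear L" "open V"
  shows "Ck_on k L V"
proof (cases k)
  case 0
  then show ?thesis using bounded_linear.continuous_on[OF assms(1) continuous_on_id] by simp
next
  case (Suc j)
  then show ?thesis
    using Ck_on_SucI[OF assms(2), where f = L and f' = "\<lambda>_. L" and k = j]
      bounded_linear_imp_has_derivative[OF assms(1)] Ck_on_const by auto
qed

lemma Ck_on_add:
  assumes "open V" "Ck_on k f V" "Ck_on k g V"
  shows "Ck_on k (\<lambda>x. f x + g x) V"
  using assms(2,3)
proof (induction k arbitrary: f g)
  case 0
  then show ?case by (simp add: continuous_on_add)
next
  case (Suc k)
  show ?case
    by (rule Ck_on_SucI[OF assms(1) has_derivative_add[OF Ck_on_SucD2[OF Suc.prems(1)] Ck_on_SucD2[OF Suc.prems(2)]]])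
      (use Suc in auto)
qed

lemma Ck_on_sum:
  assumes "open V" "\<And>i. i \<in> I \<Longrightarrow> Ck_on k (f i) V"
  shows "Ck_on k (\<lambda>x. \<Sum>i\<in>I. f i x) V"
  using assms(2)
  by (induction I rule: infinite_finite_induct) (auto intro!: Ck_on_add Ck_on_const assms(1))

text \<open>Leibniz terms pair a derivative, of class k, with the other factor undifferentiated; the
  latter is of class Suc k and is first weakened to class k.\<close>

lemma (in bounded_bilinear) Ck_on:
  assumes "open V" "Ck_on k f V" "Ck_on k g V"
  shows "Ck_on k (\<lambda>x. prod (f x) (g x)) V"
  using assms(2,3)
proof (induction k arbitrary: f g)
  case 0
  then show ?case by (simp add: continuous_on)
next
  case (Suc k)
  show ?case
    by (rule Ck_on_SucI[OF assms(1) FDERIV[OF Ck_on_SucD2[OF Suc.prems(1)] Ck_on_SucD2[OF Suc.prems(2)]]])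
      (use Suc Ck_on_SucD[OF Suc.prems(1)] Ck_on_SucD[OF Suc.prems(2)] assms(1) in \<open>auto intro!: Ck_on_add\<close>)
qed

lemmas Ck_on_mult = bounded_bilinear.Ck_on[OF bounded_bilinear_mult]
lemmas Ck_on_scaleR = bounded_bilinear.Ck_on[OF bounded_bilinear_scaleR]
lemmas Ck_on_inner = bounded_bilinear.Ck_on[OF bounded_bilinear_inner]

lemma Ck_on_prod:
  fixes f :: "'i \<Rightarrow> 'a::real_normed_vector \<Rightarrow> 'b::real_normed_field"
  assumes "open V" "\<And>i. i \<in> I \<Longrightarrow> Ck_on k (f i) V"
  shows "Ck_on k (\<lambda>x. \<Prod>i\<in>I. f i x) V"
  using assms(2)
  by (induction I rule: infinite_finite_induct) (auto intro!: Ck_on_mult Ck_on_const assms(1))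

lemma linear_euclidean_sum:
  fixes f :: "'a::euclidean_space \<Rightarrow> 'b::real_vector"
  assumes "linear f"
  shows "f x = (\<Sum>b\<in>Basis. (x \<bullet> b) *\<^sub>R f b)"
proof -
  have "f x = f (\<Sum>b\<in>Basis. (x \<bullet> b) *\<^sub>R b)" by (simp add: euclidean_representation)
  then show ?thesis using assms by (simp add: linear_sum linear_scale)
qed

text \<open>In the chain rule the direction \<open>fder f x v\<close> fed to the derivative of g
  varies with x, while the recursion only speaks of fixed directions. Expanding that direction in
  the basis separates the two and leaves sums of products.\<close>

lemma Ck_on_compose:
  fixes f :: "'a::real_normed_vector \<Rightarrow> 'b::euclidean_space"
  assumes "open V" "open W" "Ck_on k f V" "f ` V \<subseteq> W" "Ck_on k g W"
  shows "Ck_on k (\<lambda>x. g (f x)) V"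
  using assms(3-)
proof (induction k arbitrary: g)
  case 0
  then show ?case by (auto intro: continuous_on_compose2)
next
  case (Suc k)
  let ?D = "\<lambda>x v. \<Sum>b\<in>Basis. (fder f x v \<bullet> b) *\<^sub>R fder g (f x) b"
  have "((\<lambda>x. g (f x)) has_derivative ?D x) (at x)" if "x \<in> V" for x
  proof -
    have g: "(g has_derivative fder g (f x)) (at (f x))"
      using Ck_on_SucD2[OF Suc.prems(3)] Suc.prems(2) that by auto
    have "((\<lambda>x. g (f x)) has_derivative (\<lambda>v. fder g (f x) (fder f x v))) (at x)"
      using diff_chain_at[OF Ck_on_SucD2[OF Suc.prems(1) that] g] by (simp add: o_def)
    then show ?thesis
      by (simp add: linear_euclidean_sum[OF has_derivative_linear[OF g], symmetric])
  qed
  then show ?case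
  proof (rule Ck_on_SucI[OF assms(1)])
    fix v
    have "Ck_on k (\<lambda>x. fder f x v \<bullet> b) V" for b
      using Suc.prems assms(1) by (intro Ck_on_inner Ck_on_const) auto
    moreover have "Ck_on k (\<lambda>x. fder g (f x) b) V" for b
      using Suc.IH[of "\<lambda>y. fder g y b"] Ck_on_SucD[OF Suc.prems(1)] Suc.prems by auto
    ultimately show "Ck_on k (\<lambda>x. ?D x v) V"
      by (intro Ck_on_sum Ck_on_scaleR assms(1)) auto
  qed
qed

text \<open>The derivative contains \<open>inverse (f x)\<close> itself, which is of class k by the
  induction hypothesis, so closure under products finishes the step.\<close>

lemma Ck_on_inverse:
  fixes f :: "'a::real_normed_vector \<Rightarrow> 'b::real_normed_field"
  assumes "open V" "Ck_on k f V" "\<And>x. x \<in> V \<Longrightarrow> f x \<noteq> 0"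
  shows "Ck_on k (\<lambda>x. inverse (f x)) V"
  using assms(2)
proof (induction k)
  case 0
  then show ?case using assms(3) by (auto intro: continuous_on_inverse)
next
  case (Suc k)
  show ?case
  proof (rule Ck_on_SucI[OF assms(1)])
    fix x assume x: "x \<in> V"
    show "((\<lambda>x. inverse (f x)) has_derivative (\<lambda>v. (- 1) * ((inverse (f x) * fder f x v) * inverse (f x)))) (at x)"
      using Deriv.has_derivative_inverse[OF assms(3)[OF x] Ck_on_SucD2[OF Suc.prems x]] by simp
  next
    fix v
    show "Ck_on k (\<lambda>x. (- 1) * ((inverse (f x) * fder f x v) * inverse (f x))) V"
      using Suc.IH Ck_on_SucD[OF Suc.prems] Suc.prems
      by (intro Ck_on_mult Ck_on_const assms(1)) auto
  qed
qed

text \<open>One differentiation removes the logarithm, so a case split on k replaces the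
  induction.\<close>

lemma Ck_on_ln:
  fixes f :: "'a::real_normed_vector \<Rightarrow> real"
  assumes "open V" "Ck_on k f V" "\<And>x. x \<in> V \<Longrightarrow> 0 < f x"
  shows "Ck_on k (\<lambda>x. ln (f x)) V"
proof (cases k)
  case 0
  then show ?thesis using assms continuous_on_ln[of V f] by force
next
  case (Suc j)
  have f: "Ck_on (Suc j) f V" using assms(2) Suc by simp
  have "Ck_on (Suc j) (\<lambda>x. ln (f x)) V"
  proof (rule Ck_on_SucI[OF assms(1)])
    fix x assume x: "x \<in> V"
    show "((\<lambda>x. ln (f x)) has_derivative (\<lambda>v. fder f x v * inverse (f x))) (at x)"
      using has_derivative_ln[OF assms(3)[OF x] Ck_on_SucD2[OF f x]] .
  next
    fix v
    show "Ck_on j (\<lambda>x. fder f x v * inverse (f x)) V"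
      using f Ck_on_SucD[OF f] assms by (intro Ck_on_mult Ck_on_inverse) (auto simp: less_imp_neq[symmetric])
  qed
  then show ?thesis using Suc by simp
qed

lemma Ck_on_exp:
  fixes f :: "'a::real_normed_vector \<Rightarrow> real"
  assumes "open V" "Ck_on k f V"
  shows "Ck_on k (\<lambda>x. exp (f x)) V"
  using assms(2)
proof (induction k)
  case 0
  then show ?case by (auto intro: continuous_on_exp)
next
  case (Suc k)
  show ?case
  proof (rule Ck_on_SucI[OF assms(1)])
    fix x assume x: "x \<in> V"
    show "((\<lambda>x. exp (f x)) has_derivative (\<lambda>v. fder f x v * exp (f x))) (at x)"
      using has_derivative_exp[OF Ck_on_SucD2[OF Suc.prems x]] .
  next
    fix v
    show "Ck_on k (\<lambda>x. fder f x v * exp (f x)) V"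
      using Suc.IH Ck_on_SucD[OF Suc.prems] Suc.prems assms by (intro Ck_on_mult) auto
  qed
qed

section \<open>Closure properties of smooth functions\<close>

lemma smooth_on_imp_continuous_on: "smooth_on f V \<Longrightarrow> continuous_on V f"
  unfolding smooth_on_def using Ck_on_imp_continuous_on by blast

lemma smooth_on_differentiable:
  "smooth_on f V \<Longrightarrow> x \<in> V \<Longrightarrow> f differentiable (at x)"
  unfolding smooth_on_def using Ck_on.simps(2)[of 0 f V] by blast

lemma smooth_on_has_derivative:
  "smooth_on f V \<Longrightarrow> x \<in> V \<Longrightarrow> (f has_derivative fder f x) (at x)"
  using smooth_on_differentiable frechet_derivative_works by blast

lemma smooth_on_frechet_derivative:
  "smooth_on f V \<Longrightarrow> smooth_on (\<lambda>x. fder f x v) V"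
  unfolding smooth_on_def using Ck_on.simps(2)[of _ f V] by blast

lemma smooth_on_cong:
  "open V \<Longrightarrow> (\<And>x. x \<in> V \<Longrightarrow> f x = g x) \<Longrightarrow> smooth_on f V \<Longrightarrow> smooth_on g V"
  unfolding smooth_on_def using Ck_on_cong by blast

lemma smooth_on_subset: "smooth_on f V \<Longrightarrow> W \<subseteq> V \<Longrightarrow> smooth_on f W"
  unfolding smooth_on_def using Ck_on_subset by blast

lemma smooth_on_const: "smooth_on (\<lambda>x. c) V"
  unfolding smooth_on_def using Ck_on_const by blast

lemma smooth_on_bounded_linear_comp:
  "bounded_linear L \<Longrightarrow> open V \<Longrightarrow> smooth_on f V \<Longrightarrow> smooth_on (\<lambda>x. L (f x)) V"
  unfolding smooth_on_def using Ck_on_bounded_linear_comp by blast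

lemma smooth_on_bounded_linear: "bounded_linear L \<Longrightarrow> open V \<Longrightarrow> smooth_on L V"
  unfolding smooth_on_def using Ck_on_bounded_linear by blast

lemma smooth_on_add:
  "open V \<Longrightarrow> smooth_on f V \<Longrightarrow> smooth_on g V \<Longrightarrow> smooth_on (\<lambda>x. f x + g x) V"
  unfolding smooth_on_def using Ck_on_add by blast

lemma smooth_on_sum:
  "open V \<Longrightarrow> (\<And>i. i \<in> I \<Longrightarrow> smooth_on (f i) V) \<Longrightarrow> smooth_on (\<lambda>x. \<Sum>i\<in>I. f i x) V"
  unfolding smooth_on_def by (simp add: Ck_on_sum)

lemma smooth_on_prod:
  fixes f :: "'i \<Rightarrow> 'a::real_normed_vector \<Rightarrow> 'b::real_normed_field"
  shows "open V \<Longrightarrow> (\<And>i. i \<in> I \<Longrightarrow> smooth_on (f i) V) \<Longrightarrow> smooth_on (\<lambda>x. \<Prod>i\<in>I. f i x) V"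
  unfolding smooth_on_def by (simp add: Ck_on_prod)

lemma smooth_on_mult:
  fixes f :: "'a::real_normed_vector \<Rightarrow> 'b::real_normed_field"
  shows "open V \<Longrightarrow> smooth_on f V \<Longrightarrow> smooth_on g V \<Longrightarrow> smooth_on (\<lambda>x. f x * g x) V"
  unfolding smooth_on_def by (simp add: Ck_on_mult)

lemma smooth_on_scaleR:
  "open V \<Longrightarrow> smooth_on f V \<Longrightarrow> smooth_on g V \<Longrightarrow> smooth_on (\<lambda>x. f x *\<^sub>R g x) V"
  unfolding smooth_on_def by (simp add: Ck_on_scaleR)

lemma smooth_on_inverse:
  fixes f :: "'a::real_normed_vector \<Rightarrow> 'b::real_normed_field"
  shows "open V \<Longrightarrow> smooth_on f V \<Longrightarrow> (\<And>x. x \<in> V \<Longrightarrow> f x \<noteq> 0) \<Longrightarrow> smooth_on (\<lambda>x. inverse (f x)) V"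
  unfolding smooth_on_def by (simp add: Ck_on_inverse)

lemma smooth_on_ln:
  fixes f :: "'a::real_normed_vector \<Rightarrow> real"
  shows "open V \<Longrightarrow> smooth_on f V \<Longrightarrow> (\<And>x. x \<in> V \<Longrightarrow> 0 < f x) \<Longrightarrow> smooth_on (\<lambda>x. ln (f x)) V"
  unfolding smooth_on_def by (simp add: Ck_on_ln)

lemma smooth_on_exp:
  fixes f :: "'a::real_normed_vector \<Rightarrow> real"
  shows "open V \<Longrightarrow> smooth_on f V \<Longrightarrow> smooth_on (\<lambda>x. exp (f x)) V"
  unfolding smooth_on_def by (simp add: Ck_on_exp)

lemma smooth_on_compose:
  fixes f :: "'a::real_normed_vector \<Rightarrow> 'b::euclidean_space"
  shows "open V \<Longrightarrow> open W \<Longrightarrow> smooth_on f V \<Longrightarrow> f ` V \<subseteq> W \<Longrightarrow> smooth_on g W \<Longrightarrow> smooth_on (\<lambda>x. g (f x)) V"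
  unfolding smooth_on_def using Ck_on_compose by blast

text \<open>The mean value estimate is applied in the direction u to the difference in the direction
  v, minus its expected linear part. Only differentiability of \<open>fder f _ u\<close> at x is
  used to control the resulting derivative.\<close>

lemma second_difference_bound:
  fixes f :: "'a::real_normed_vector \<Rightarrow> 'b::real_normed_vector"
  assumes V: "open V" and f: "smooth_on f V" and x: "x \<in> V" and e: "0 < e"
  obtains r where "0 < r" "\<And>s. 0 < s \<Longrightarrow> s < r \<Longrightarrow>
    norm (f (x + s *\<^sub>R u + s *\<^sub>R v) - f (x + s *\<^sub>R u) - (f (x + s *\<^sub>R v) - f x)
      - (s * s) *\<^sub>R fder (\<lambda>y. fder f y u) x v) \<le> e * (s * s)"
proof -
  \<comment> \<open>The two error terms have lengths at most s (|u| + |v|) and s |u|; C bounds their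
    sum divided by s, and the 1 keeps it positive when u = v = 0.\<close>
  define C where "C = 2 * norm u + norm v + 1"
  have C: "C > 0" unfolding C_def by (simp add: add_nonneg_pos)
  let ?fu = "\<lambda>y. fder f y u" and ?D = "fder (\<lambda>y. fder f y u) x"
  have D: "(?fu has_derivative ?D) (at x)"
    by (rule smooth_on_has_derivative[OF smooth_on_frechet_derivative[OF f] x])
  note lin = linear_add[OF has_derivative_linear[OF D]] linear_scale[OF has_derivative_linear[OF D]]
  obtain d where d: "0 < d" "\<And>w. norm w < d \<Longrightarrow> norm (?fu (x + w) - ?fu x - ?D w) \<le> e / C * norm w"
    using D e C unfolding has_derivative_at_alt
    by (metis add_diff_cancel_left' divide_pos_pos)
  obtain d' where d': "0 < d'" "\<And>w. norm w < d' \<Longrightarrow> x + w \<in> V"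
  proof -
    obtain r where "0 < r" "ball x r \<subseteq> V" using V x openE by blast
    then show ?thesis by (intro that[of r]) (auto simp: dist_norm subset_iff)
  qed
  define r where "r = min d d' / C"
  have "norm (f (x + s *\<^sub>R u + s *\<^sub>R v) - f (x + s *\<^sub>R u) - (f (x + s *\<^sub>R v) - f x) - (s * s) *\<^sub>R ?D v) \<le> e * (s * s)"
    if s: "0 < s" "s < r" for s
  proof -
    have small: "norm (a *\<^sub>R u + b *\<^sub>R v) \<le> s * (norm u + norm v)" "norm (a *\<^sub>R u + b *\<^sub>R v) < min d d'"
      if "a \<in> {0..s}" "b \<in> {0..s}" for a b
    proof -
      have "norm (a *\<^sub>R u + b *\<^sub>R v) \<le> a * norm u + b * norm v"
        using that norm_triangle_ineq[of "a *\<^sub>R u" "b *\<^sub>R v"] by simp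
      also have "\<dots> \<le> s * norm u + s * norm v" using that by (intro add_mono mult_right_mono) auto
      finally show le: "norm (a *\<^sub>R u + b *\<^sub>R v) \<le> s * (norm u + norm v)" by (simp add: distrib_left)
      also have "\<dots> \<le> s * C" using s(1) by (intro mult_left_mono) (simp_all add: C_def)
      also have "\<dots> < min d d'" using s(2) C by (simp add: r_def pos_less_divide_eq)
      finally show "norm (a *\<^sub>R u + b *\<^sub>R v) < min d d'" .
    qed
    have der: "((\<lambda>a. f (x + (a *\<^sub>R u + b *\<^sub>R v))) has_derivative (\<lambda>h. h *\<^sub>R ?fu (x + (a *\<^sub>R u + b *\<^sub>R v)))) (at a within {0..s})"
      if "a \<in> {0..s}" "b \<in> {0..s}" for a b
    proof -
      have "x + (a *\<^sub>R u + b *\<^sub>R v) \<in> V" using small(2)[OF that] by (intro d'(2)) simp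
      note D' = smooth_on_has_derivative[OF f this]
      have "((\<lambda>a. x + (a *\<^sub>R u + b *\<^sub>R v)) has_derivative (\<lambda>h. h *\<^sub>R u)) (at a within {0..s})"
        by (auto intro!: derivative_eq_intros)
      from has_derivative_compose[OF this D'] show ?thesis
        by (simp add: linear_scale[OF has_derivative_linear[OF D']])
    qed
    \<comment> \<open>The term with coefficient 0 of v is written out so that \<open>der\<close> and
      \<open>small\<close> apply to both difference terms in the same form.\<close>
    let ?p = "\<lambda>a. f (x + (a *\<^sub>R u + s *\<^sub>R v)) - f (x + (a *\<^sub>R u + 0 *\<^sub>R v)) - a *\<^sub>R (s *\<^sub>R ?D v)"
    let ?p' = "\<lambda>a h. h *\<^sub>R ?fu (x + (a *\<^sub>R u + s *\<^sub>R v)) - h *\<^sub>R ?fu (x + (a *\<^sub>R u + 0 *\<^sub>R v)) - h *\<^sub>R (s *\<^sub>R ?D v)"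
    have "norm (?p s - ?p 0) \<le> (e * s) * norm (s - 0)"
    proof (rule differentiable_bound[where S = "{0..s}" and f' = ?p'])
      fix a assume a: "a \<in> {0..s}"
      show "(?p has_derivative ?p' a) (at a within {0..s})"
        using a s by (intro has_derivative_diff der has_derivative_scaleR_left has_derivative_ident) auto
      let ?w = "a *\<^sub>R u + s *\<^sub>R v" and ?w' = "a *\<^sub>R u + 0 *\<^sub>R v"
      show "onorm (?p' a) \<le> e * s"
      proof (rule onorm_le)
        fix h :: real
        have "?p' a h = h *\<^sub>R ((?fu (x + ?w) - ?fu x - ?D ?w) - (?fu (x + ?w') - ?fu x - ?D ?w'))"
          by (simp add: lin algebra_simps)
        then have "norm (?p' a h) \<le> \<bar>h\<bar> * (norm (?fu (x + ?w) - ?fu x - ?D ?w) + norm (?fu (x + ?w') - ?fu x - ?D ?w'))"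
          by (simp only: norm_scaleR) (intro mult_left_mono norm_triangle_ineq4 abs_ge_zero)
        also have "\<dots> \<le> \<bar>h\<bar> * (e / C * norm ?w + e / C * norm ?w')"
          using small(2)[OF a, of s] small(2)[OF a, of 0] s by (intro mult_left_mono add_mono d(2)) auto
        also have "\<dots> \<le> \<bar>h\<bar> * (e / C * (s * C))"
        proof (rule mult_left_mono)
          have "norm ?w' \<le> s * norm u" using a by (auto intro: mult_right_mono)
          then have "norm ?w + norm ?w' \<le> s * C" using small(1)[OF a, of s] s by (simp add: C_def algebra_simps)
          from mult_left_mono[OF this, of "e / C"]
          show "e / C * norm ?w + e / C * norm ?w' \<le> e / C * (s * C)" using e C by (simp add: distrib_left)
        qed simp
        also have "\<dots> = e * s * norm h" using C by simp
        finally show "norm (?p' a h) \<le> e * s * norm h" .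
      qed
    qed (use s in auto)
    moreover have "?p s - ?p 0 = f (x + s *\<^sub>R u + s *\<^sub>R v) - f (x + s *\<^sub>R u) - (f (x + s *\<^sub>R v) - f x) - (s * s) *\<^sub>R ?D v"
      by (simp add: algebra_simps)
    ultimately show ?thesis using s(1) by (simp only: real_norm_def diff_0_right abs_of_pos mult.assoc)
  qed
  moreover have "0 < r" using d d' C by (simp add: r_def)
  ultimately show ?thesis using that by blast
qed

text \<open>The second difference is symmetric in u and v, so both iterated derivatives approximate
  the same quantity up to an arbitrarily small multiple of s^2.\<close>

lemma second_derivative_symmetric:
  fixes f :: "'a::real_normed_vector \<Rightarrow> 'b::real_normed_vector"
  assumes "open V" "smooth_on f V" "x \<in> V"
  shows "fder (\<lambda>y. fder f y u) x v = fder (\<lambda>y. fder f y v) x u" (is "?D = ?D'")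
proof -
  have "norm (?D - ?D') \<le> e" if "0 < e" for e
  proof -
    have e: "0 < e / 2" using that by simp
    obtain r where r: "0 < r" "\<And>s. 0 < s \<Longrightarrow> s < r \<Longrightarrow>
        norm (f (x + s *\<^sub>R u + s *\<^sub>R v) - f (x + s *\<^sub>R u) - (f (x + s *\<^sub>R v) - f x) - (s * s) *\<^sub>R ?D) \<le> e / 2 * (s * s)"
      using second_difference_bound[OF assms e, of u v] by blast
    obtain r' where r': "0 < r'" "\<And>s. 0 < s \<Longrightarrow> s < r' \<Longrightarrow>
        norm (f (x + s *\<^sub>R v + s *\<^sub>R u) - f (x + s *\<^sub>R v) - (f (x + s *\<^sub>R u) - f x) - (s * s) *\<^sub>R ?D') \<le> e / 2 * (s * s)"
      using second_difference_bound[OF assms e, of v u] by blast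
    define s where "s = min r r' / 2"
    have s: "0 < s" "s < r" "s < r'" using r(1) r'(1) by (auto simp: s_def)
    have "(s * s) *\<^sub>R (?D - ?D') =
        (f (x + s *\<^sub>R v + s *\<^sub>R u) - f (x + s *\<^sub>R v) - (f (x + s *\<^sub>R u) - f x) - (s * s) *\<^sub>R ?D') -
        (f (x + s *\<^sub>R u + s *\<^sub>R v) - f (x + s *\<^sub>R u) - (f (x + s *\<^sub>R v) - f x) - (s * s) *\<^sub>R ?D)"
      by (simp add: algebra_simps)
    then have "norm ((s * s) *\<^sub>R (?D - ?D')) \<le> e / 2 * (s * s) + e / 2 * (s * s)"
      by (simp only:) (rule order_trans[OF norm_triangle_ineq4 add_mono[OF r'(2)[OF s(1,3)] r(2)[OF s(1,2)]]])
    then have "(s * s) * norm (?D - ?D') \<le> (s * s) * e" by (simp add: mult.commute)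
    then show ?thesis using s(1) by simp
  qed
  then have "norm (?D - ?D') \<le> 0" using field_le_epsilon[of "norm (?D - ?D')" 0] by (simp only: add_0)
  then show ?thesis by simp
qed

section \<open>Wirtinger derivatives\<close>

text \<open>Treats \<open>dz\<close> (for \<open>e = - \<i>\<close>) and \<open>dzb\<close> (for \<open>e = \<i>\<close>) together.\<close>

lemma frechet_derivative_eqI: "(f has_derivative f') (at x) \<Longrightarrow> fder f x v = f' v"
  using frechet_derivative_at[of f f' x] by simp

definition wirtinger :: "complex \<Rightarrow> 'n \<Rightarrow> (complex^'n::finite \<Rightarrow> complex) \<Rightarrow> complex^'n \<Rightarrow> complex" where
  "wirtinger e j f z = (fder f z (axis j 1) + e * fder f z (axis j \<i>)) / 2"

lemma dz_eq_wirtinger: "dz = wirtinger (- \<i>)"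
  by (simp add: fun_eq_iff dz_def wirtinger_def)

lemma dzb_eq_wirtinger: "dzb = wirtinger \<i>"
  by (simp add: fun_eq_iff dzb_def wirtinger_def)

lemmas dz_dzb_eq = dz_eq_wirtinger dzb_eq_wirtinger

lemma wirtinger_eq:
  assumes "(f has_derivative f') (at z)"
  shows "wirtinger e j f z = (f' (axis j 1) + e * f' (axis j \<i>)) / 2"
  unfolding wirtinger_def frechet_derivative_at[OF assms, symmetric] ..

lemma wirtinger_cong:
  assumes "open V" "z \<in> V" "\<And>y. y \<in> V \<Longrightarrow> f y = g y"
  shows "wirtinger e j f z = wirtinger e j g z"
  using frechet_derivative_cong_open[of V z f g, OF assms] by (simp add: wirtinger_def)

lemma wirtinger_const: "wirtinger e j (\<lambda>z. c) z = 0"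
  by (simp add: wirtinger_def)

lemma wirtinger_add:
  assumes "f differentiable (at z)" "g differentiable (at z)"
  shows "wirtinger e j (\<lambda>z. f z + g z) z = wirtinger e j f z + wirtinger e j g z"
proof -
  note f = frechet_derivative_works[THEN iffD1, OF assms(1)]
  note g = frechet_derivative_works[THEN iffD1, OF assms(2)]
  show ?thesis
    unfolding wirtinger_eq[OF has_derivative_add[OF f g]] wirtinger_eq[OF f] wirtinger_eq[OF g]
    by (simp add: field_simps)
qed

lemma wirtinger_mult:
  assumes "f differentiable (at z)" "g differentiable (at z)"
  shows "wirtinger e j (\<lambda>z. f z * g z) z = wirtinger e j f z * g z + f z * wirtinger e j g z"
proof -
  note f = frechet_derivative_works[THEN iffD1, OF assms(1)]
  note g = frechet_derivative_works[THEN iffD1, OF assms(2)]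
  show ?thesis
    unfolding wirtinger_eq[OF has_derivative_mult[OF f g]] wirtinger_eq[OF f] wirtinger_eq[OF g]
    by (simp add: field_simps)
qed

lemma wirtinger_cmult:
  assumes "f differentiable (at z)"
  shows "wirtinger e j (\<lambda>z. c * f z) z = c * wirtinger e j f z"
  using wirtinger_mult[OF _ assms, of "\<lambda>_. c"] by (simp add: wirtinger_const)

lemma wirtinger_sum:
  assumes "\<And>i. i \<in> I \<Longrightarrow> f i differentiable (at z)"
  shows "wirtinger e j (\<lambda>z. \<Sum>i\<in>I. f i z) z = (\<Sum>i\<in>I. wirtinger e j (f i) z)"
  using assms
proof (induction I rule: infinite_finite_induct)
  case (insert x F)
  have "(\<lambda>z. \<Sum>i\<in>F. f i z) differentiable (at z)"
    using insert by (intro differentiable_sum) auto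
  then show ?case using insert by (simp add: wirtinger_add)
qed (simp_all add: wirtinger_const)

lemma wirtinger_prod:
  assumes "finite I" "\<And>i. i \<in> I \<Longrightarrow> f i differentiable (at z)"
  shows "wirtinger e j (\<lambda>z. \<Prod>i\<in>I. f i z) z = (\<Sum>i\<in>I. wirtinger e j (f i) z * (\<Prod>l\<in>I - {i}. f l z))"
proof -
  have f: "(f i has_derivative fder (f i) z) (at z)" if "i \<in> I" for i
    using assms(2)[OF that] frechet_derivative_works by blast
  have D: "wirtinger e j (\<lambda>z. \<Prod>i\<in>I. f i z) z =
      ((\<Sum>i\<in>I. fder (f i) z (axis j 1) * (\<Prod>l\<in>I - {i}. f l z)) +
       e * (\<Sum>i\<in>I. fder (f i) z (axis j \<i>) * (\<Prod>l\<in>I - {i}. f l z))) / 2"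
    by (rule wirtinger_eq[OF has_derivative_prod[OF f]])
  show ?thesis
    unfolding D unfolding wirtinger_def sum_distrib_left sum.distrib[symmetric] sum_divide_distrib
    by (intro sum.cong refl) (simp add: field_simps)
qed

lemma wirtinger_inverse:
  assumes "f differentiable (at z)" "f z \<noteq> 0"
  shows "wirtinger e j (\<lambda>z. inverse (f z)) z = - wirtinger e j f z * (inverse (f z))\<^sup>2"
proof -
  note f = frechet_derivative_works[THEN iffD1, OF assms(1)]
  show ?thesis
    unfolding wirtinger_eq[OF Deriv.has_derivative_inverse[OF assms(2) f]] wirtinger_eq[OF f]
    using assms(2) by (simp add: field_simps power2_eq_square)
qed

text \<open>Conjugation exchanges the parameters \<open>\<i>\<close> and \<open>- \<i>\<close>,
  hence \<open>dz\<close> and \<open>dzb\<close>; this makes conjugates of holomorphic functions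
  vanish under \<open>dz\<close>.\<close>

lemma wirtinger_cnj:
  assumes "f differentiable (at z)"
  shows "wirtinger e j (\<lambda>z. cnj (f z)) z = cnj (wirtinger (cnj e) j f z)"
proof -
  note f = frechet_derivative_works[THEN iffD1, OF assms(1)]
  show ?thesis
    unfolding wirtinger_eq[OF has_derivative_cnj[OF f]] wirtinger_eq[OF f] by simp
qed

lemma wirtinger_of_real_ln:
  fixes f :: "complex^'n::finite \<Rightarrow> real"
  assumes "f differentiable (at z)" "0 < f z"
  shows "wirtinger e j (\<lambda>z. of_real (ln (f z))) z = wirtinger e j (\<lambda>z. of_real (f z)) z / of_real (f z)"
proof -
  note f = frechet_derivative_works[THEN iffD1, OF assms(1)]
  show ?thesis
    unfolding wirtinger_eq[OF has_derivative_of_real[OF has_derivative_ln[OF assms(2) f]]]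
      wirtinger_eq[OF has_derivative_of_real[OF f]]
    using assms(2) by (simp add: field_simps)
qed

lemma smooth_on_wirtinger:
  assumes "open V" "smooth_on f V"
  shows "smooth_on (wirtinger e j f) V"
proof -
  have "smooth_on (\<lambda>z. inverse 2 * (fder f z (axis j 1) + e * fder f z (axis j \<i>))) V"
    by (intro smooth_on_mult smooth_on_add smooth_on_const smooth_on_frechet_derivative assms)
  then show ?thesis
    by (rule smooth_on_cong[OF assms(1), rotated]) (simp add: wirtinger_def field_simps)
qed

text \<open>Both operators are constant-coefficient combinations of real directional derivatives, so
  the claim splits into four instances of the symmetry of second derivatives.\<close>

lemma wirtinger_commute:
  assumes "open V" "smooth_on f V" "z \<in> V"
  shows "wirtinger e j (wirtinger e' k f) z = wirtinger e' k (wirtinger e j f) z"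
proof -
  let ?D = "\<lambda>u v. fder (\<lambda>y. fder f y u) z v"
  have *: "fder (wirtinger e k f) z v = (?D (axis k 1) v + e * ?D (axis k \<i>) v) / 2" for e k v
  proof -
    have "fder (wirtinger e k f) z v =
        inverse 2 * (?D (axis k 1) v + e * ?D (axis k \<i>) v)"
    proof (rule frechet_derivative_eqI)
      have D: "((\<lambda>y. fder f y u) has_derivative ?D u) (at z)" for u
        by (rule smooth_on_has_derivative[OF smooth_on_frechet_derivative[OF assms(2)] assms(3)])
      have "wirtinger e k f = (\<lambda>z. inverse 2 * (fder f z (axis k 1) + e * fder f z (axis k \<i>)))"
        by (simp add: fun_eq_iff wirtinger_def)
      then show "(wirtinger e k f has_derivative (\<lambda>v. inverse 2 * (?D (axis k 1) v + e * ?D (axis k \<i>) v))) (at z)"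
        by (simp only:) (intro has_derivative_mult_right has_derivative_add D)
    qed
    then show ?thesis by (simp only: divide_inverse mult.commute)
  qed
  note s = second_derivative_symmetric[OF assms]
  show ?thesis
    unfolding wirtinger_def[of e j] wirtinger_def[of e' k "wirtinger e j f"] *
      s[of "axis k 1" "axis j 1"] s[of "axis k \<i>" "axis j 1"] s[of "axis k 1" "axis j \<i>"] s[of "axis k \<i>" "axis j \<i>"]
    by (simp add: algebra_simps add_divide_distrib)
qed

section \<open>The real derivative and the chain rule in terms of Wirtinger operators\<close>

lemma complex_vec_eq_sum_axis:
  "(u :: complex^'n::finite) = (\<Sum>j\<in>UNIV. Re (u $ j) *\<^sub>R axis j 1 + Im (u $ j) *\<^sub>R axis j \<i>)"
proof -
  have "(\<Sum>j\<in>UNIV. Re (u $ j) *\<^sub>R axis j 1 $ i + Im (u $ j) *\<^sub>R axis j \<i> $ i) = u $ i" for i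
  proof -
    have "(\<Sum>j\<in>UNIV. Re (u $ j) *\<^sub>R axis j 1 $ i + Im (u $ j) *\<^sub>R axis j \<i> $ i) = (\<Sum>j\<in>UNIV. if j = i then u $ j else 0)"
      by (intro sum.cong refl) (auto simp: axis_def complex_eq_iff)
    then show ?thesis by simp
  qed
  then show ?thesis by (simp add: vec_eq_iff)
qed

lemma frechet_derivative_wirtinger:
  assumes "f differentiable (at z)"
  shows "fder f z u = (\<Sum>j\<in>UNIV. dz j f z * u $ j + dzb j f z * cnj (u $ j))"
proof -
  have l: "linear (fder f z)" by (rule linear_frechet_derivative[OF assms])
  have "fder f z u = fder f z (\<Sum>j\<in>UNIV. Re (u $ j) *\<^sub>R axis j 1 + Im (u $ j) *\<^sub>R axis j \<i>)"
    using complex_vec_eq_sum_axis[of u] by simp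
  also have "\<dots> = (\<Sum>j\<in>UNIV. Re (u $ j) *\<^sub>R fder f z (axis j 1) + Im (u $ j) *\<^sub>R fder f z (axis j \<i>))"
    by (simp add: linear_sum[OF l] linear_add[OF l] linear_scale[OF l])
  also have "\<dots> = (\<Sum>j\<in>UNIV. dz j f z * u $ j + dzb j f z * cnj (u $ j))"
    by (intro sum.cong refl) (simp add: dz_def dzb_def complex_eq_iff field_simps)
  finally show ?thesis .
qed

lemma differentiable_vec_lambda:
  fixes \<tau> :: "'a::real_normed_vector \<Rightarrow> complex^'p::finite"
  assumes "\<And>c. (\<lambda>z. \<tau> z $ c) differentiable (at z)"
  shows "(\<tau> has_derivative (\<lambda>v. \<chi> c. fder (\<lambda>z. \<tau> z $ c) z v)) (at z)"
proof -
  have "((\<lambda>z. \<tau> z $ c) has_derivative fder (\<lambda>z. \<tau> z $ c) z) (at z)" for c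
    using assms frechet_derivative_works by blast
  then show ?thesis
    unfolding has_derivative_componentwise_within[of \<tau>]
    by (auto simp: Basis_vec_def inner_axis intro!: has_derivative_inner_left)
qed

text \<open>The chain rule also has terms \<open>dz c f\<close> times \<open>dzb b\<close> of a
  component of \<tau>, which vanish by holomorphy. The surviving coefficients are conjugate Jacobian
  entries, the transition law of (0,1)-forms.\<close>

lemma dzb_compose_holo:
  fixes \<tau> :: "complex^'n::finite \<Rightarrow> complex^'p::finite"
  assumes f: "f differentiable (at (\<tau> z))"
    and \<tau>: "\<And>c. (\<lambda>z. \<tau> z $ c) differentiable (at z)" "\<And>c. dzb b (\<lambda>z. \<tau> z $ c) z = 0"
  shows "dzb b (\<lambda>z. f (\<tau> z)) z = (\<Sum>c\<in>UNIV. cnj (dz b (\<lambda>z. \<tau> z $ c) z) * dzb c f (\<tau> z))"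
proof -
  let ?t = "\<lambda>v. \<chi> c. fder (\<lambda>z. \<tau> z $ c) z v"
  have "((\<lambda>z. f (\<tau> z)) has_derivative (\<lambda>v. fder f (\<tau> z) (?t v))) (at z)"
    using has_derivative_compose[OF differentiable_vec_lambda[OF \<tau>(1)]] f frechet_derivative_works by blast
  from wirtinger_eq[OF this] have "dzb b (\<lambda>z. f (\<tau> z)) z =
     (fder f (\<tau> z) (?t (axis b 1)) + \<i> * fder f (\<tau> z) (?t (axis b \<i>))) / 2"
    by (simp add: dzb_eq_wirtinger)
  also have "\<dots> = (\<Sum>c\<in>UNIV. dz c f (\<tau> z) * dzb b (\<lambda>z. \<tau> z $ c) z + dzb c f (\<tau> z) * cnj (dz b (\<lambda>z. \<tau> z $ c) z))"
    unfolding frechet_derivative_wirtinger[OF f] sum_distrib_left sum.distrib[symmetric] sum_divide_distrib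
    by (intro sum.cong refl) (simp add: dz_def[of b] dzb_def[of b] field_simps)
  finally show ?thesis by (simp add: \<tau>(2) mult.commute)
qed

subsection \<open>Coordinates on a product\<close>

definition vec_join :: "complex^'n::finite \<Rightarrow> complex^'m::finite \<Rightarrow> complex^('n + 'm)" where
  "vec_join z w = (\<chi> j. case j of Inl \<alpha> \<Rightarrow> z $ \<alpha> | Inr k \<Rightarrow> w $ k)"

lemma vec_join_nth [simp]: "vec_join z w $ Inl a = z $ a" "vec_join z w $ Inr k = w $ k"
  by (simp_all add: vec_join_def)

lemma vec_join_inject [simp]: "vec_join z w = vec_join z' w' \<longleftrightarrow> z = z' \<and> w = w'"
proof
  assume *: "vec_join z w = vec_join z' w'"
  have "z $ a = z' $ a" "w $ b = w' $ b" for a b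
    using arg_cong[OF *, of "\<lambda>v. v $ Inl a"] arg_cong[OF *, of "\<lambda>v. v $ Inr b"] by simp_all
  then show "z = z' \<and> w = w'" by (simp add: vec_eq_iff)
qed simp

lemma bounded_linear_vec_join: "bounded_linear (\<lambda>p. vec_join (fst p) (snd p))"
  by (rule linear_conv_bounded_linear[THEN iffD1], rule linearI)
    (auto simp: vec_eq_iff vec_join_def split: sum.splits)

lemma vec_join_add: "vec_join z w = vec_join z 0 + vec_join 0 w"
  by (auto simp: vec_eq_iff vec_join_def split: sum.splits)

lemma vec_join_axis: "vec_join 0 (axis k c) = axis (Inr k) c"
  by (auto simp: vec_eq_iff vec_join_def axis_def split: sum.splits)

lemma continuous_on_vec_join [continuous_intros]:
  "continuous_on V f \<Longrightarrow> continuous_on V g \<Longrightarrow> continuous_on V (\<lambda>x. vec_join (f x) (g x))"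
  using bounded_linear.continuous_on[OF bounded_linear_vec_join continuous_on_Pair[of V f g]] by simp

lemma has_derivative_vec_join_right: "((\<lambda>w. vec_join z w) has_derivative (\<lambda>v. vec_join 0 v)) (at w)"
proof -
  have "((\<lambda>w. (z, w)) has_derivative (\<lambda>v. (0, v))) (at w)"
    by (rule has_derivative_Pair[OF has_derivative_const has_derivative_ident])
  from bounded_linear.has_derivative[OF bounded_linear_vec_join this] show ?thesis by simp
qed

lemma smooth_on_vec_join_right:
  assumes "open V"
  shows "smooth_on (\<lambda>w. vec_join z w) V"
proof -
  have "bounded_linear (\<lambda>w. vec_join 0 w)"
    by (rule has_derivative_bounded_linear[OF has_derivative_vec_join_right[of 0]])
  then have "smooth_on (\<lambda>w. vec_join z 0 + vec_join 0 w) V"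
    by (intro smooth_on_add smooth_on_const smooth_on_bounded_linear assms)
  then show ?thesis by (simp flip: vec_join_add)
qed

lemma smooth_on_vec_join_left:
  assumes "open V"
  shows "smooth_on (\<lambda>z. vec_join z w) V"
proof -
  have "linear (\<lambda>z. vec_join z 0)"
    by (rule linearI) (auto simp: vec_eq_iff vec_join_def split: sum.splits)
  then have "bounded_linear (\<lambda>z. vec_join z 0)" by (simp add: linear_conv_bounded_linear)
  then have "smooth_on (\<lambda>z. vec_join z 0 + vec_join 0 w) V"
    by (intro smooth_on_add smooth_on_const smooth_on_bounded_linear assms)
  then show ?thesis by (simp flip: vec_join_add)
qed

lemma frechet_derivative_vec_join:
  assumes "G differentiable (at (vec_join z w))"
  shows "((\<lambda>w. G (vec_join z w)) has_derivative (\<lambda>v. fder G (vec_join z w) (vec_join 0 v))) (at w)"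
  using has_derivative_compose[OF has_derivative_vec_join_right] assms frechet_derivative_works by blast

lemma wirtinger_vec_join:
  assumes "G differentiable (at (vec_join z w))"
  shows "wirtinger e k (\<lambda>w. G (vec_join z w)) w = wirtinger e (Inr k) G (vec_join z w)"
  unfolding wirtinger_eq[OF frechet_derivative_vec_join[OF assms]] by (simp add: vec_join_axis wirtinger_def)

section \<open>Hermitian matrices and determinants\<close>

lemma matrix_inv_works:
  assumes "invertible A"
  shows "A ** matrix_inv A = mat 1" "matrix_inv A ** A = mat 1"
  using someI_ex[OF assms[unfolded invertible_def]] unfolding matrix_inv_def by auto

lemma matrix_inv_eqI:
  fixes A :: "'a::field^'n^'n"
  assumes "A ** B = mat 1"
  shows "matrix_inv A = B"
proof -
  have "B ** A = mat 1" using assms matrix_left_right_inverse by blast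
  then have "invertible A" using assms invertible_def by blast
  then show ?thesis
    by (metis matrix_inv_works(2) assms matrix_mul_assoc matrix_mul_lid matrix_mul_rid)
qed

lemma trace_conj:
  fixes A B :: "'a::comm_ring_1^'n^'n"
  assumes "invertible B"
  shows "trace (B ** A ** matrix_inv B) = trace A"
  using trace_mul_sym[of "B ** A" "matrix_inv B"] matrix_inv_works(2)[OF assms]
  by (simp add: matrix_mul_assoc)

lemma mat_mult_left: "mat c ** (M :: complex^'n^'n) = (\<chi> a b. c * M $ a $ b)"
  by (simp add: vec_eq_iff matrix_matrix_mult_def mat_def if_distrib[of "\<lambda>x. x * _"] cong: if_cong)

lemma mat_mult_right: "(M :: complex^'n^'n) ** mat c = (\<chi> a b. c * M $ a $ b)"
  by (simp add: vec_eq_iff matrix_matrix_mult_def mat_def if_distrib[of "\<lambda>x. _ * x"] mult.commute cong: if_cong)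

lemma ctranspose_nth [simp]: "ctranspose M $ a $ b = cnj (M $ b $ a)"
  by (simp add: ctranspose_def)

lemma ctranspose_mult: "ctranspose (M ** N) = ctranspose N ** ctranspose M"
  by (simp add: vec_eq_iff matrix_matrix_mult_def mult.commute)

lemma ctranspose_mat: "ctranspose (mat c) = mat (cnj c)"
  by (auto simp: vec_eq_iff mat_def)

lemma det_ctranspose: "det (ctranspose M) = cnj (det M)"
proof -
  have "ctranspose M = transpose (\<chi> a b. cnj (M $ a $ b))" by (simp add: vec_eq_iff transpose_def)
  then have "det (ctranspose M) = det (\<chi> a b. cnj (M $ a $ b))" by simp
  also have "\<dots> = cnj (det M)" by (simp add: det_def)
  finally show ?thesis .
qed

lemma matrix_inv_mult:
  fixes A B :: "'a::field^'n^'n"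
  assumes "invertible A" "invertible B"
  shows "matrix_inv (A ** B) = matrix_inv B ** matrix_inv A"
proof (rule matrix_inv_eqI)
  have "A ** B ** (matrix_inv B ** matrix_inv A) = A ** (B ** matrix_inv B) ** matrix_inv A"
    by (simp add: matrix_mul_assoc)
  then show "A ** B ** (matrix_inv B ** matrix_inv A) = mat 1"
    using assms by (simp add: matrix_inv_works)
qed

lemma matrix_inv_ctranspose:
  assumes "invertible A"
  shows "matrix_inv (ctranspose A) = ctranspose (matrix_inv A)"
  by (rule matrix_inv_eqI) (simp add: matrix_inv_works[OF assms] ctranspose_mat flip: ctranspose_mult)

lemma invertible_ctranspose: "invertible A \<Longrightarrow> invertible (ctranspose A)"
  by (simp add: invertible_det_nz det_ctranspose)

lemma hermitian_pos_def_invertible: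
  assumes "hermitian_pos_def M"
  shows "invertible M"
proof -
  have "x = 0" if "M *v x = 0" for x
  proof (rule ccontr)
    assume x: "x \<noteq> 0"
    \<comment> \<open>The form pairs \<open>v $ a\<close> with \<open>cnj (v $ b)\<close>, so a
      kernel vector x of M has to be tested through its conjugate.\<close>
    define v where "v = (\<chi> b. cnj (x $ b))"
    have "v \<noteq> 0" using x by (simp add: v_def vec_eq_iff)
    then have "0 < Re (\<Sum>a\<in>UNIV. \<Sum>b\<in>UNIV. v $ a * M $ a $ b * cnj (v $ b))"
      using assms unfolding hermitian_pos_def_def by blast
    moreover have "(\<Sum>b\<in>UNIV. v $ a * M $ a $ b * cnj (v $ b)) = v $ a * (M *v x) $ a" for a
      by (simp add: matrix_vector_mult_def v_def sum_distrib_left mult.assoc)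
    ultimately show False using that by simp
  qed
  then show ?thesis using matrix_left_invertible_ker invertible_left_inverse by blast
qed

text \<open>The Schur complement of a diagonal entry is again positive definite.\<close>

lemma cholesky_on_finite:
  fixes M :: "'r \<Rightarrow> 'r \<Rightarrow> complex"
  assumes "finite I"
    and "\<And>a b. a \<in> I \<Longrightarrow> b \<in> I \<Longrightarrow> M b a = cnj (M a b)"
    and "\<And>v. \<exists>a\<in>I. v a \<noteq> 0 \<Longrightarrow> 0 < Re (\<Sum>a\<in>I. \<Sum>b\<in>I. v a * M a b * cnj (v b))"
  shows "\<exists>u. \<forall>a\<in>I. \<forall>b\<in>I. M a b = (\<Sum>m\<in>I. u a m * cnj (u b m))"
  using assms
proof (induction I arbitrary: M rule: finite_induct)
  case (insert p I)
  note herm = insert.prems(1) and pos = insert.prems(2)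
  define c where "c = Re (M p p)"
  have Mpp: "M p p = of_real c" using herm[of p p] by (simp add: c_def complex_eq_iff)
  \<comment> \<open>The form is tested on the unit vector at p, which isolates the diagonal entry
    \<open>M p p\<close>.\<close>
  have "0 < Re (\<Sum>a\<in>insert p I. \<Sum>b\<in>insert p I. of_bool (a = p) * M a b * cnj (of_bool (b = p)))"
    by (rule pos) auto
  moreover have "(\<Sum>a\<in>insert p I. \<Sum>b\<in>insert p I. of_bool (a = p) * M a b * cnj (of_bool (b = p))) = M p p"
  proof -
    have "of_bool (a = p) * M a b * cnj (of_bool (b = p)) = (if a = p then if b = p then M p p else 0 else 0)" for a b
      by auto
    moreover have "(\<Sum>b\<in>insert p I. if a = p then if b = p then M p p else 0 else 0) = (if a = p then M p p else 0)" for a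
      using insert.hyps by simp
    ultimately show ?thesis using insert.hyps by (simp only: finite_insert sum.delta insertI1 if_True)
  qed
  ultimately have c: "c > 0" by (simp add: Mpp)
  define N where "N a b = M a b - M a p * M p b / of_real c" for a b
  have "\<exists>u. \<forall>a\<in>I. \<forall>b\<in>I. N a b = (\<Sum>m\<in>I. u a m * cnj (u b m))"
  proof (rule insert.IH)
    fix a b assume "a \<in> I" "b \<in> I"
    then show "N b a = cnj (N a b)"
      using herm[of a b] herm[of a p] herm[of p b] by (simp add: N_def)
  next
    fix v :: "'r \<Rightarrow> complex" assume v: "\<exists>a\<in>I. v a \<noteq> 0"
    define X where "X = (\<Sum>a\<in>I. v a * M a p)"
    have X': "(\<Sum>b\<in>I. M p b * cnj (v b)) = cnj X"
      unfolding X_def cnj_sum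
    proof (rule sum.cong[OF refl])
      fix b assume "b \<in> I"
      then show "M p b * cnj (v b) = cnj (v b * M b p)" using herm[of b p] by simp
    qed
    \<comment> \<open>The entry at p completes the square: it minimizes the form of M among all
      extensions of v, and the minimum is the form of the Schur complement N at v.\<close>
    define w where "w a = (if a = p then - X / of_real c else v a)" for a
    have w: "w p = - X / of_real c" "\<And>a. a \<in> I \<Longrightarrow> w a = v a"
      using insert.hyps by (auto simp: w_def)
    have "0 < Re (\<Sum>a\<in>insert p I. \<Sum>b\<in>insert p I. w a * M a b * cnj (w b))"
      by (rule pos) (use v w in auto)
    also have "(\<Sum>a\<in>insert p I. \<Sum>b\<in>insert p I. w a * M a b * cnj (w b)) =
        w p * M p p * cnj (w p) + w p * (\<Sum>b\<in>I. M p b * cnj (v b)) + X * cnj (w p)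
        + (\<Sum>a\<in>I. \<Sum>b\<in>I. v a * M a b * cnj (v b))"
      using insert.hyps by (simp add: w(2) sum.distrib X_def sum_distrib_left sum_distrib_right mult.assoc)
    also have "\<dots> = (\<Sum>a\<in>I. \<Sum>b\<in>I. v a * M a b * cnj (v b)) - X * cnj X / of_real c"
      unfolding X' w(1) Mpp using c by (simp add: field_simps)
    also have "X * cnj X / of_real c = (\<Sum>a\<in>I. \<Sum>b\<in>I. v a * (M a p * M p b / of_real c) * cnj (v b))"
    proof -
      have "X * cnj X / of_real c = (\<Sum>a\<in>I. v a * M a p) * (\<Sum>b\<in>I. M p b * cnj (v b)) / of_real c"
        by (simp only: X' X_def[symmetric])
      then show ?thesis by (simp add: sum_product sum_divide_distrib mult_ac)
    qed
    also have "(\<Sum>a\<in>I. \<Sum>b\<in>I. v a * M a b * cnj (v b)) - \<dots> = (\<Sum>a\<in>I. \<Sum>b\<in>I. v a * N a b * cnj (v b))"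
      by (simp add: N_def right_diff_distrib left_diff_distrib sum_subtractf)
    finally show "0 < Re (\<Sum>a\<in>I. \<Sum>b\<in>I. v a * N a b * cnj (v b))" .
  qed
  then obtain u where u: "\<And>a b. a \<in> I \<Longrightarrow> b \<in> I \<Longrightarrow> N a b = (\<Sum>m\<in>I. u a m * cnj (u b m))" by blast
  \<comment> \<open>Column p carries the rank one part that was subtracted to form N; the remaining
    columns factor N and are 0 in row p.\<close>
  define u' where "u' a m = (if m = p then M a p / of_real (sqrt c) else if a = p then 0 else u a m)" for a m
  have "M a b = (\<Sum>m\<in>insert p I. u' a m * cnj (u' b m))" if "a \<in> insert p I" "b \<in> insert p I" for a b
  proof -
    have sq: "complex_of_real (sqrt c) * complex_of_real (sqrt c) = of_real c"
      using c by (simp flip: of_real_mult)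
    have "u' a p * cnj (u' b p) = M a p * cnj (M b p) / of_real c"
      by (simp add: u'_def sq)
    also have "\<dots> = M a p * M p b / of_real c" using herm[of b p] that by simp
    finally have p: "u' a p * cnj (u' b p) = M a p * M p b / of_real c" .
    have I: "(\<Sum>m\<in>I. u' a m * cnj (u' b m)) = (if a = p \<or> b = p then 0 else N a b)"
    proof (cases "a = p \<or> b = p")
      case True
      then show ?thesis using insert.hyps by (auto simp: u'_def intro!: sum.neutral)
    next
      case False
      then have "(\<Sum>m\<in>I. u' a m * cnj (u' b m)) = (\<Sum>m\<in>I. u a m * cnj (u b m))"
        using insert.hyps by (intro sum.cong) (auto simp: u'_def)
      then show ?thesis using False u that by auto
    qed
    show ?thesis
      using insert.hyps p I c by (auto simp: N_def Mpp)
  qed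
  then show ?case by blast
qed simp

text \<open>Passing to an orthonormal frame: P turns the forms built from M into sums of squared
  moduli, and it yields the sign of the determinant.\<close>

lemma hermitian_pos_def_factor:
  fixes M :: "complex^'r::finite^'r"
  assumes "hermitian_pos_def M"
  obtains P where "invertible P" "M = P ** ctranspose P"
proof -
  have "\<exists>u. \<forall>a\<in>UNIV. \<forall>b\<in>UNIV. M $ a $ b = (\<Sum>m::'r\<in>UNIV. u a m * cnj (u b m))"
  proof (rule cholesky_on_finite[where M = "\<lambda>a b. M $ a $ b"])
    fix a b show "M $ b $ a = cnj (M $ a $ b)"
      using assms ctranspose_nth[of M b a] by (simp add: hermitian_pos_def_def)
  next
    fix v :: "'r \<Rightarrow> complex" assume "\<exists>a\<in>UNIV. v a \<noteq> 0"
    then have "vec_lambda v \<noteq> 0" by (auto simp: vec_eq_iff)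
    then show "0 < Re (\<Sum>a\<in>UNIV. \<Sum>b\<in>UNIV. v a * M $ a $ b * cnj (v b))"
      using assms unfolding hermitian_pos_def_def by fastforce
  qed simp
  then obtain u where u: "\<And>a b. M $ a $ b = (\<Sum>m::'r\<in>UNIV. u a m * cnj (u b m))" by blast
  define P where "P = (\<chi> a m. u a m)"
  have M: "M = P ** ctranspose P" by (simp add: P_def vec_eq_iff matrix_matrix_mult_def u)
  moreover have "invertible P"
    using hermitian_pos_def_invertible[OF assms] by (auto simp: M invertible_det_nz det_mul)
  ultimately show ?thesis using that by blast
qed

text \<open>With M = P P^* the determinant is |det P|^2. This makes \<open>ln (Re (det M))\<close> a
  genuine smooth potential in which \<open>Re\<close> loses nothing.\<close>

lemma hermitian_pos_def_det:
  assumes "hermitian_pos_def M"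
  shows "0 < Re (det M)" "det M = of_real (Re (det M))"
proof -
  obtain P where P: "invertible P" "M = P ** ctranspose P"
    using hermitian_pos_def_factor[OF assms] .
  have "det M = of_real ((cmod (det P))\<^sup>2)"
    unfolding P(2) det_mul det_ctranspose complex_norm_square ..
  moreover have "det P \<noteq> 0" using P(1) invertible_det_nz by blast
  ultimately show "0 < Re (det M)" "det M = of_real (Re (det M))" by simp_all
qed

lemma hermitian_pos_def_scaleR:
  assumes "hermitian_pos_def M" "0 < c"
  shows "hermitian_pos_def (c *\<^sub>R M)"
proof -
  have "(\<Sum>a\<in>UNIV. \<Sum>b\<in>UNIV. v $ a * (c *\<^sub>R M) $ a $ b * cnj (v $ b)) =
        of_real c * (\<Sum>a\<in>UNIV. \<Sum>b\<in>UNIV. v $ a * M $ a $ b * cnj (v $ b))" for v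
    by (simp add: sum_distrib_left scaleR_conv_of_real[where 'a = complex] mult_ac)
  moreover have "ctranspose (c *\<^sub>R M) = c *\<^sub>R ctranspose M"
    by (simp add: vec_eq_iff)
  ultimately show ?thesis using assms by (simp add: hermitian_pos_def_def)
qed

text \<open>Cramer's rule exhibits each entry as a quotient of polynomials in the entries of A, from
  which smoothness and continuity of the inverse follow.\<close>

lemma matrix_inv_nth:
  fixes A :: "'a::field^'n^'n"
  assumes "det A \<noteq> 0"
  shows "matrix_inv A $ a $ b = det (\<chi> i j. if j = a then axis b 1 $ i else A $ i $ j) * inverse (det A)"
proof -
  have inv: "invertible A" using assms invertible_det_nz by blast
  have "A *v (matrix_inv A *v axis b 1) = axis b 1"
    using matrix_inv_works(1)[OF inv] by (simp add: matrix_vector_mul_assoc)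
  then have "matrix_inv A *v axis b 1 = (\<chi> k. det (\<chi> i j. if j = k then axis b 1 $ i else A $ i $ j) / det A)"
    using cramer[OF assms] by blast
  then have "(matrix_inv A *v axis b 1) $ a = det (\<chi> i j. if j = a then axis b 1 $ i else A $ i $ j) / det A" by simp
  moreover have "(matrix_inv A *v axis b 1) $ a = matrix_inv A $ a $ b"
    by (simp add: matrix_vector_mult_def axis_def if_distrib[of "\<lambda>x. _ * x"] cong: if_cong)
  ultimately show ?thesis by (simp add: divide_inverse)
qed

lemma smooth_on_det:
  fixes M :: "'b::real_normed_vector \<Rightarrow> complex^'n^'n"
  assumes "open V" "\<And>a b. smooth_on (\<lambda>z. M z $ a $ b) V"
  shows "smooth_on (\<lambda>z. det (M z)) V"
  unfolding det_def by (intro smooth_on_sum smooth_on_mult smooth_on_const smooth_on_prod assms)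

lemma smooth_on_matrix_inv:
  fixes M :: "'b::real_normed_vector \<Rightarrow> complex^'n^'n"
  assumes "open V" "\<And>a b. smooth_on (\<lambda>z. M z $ a $ b) V" "\<And>z. z \<in> V \<Longrightarrow> invertible (M z)"
  shows "smooth_on (\<lambda>z. matrix_inv (M z) $ a $ b) V"
proof -
  have "smooth_on (\<lambda>z. det (\<chi> i j. if j = a then axis b 1 $ i else M z $ i $ j) * inverse (det (M z))) V"
  proof (intro smooth_on_mult smooth_on_inverse smooth_on_det assms(1,2))
    show "smooth_on (\<lambda>z. (\<chi> i j. if j = a then axis b 1 $ i else M z $ i $ j) $ i $ j) V" for i j
      using assms(2) by (cases "j = a") (simp_all add: smooth_on_const)
  qed (use assms(3) invertible_det_nz in blast)
  then show ?thesis
    by (rule smooth_on_cong[OF assms(1), rotated])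
      (simp add: matrix_inv_nth assms(3) flip: invertible_det_nz)
qed

lemma continuous_on_det:
  fixes M :: "'b::topological_space \<Rightarrow> complex^'n^'n"
  assumes "continuous_on V M"
  shows "continuous_on V (\<lambda>z. det (M z))"
  unfolding det_def by (intro continuous_intros assms)

lemma continuous_on_matrix_inv:
  fixes M :: "'b::topological_space \<Rightarrow> complex^'n^'n"
  assumes "continuous_on V M" "\<And>z. z \<in> V \<Longrightarrow> invertible (M z)"
  shows "continuous_on V (\<lambda>z. matrix_inv (M z))"
proof -
  have nz: "det (M z) \<noteq> 0" if "z \<in> V" for z
    using assms(2)[OF that] invertible_det_nz by blast
  have "continuous_on V (\<lambda>z. (\<chi> a b. det (\<chi> i j. if j = a then axis b 1 $ i else M z $ i $ j) * inverse (det (M z))))"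
  proof (intro continuous_on_vec_lambda continuous_on_mult continuous_on_inverse continuous_on_det assms(1))
    show "continuous_on V (\<lambda>z. if j = a then axis b 1 $ i else M z $ i $ j)" for a b i j
      by (cases "j = a") (auto intro!: continuous_on_component assms(1) continuous_on_const)
  qed (use nz in auto)
  then show ?thesis
    by (rule continuous_on_eq) (simp add: vec_eq_iff matrix_inv_nth nz)
qed

text \<open>Jacobi's formula. The product rule differentiates one row at a time. With Y = D M^-1,
  row a of D is the combination of the rows of M with coefficients from row a of Y, so putting it in
  place of row a of M multiplies the determinant by Y_aa.\<close>

lemma wirtinger_det:
  fixes M :: "complex^'n::finite \<Rightarrow> complex^'r::finite^'r"
  assumes M: "\<And>a b. (\<lambda>z. M z $ a $ b) differentiable (at z)" and inv: "invertible (M z)"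
  shows "wirtinger e k (\<lambda>z. det (M z)) z =
    trace ((\<chi> a b. wirtinger e k (\<lambda>z. M z $ a $ b) z) ** matrix_inv (M z)) * det (M z)"
proof -
  define D where "D = (\<chi> a b. wirtinger e k (\<lambda>z. M z $ a $ b) z)"
  define Y where "Y = D ** matrix_inv (M z)"
  let ?R = "\<lambda>a. \<chi> i. if i = a then D $ a else M z $ i"
  have p: "(\<lambda>z. \<Prod>i\<in>UNIV. M z $ i $ p i) differentiable (at z)" for p :: "'r \<Rightarrow> 'r"
    unfolding differentiable_def
    by (rule exI, rule has_derivative_prod, rule M[unfolded frechet_derivative_works])
  have R: "(\<Prod>i\<in>UNIV. ?R a $ i $ p i) = D $ a $ p a * (\<Prod>l\<in>UNIV - {a}. M z $ l $ p l)" for a and p :: "'r \<Rightarrow> 'r"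
    by (subst prod.remove[of _ a]) (auto intro!: prod.cong)
  have "wirtinger e k (\<lambda>z. det (M z)) z =
      (\<Sum>p | p permutes (UNIV :: 'r set). of_int (sign p) * (\<Sum>a\<in>UNIV. D $ a $ p a * (\<Prod>l\<in>UNIV - {a}. M z $ l $ p l)))"
    unfolding det_def
    by (subst wirtinger_sum) (simp_all add: wirtinger_cmult p wirtinger_prod M D_def)
  also have "\<dots> = (\<Sum>a\<in>UNIV. det (?R a))"
    unfolding det_def R sum_distrib_left by (rule sum.swap)
  also have "\<dots> = (\<Sum>a\<in>UNIV. Y $ a $ a * det (M z))"
  proof (rule sum.cong[OF refl])
    fix a
    have "Y ** M z = D"
      unfolding Y_def using matrix_inv_works(2)[OF inv] by (simp flip: matrix_mul_assoc)
    then have D: "D $ a = (\<Sum>i\<in>UNIV. Y $ a $ i *s M z $ i)"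
      by (auto simp: vec_eq_iff matrix_matrix_mult_def)
    have "row i (M z) = M z $ i" for i by (simp add: row_def)
    then show "det (?R a) = Y $ a $ a * det (M z)"
      using cramer_lemma_transpose[of a "Y $ a" "M z"] by (simp only: D)
  qed
  finally show ?thesis
    by (simp add: trace_def sum_distrib_right flip: D_def Y_def)
qed

section \<open>Differentiation under the integral sign\<close>

lemma norm_integral_le:
  fixes f :: "'a \<Rightarrow> 'b::{banach, second_countable_topology}"
  assumes "integrable M f" "integrable M g" "\<And>x. norm (f x) \<le> g x"
  shows "norm (LINT x|M. f x) \<le> (LINT x|M. g x)"
  using integral_norm_bound[of M f] integral_mono[OF integrable_norm[OF assms(1)] assms(2,3)] by linarith

text \<open>Since f is controlled only on K, measurability is obtained for f times the indicator of
  K, which the weight cannot tell from f. Boundedness on the compact K then gives the dominating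
  function.\<close>

lemma integrable_weight:
  fixes f :: "'x::topological_space \<Rightarrow> 'b::{banach, second_countable_topology}" and \<eta> :: "'x \<Rightarrow> real"
  assumes M: "sets M = sets borel" and K: "compact K" "closed K"
    and \<eta>: "integrable M \<eta>" "\<And>x. x \<notin> K \<Longrightarrow> \<eta> x = 0"
    and f: "continuous_on K f"
  shows "integrable M (\<lambda>x. \<eta> x *\<^sub>R f x)"
proof -
  have eq: "(\<lambda>x. \<eta> x *\<^sub>R f x) = (\<lambda>x. \<eta> x *\<^sub>R (indicator K x *\<^sub>R f x))"
    using \<eta>(2) by (auto simp: fun_eq_iff indicator_def)
  have "(\<lambda>x. indicator K x *\<^sub>R f x) \<in> borel_measurable borel"
    by (intro borel_measurable_continuous_on_indicator f) (use K in auto)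
  then have "(\<lambda>x. indicator K x *\<^sub>R f x) \<in> borel_measurable M"
    using measurable_cong_sets[OF M refl] by blast
  then have meas: "(\<lambda>x. \<eta> x *\<^sub>R f x) \<in> borel_measurable M"
    unfolding eq using borel_measurable_integrable[OF \<eta>(1)] by measurable
  have "bounded (f ` K)" by (intro compact_imp_bounded compact_continuous_image f K)
  then obtain C where C: "\<And>x. x \<in> K \<Longrightarrow> norm (f x) \<le> C" unfolding bounded_iff by auto
  have "norm (\<eta> x *\<^sub>R f x) \<le> norm (C * \<eta> x)" for x
  proof (cases "x \<in> K")
    case True
    then have "\<bar>\<eta> x\<bar> * norm (f x) \<le> \<bar>\<eta> x\<bar> * \<bar>C\<bar>" using C[of x] by (intro mult_left_mono) auto
    then show ?thesis by (simp add: abs_mult mult.commute)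
  qed (simp add: \<eta>)
  then show ?thesis
    by (intro Bochner_Integration.integrable_bound[OF integrable_mult_right[OF \<eta>(1), of C] meas]) simp
qed

text \<open>Compactness of K makes continuity in the parameter uniform in x, which supplies one
  radius for the whole integrand.\<close>

lemma continuous_on_prod_compact_uniform:
  fixes G :: "'x::topological_space \<Rightarrow> 'w::metric_space \<Rightarrow> 'b::metric_space"
  assumes "compact K" "continuous_on (K \<times> W) (\<lambda>(x, w). G x w)" "open W" "w\<^sub>0 \<in> W" "0 < e"
  obtains d where "0 < d" "ball w\<^sub>0 d \<subseteq> W" "\<And>w x. w \<in> ball w\<^sub>0 d \<Longrightarrow> x \<in> K \<Longrightarrow> dist (G x w) (G x w\<^sub>0) \<le> e"
proof -
  have "continuous_on (W \<times> K) (\<lambda>p. (\<lambda>(x, w). G x w) (snd p, fst p))"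
    by (rule continuous_on_compose2[OF assms(2)]) (auto intro!: continuous_intros)
  then have c: "continuous_on (W \<times> K) (\<lambda>(w, x). G x w)" by (simp add: case_prod_unfold)
  obtain X0 where X0: "w\<^sub>0 \<in> X0" "open X0"
    "\<forall>w\<in>X0 \<inter> W. \<forall>x\<in>K. dist ((\<lambda>(w, x). G x w) (w, x)) ((\<lambda>(w, x). G x w) (w\<^sub>0, x)) \<le> e"
    using continuous_on_prod_compactE[OF c assms(1,4,5)] by blast
  have "open (X0 \<inter> W)" "w\<^sub>0 \<in> X0 \<inter> W" using X0 assms by auto
  then obtain d where "0 < d" "ball w\<^sub>0 d \<subseteq> X0 \<inter> W" using openE by blast
  then show ?thesis using X0(3) by (intro that[of d]) (auto simp: subset_iff)
qed

lemma continuous_on_slice: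
  assumes "continuous_on (K \<times> W) (\<lambda>(x, w). G x w)" "w \<in> W"
  shows "continuous_on K (\<lambda>x. G x w)"
proof -
  have "continuous_on K (\<lambda>x. (\<lambda>(x, w). G x w) (x, w))"
    by (rule continuous_on_compose2[OF assms(1)]) (use assms(2) in \<open>auto intro!: continuous_intros\<close>)
  then show ?thesis by simp
qed

text \<open>Continuity of the derivatives is known one direction at a time; this converts bounds on
  finitely many basis directions into an operator norm bound.\<close>

lemma norm_linear_le_Basis:
  fixes f :: "'a::euclidean_space \<Rightarrow> 'b::real_normed_vector"
  assumes "linear f" "\<And>b. b \<in> Basis \<Longrightarrow> norm (f b) \<le> c"
  shows "norm (f v) \<le> norm v * (real DIM('a) * c)"
proof -
  have "norm (f v) \<le> (\<Sum>b\<in>Basis. norm ((v \<bullet> b) *\<^sub>R f b))"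
    using linear_euclidean_sum[OF assms(1), of v] norm_sum by metis
  also have "\<dots> \<le> (\<Sum>b\<in>(Basis :: 'a set). norm v * c)"
    using assms(2) Basis_le_norm[of _ v] by (intro sum_mono) (auto intro!: mult_mono)
  finally show ?thesis by (simp add: mult_ac)
qed

text \<open>By the mean value inequality the linearization error of \<open>G x\<close> is at most a
  small multiple of |y - w|, uniformly for x in K. Integrating against the weight preserves this
  bound up to the factor \<open>I\<close>, the integral of |\<eta>|.\<close>

lemma has_derivative_param_integral:
  fixes G :: "'x::topological_space \<Rightarrow> 'w::euclidean_space \<Rightarrow> 'b::{banach, second_countable_topology}"
    and \<eta> :: "'x \<Rightarrow> real"
  assumes M: "sets M = sets borel" and K: "compact K" "closed K"
    and \<eta>: "integrable M \<eta>" "\<And>x. x \<notin> K \<Longrightarrow> \<eta> x = 0"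
    and W: "open W" and w: "w \<in> W"
    and der: "\<And>x w. x \<in> K \<Longrightarrow> w \<in> W \<Longrightarrow> (G x has_derivative G' x w) (at w)"
    and cont: "continuous_on (K \<times> W) (\<lambda>(x, w). G x w)"
    and cont': "\<And>v. continuous_on (K \<times> W) (\<lambda>(x, w). G' x w v)"
  shows "((\<lambda>w. LINT x|M. \<eta> x *\<^sub>R G x w) has_derivative (\<lambda>v. LINT x|M. \<eta> x *\<^sub>R G' x w v)) (at w)"
proof -
  have int: "integrable M (\<lambda>x. \<eta> x *\<^sub>R G x w)" if "w \<in> W" for w
    by (rule integrable_weight[OF M K \<eta> continuous_on_slice[OF cont that]])
  have int': "integrable M (\<lambda>x. \<eta> x *\<^sub>R G' x w v)" for v
    by (rule integrable_weight[OF M K \<eta> continuous_on_slice[OF cont' w]])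
  have lin: "linear (G' x w)" if "x \<in> K" for x
    using has_derivative_linear[OF der[OF that w]] .
  have "linear (\<lambda>v. LINT x|M. \<eta> x *\<^sub>R G' x w v)"
  proof (rule linearI)
    fix u v
    have "\<eta> x *\<^sub>R G' x w (u + v) = \<eta> x *\<^sub>R G' x w u + \<eta> x *\<^sub>R G' x w v" for x
      using \<eta>(2)[of x] linear_add[OF lin, of x u v] by (cases "x \<in> K") (auto simp: scaleR_add_right)
    then show "(LINT x|M. \<eta> x *\<^sub>R G' x w (u + v)) = (LINT x|M. \<eta> x *\<^sub>R G' x w u) + (LINT x|M. \<eta> x *\<^sub>R G' x w v)"
      using int' by simp
  next
    fix c v
    have "\<eta> x *\<^sub>R G' x w (c *\<^sub>R v) = c *\<^sub>R (\<eta> x *\<^sub>R G' x w v)" for x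
      using \<eta>(2)[of x] linear_scale[OF lin, of x c v] by (cases "x \<in> K") auto
    then have "(LINT x|M. \<eta> x *\<^sub>R G' x w (c *\<^sub>R v)) = (LINT x|M. c *\<^sub>R (\<eta> x *\<^sub>R G' x w v))"
      by (simp only:)
    also have "\<dots> = c *\<^sub>R (LINT x|M. \<eta> x *\<^sub>R G' x w v)"
      by (rule Bochner_Integration.integral_scaleR_right)
    finally show "(LINT x|M. \<eta> x *\<^sub>R G' x w (c *\<^sub>R v)) = c *\<^sub>R (LINT x|M. \<eta> x *\<^sub>R G' x w v)" .
  qed
  then have bl: "bounded_linear (\<lambda>v. LINT x|M. \<eta> x *\<^sub>R G' x w v)"
    by (simp add: linear_conv_bounded_linear)
  define I where "I = (LINT x|M. \<bar>\<eta> x\<bar>)"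
  have I: "I \<ge> 0" unfolding I_def by simp
  have "\<exists>d>0. \<forall>y. norm (y - w) < d \<longrightarrow>
      norm ((LINT x|M. \<eta> x *\<^sub>R G x y) - (LINT x|M. \<eta> x *\<^sub>R G x w) - (LINT x|M. \<eta> x *\<^sub>R G' x w (y - w))) \<le> e * norm (y - w)"
    if "0 < e" for e
  proof -
    \<comment> \<open>The final error is e' times \<open>DIM('w) * I\<close>; adding 1 to the
      divisor covers the case I = 0.\<close>
    define e' where "e' = e / (DIM('w) * I + 1)"
    have pos: "DIM('w) * I + 1 > 0" using I by (simp add: add_nonneg_pos)
    have e': "e' > 0" using that pos unfolding e'_def by simp
    have "\<exists>d. \<forall>b\<in>Basis. 0 < d b \<and> ball w (d b) \<subseteq> W \<and> (\<forall>y\<in>ball w (d b). \<forall>x\<in>K. dist (G' x y b) (G' x w b) \<le> e')"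
      using continuous_on_prod_compact_uniform[OF K(1) cont' W w e'] by (intro bchoice ballI) metis
    then obtain d where d: "\<And>b. b \<in> Basis \<Longrightarrow> 0 < d b" "\<And>b. b \<in> Basis \<Longrightarrow> ball w (d b) \<subseteq> W"
      "\<And>b y x. b \<in> Basis \<Longrightarrow> y \<in> ball w (d b) \<Longrightarrow> x \<in> K \<Longrightarrow> dist (G' x y b) (G' x w b) \<le> e'" by blast
    define r where "r = Min (d ` Basis)"
    have r: "r > 0" unfolding r_def using d(1) by simp
    have rd: "ball w r \<subseteq> ball w (d b)" if "b \<in> Basis" for b
      unfolding r_def using that by (intro subset_ball) simp
    have rW: "ball w r \<subseteq> W" using rd d(2) nonempty_Basis by blast
    show ?thesis
    proof (intro exI[of _ r] conjI allI impI r)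
      fix y assume "norm (y - w) < r"
      then have y: "y \<in> ball w r" by (simp add: dist_norm norm_minus_commute)
      have est: "norm (G x y - G x w - G' x w (y - w)) \<le> norm (y - w) * (DIM('w) * e')" if x: "x \<in> K" for x
      proof (rule differentiable_bound_linearization[where S = "ball w r" and f' = "G' x"])
        show "w + t *\<^sub>R (y - w) \<in> ball w r" if "t \<in> {0..1}" for t
        proof -
          have "norm (t *\<^sub>R (y - w)) \<le> norm (y - w)" using that by (simp add: mult_left_le_one_le)
          then show ?thesis using y by (simp add: dist_norm norm_minus_commute)
        qed
        show "(G x has_derivative G' x u) (at u within ball w r)" if "u \<in> ball w r" for u
          using der[OF x] rW that has_derivative_at_withinI by blast
        show "onorm (G' x u - G' x w) \<le> real DIM('w) * e'" if u: "u \<in> ball w r" for u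
        proof (rule onorm_le)
          fix v
          have "linear (\<lambda>i. G' x u i - G' x w i)"
            using linear_compose_sub[OF has_derivative_linear[OF der[OF x]] lin[OF x]] u rW by blast
          moreover have "norm (G' x u b - G' x w b) \<le> e'" if "b \<in> Basis" for b
            using d(3)[OF that _ x] rd[OF that] u by (auto simp: dist_norm)
          ultimately have "norm (G' x u v - G' x w v) \<le> norm v * (DIM('w) * e')"
            using norm_linear_le_Basis[where f = "\<lambda>i. G' x u i - G' x w i"] by blast
          then show "norm ((G' x u - G' x w) v) \<le> DIM('w) * e' * norm v" by (simp add: mult.commute)
        qed
        show "w \<in> ball w r" using r by simp
      qed
      have "(LINT x|M. \<eta> x *\<^sub>R G x y) - (LINT x|M. \<eta> x *\<^sub>R G x w) - (LINT x|M. \<eta> x *\<^sub>R G' x w (y - w))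
          = (LINT x|M. \<eta> x *\<^sub>R (G x y - G x w - G' x w (y - w)))"
        using int[of y] int[OF w] int' y rW by (auto simp: scaleR_diff_right)
      also have "norm \<dots> \<le> (LINT x|M. norm (y - w) * (DIM('w) * e') * \<bar>\<eta> x\<bar>)"
      proof (rule norm_integral_le)
        show "integrable M (\<lambda>x. \<eta> x *\<^sub>R (G x y - G x w - G' x w (y - w)))"
          using int[of y] int[OF w] int' y rW by (auto simp: scaleR_diff_right)
        show "integrable M (\<lambda>x. norm (y - w) * (DIM('w) * e') * \<bar>\<eta> x\<bar>)"
          using \<eta>(1) by simp
        fix x
        show "norm (\<eta> x *\<^sub>R (G x y - G x w - G' x w (y - w))) \<le> norm (y - w) * (DIM('w) * e') * \<bar>\<eta> x\<bar>"
        proof (cases "x \<in> K")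
          case True
          then show ?thesis using mult_right_mono[OF est[OF True], of "\<bar>\<eta> x\<bar>"] by (simp add: mult.commute)
        qed (simp add: \<eta>(2))
      qed
      also have "\<dots> = (e' * (DIM('w) * I)) * norm (y - w)"
        unfolding I_def by (simp add: mult_ac)
      also have "\<dots> \<le> e * norm (y - w)"
      proof (rule mult_right_mono)
        have "e' * (DIM('w) * I) \<le> e' * (DIM('w) * I + 1)" using e' by (intro mult_left_mono) auto
        also have "\<dots> = e" using pos unfolding e'_def by simp
        finally show "e' * (DIM('w) * I) \<le> e" .
      qed simp
      finally show "norm ((LINT x|M. \<eta> x *\<^sub>R G x y) - (LINT x|M. \<eta> x *\<^sub>R G x w) - (LINT x|M. \<eta> x *\<^sub>R G' x w (y - w))) \<le> e * norm (y - w)" .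
    qed
  qed
  then show ?thesis using bl unfolding has_derivative_at_alt by blast
qed

section \<open>Parameter integrals in product coordinates\<close>

context
  fixes M :: "'x::topological_space measure" and K :: "'x set" and \<eta> :: "'x \<Rightarrow> real"
    and \<zeta> :: "'x \<Rightarrow> complex^'n::finite" and W :: "(complex^'m::finite) set" and V :: "(complex^('n + 'm)) set"
  assumes M: "sets M = sets borel" and K: "compact K" "closed K"
    and \<eta>: "integrable M \<eta>" "\<And>x. x \<notin> K \<Longrightarrow> \<eta> x = 0"
    and \<zeta>: "continuous_on K \<zeta>" and W: "open W"
    and V: "open V" "\<And>x w. x \<in> K \<Longrightarrow> w \<in> W \<Longrightarrow> vec_join (\<zeta> x) w \<in> V"
begin

lemma continuous_on_vec_join_param:
  assumes "continuous_on V G"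
  shows "continuous_on (K \<times> W) (\<lambda>(x, w). G (vec_join (\<zeta> x) w))"
  unfolding case_prod_unfold
  by (rule continuous_on_compose2[OF assms])
    (auto intro!: continuous_intros continuous_on_compose2[OF \<zeta>] V)

lemma has_derivative_vec_join_param_integral:
  fixes G :: "complex^('n + 'm) \<Rightarrow> 'b::{banach, second_countable_topology}"
  assumes "smooth_on G V" "w \<in> W"
  shows "((\<lambda>w. LINT x|M. \<eta> x *\<^sub>R G (vec_join (\<zeta> x) w)) has_derivative
    (\<lambda>v. LINT x|M. \<eta> x *\<^sub>R fder G (vec_join (\<zeta> x) w) (vec_join 0 v))) (at w)"
proof (rule has_derivative_param_integral[OF M K \<eta> W assms(2)])
  show "((\<lambda>w. G (vec_join (\<zeta> x) w)) has_derivative (\<lambda>v. fder G (vec_join (\<zeta> x) w) (vec_join 0 v))) (at w)"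
    if "x \<in> K" "w \<in> W" for x w
    by (rule frechet_derivative_vec_join[OF smooth_on_differentiable[OF assms(1) V(2)[OF that]]])
  show "continuous_on (K \<times> W) (\<lambda>(x, w). G (vec_join (\<zeta> x) w))"
    by (rule continuous_on_vec_join_param[OF smooth_on_imp_continuous_on[OF assms(1)]])
  show "continuous_on (K \<times> W) (\<lambda>(x, w). fder G (vec_join (\<zeta> x) w) (vec_join 0 v))" for v
    by (rule continuous_on_vec_join_param[OF smooth_on_imp_continuous_on[OF smooth_on_frechet_derivative[OF assms(1)]]])
qed

text \<open>The derivative in direction v is an integral of the same shape, with G replaced by its
  derivative in direction \<open>vec_join 0 v\<close>. The induction therefore runs over all smooth
  G at once.\<close>

lemma smooth_on_param_integral:
  fixes G :: "complex^('n + 'm) \<Rightarrow> 'b::{banach, second_countable_topology}"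
  assumes "smooth_on G V"
  shows "smooth_on (\<lambda>w. LINT x|M. \<eta> x *\<^sub>R G (vec_join (\<zeta> x) w)) W"
proof -
  have "Ck_on k (\<lambda>w. LINT x|M. \<eta> x *\<^sub>R G (vec_join (\<zeta> x) w)) W" for k
    using assms
  proof (induction k arbitrary: G)
    case 0
    show ?case
      using has_derivative_continuous[OF has_derivative_vec_join_param_integral[OF 0]]
      by (simp add: continuous_at_imp_continuous_on)
  next
    case (Suc k)
    show ?case
      by (rule Ck_on_SucI[OF W has_derivative_vec_join_param_integral[OF Suc.prems]])
        (auto intro: Suc.IH smooth_on_frechet_derivative[OF Suc.prems])
  qed
  then show ?thesis unfolding smooth_on_def by blast
qed

lemma integrable_vec_join:
  fixes G :: "complex^('n + 'm) \<Rightarrow> 'b::{banach, second_countable_topology}"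
  assumes "smooth_on G V" "w \<in> W"
  shows "integrable M (\<lambda>x. \<eta> x *\<^sub>R G (vec_join (\<zeta> x) w))"
  by (rule integrable_weight[OF M K \<eta> continuous_on_slice[OF continuous_on_vec_join_param assms(2)]])
    (use smooth_on_imp_continuous_on[OF assms(1)] in auto)

lemma wirtinger_param_integral:
  assumes "smooth_on G V" "w \<in> W"
  shows "wirtinger e k (\<lambda>w. LINT x|M. \<eta> x *\<^sub>R G (vec_join (\<zeta> x) w)) w =
    (LINT x|M. \<eta> x *\<^sub>R wirtinger e (Inr k) G (vec_join (\<zeta> x) w))"
proof -
  let ?D = "\<lambda>v x. fder G (vec_join (\<zeta> x) w) v"
  have i: "integrable M (\<lambda>x. \<eta> x *\<^sub>R ?D v x)" for v
    using integrable_vec_join[OF smooth_on_frechet_derivative[OF assms(1)] assms(2)] .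
  have *: "((LINT x|M. a x) + e * (LINT x|M. b x)) / 2 = (LINT x|M. (a x + e * b x) / 2)"
    if "integrable M a" "integrable M b" for a b :: "'x \<Rightarrow> complex"
    using that by simp
  have "wirtinger e k (\<lambda>w. LINT x|M. \<eta> x *\<^sub>R G (vec_join (\<zeta> x) w)) w =
      ((LINT x|M. \<eta> x *\<^sub>R ?D (axis (Inr k) 1) x) + e * (LINT x|M. \<eta> x *\<^sub>R ?D (axis (Inr k) \<i>) x)) / 2"
    unfolding wirtinger_eq[OF has_derivative_vec_join_param_integral[OF assms]] vec_join_axis ..
  also have "\<dots> = (LINT x|M. (\<eta> x *\<^sub>R ?D (axis (Inr k) 1) x + e * (\<eta> x *\<^sub>R ?D (axis (Inr k) \<i>) x)) / 2)"
    by (rule *[OF i i])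
  also have "\<dots> = (LINT x|M. \<eta> x *\<^sub>R wirtinger e (Inr k) G (vec_join (\<zeta> x) w))"
    by (intro Bochner_Integration.integral_cong refl)
      (simp add: wirtinger_def scaleR_conv_of_real algebra_simps add_divide_distrib)
  finally show ?thesis .
qed

end

section \<open>Charts\<close>

lemma chartD:
  assumes "topological_chart c"
  shows "open (fst c)" "open (snd c ` fst c)" "continuous_on (fst c) (snd c)"
    "continuous_on (snd c ` fst c) (chart_inv c)"
    "\<And>x. x \<in> fst c \<Longrightarrow> chart_inv c (snd c x) = x"
    "\<And>z. z \<in> snd c ` fst c \<Longrightarrow> chart_inv c z \<in> fst c"
    "\<And>z. z \<in> snd c ` fst c \<Longrightarrow> snd c (chart_inv c z) = z"
    "inj_on (snd c) (fst c)"
  using assms unfolding topological_chart_def homeomorphism_def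
  by (auto intro: inj_on_inverseI[of _ "chart_inv c"])

lemma open_chart_image:
  assumes "topological_chart c" "open W"
  shows "open (snd c ` (fst c \<inter> W))"
proof -
  note c = chartD[OF assms(1)]
  have "snd c ` (fst c \<inter> W) = snd c ` fst c \<inter> chart_inv c -` W"
    using c(5,6,7) by (auto simp: image_iff)
  then show ?thesis using continuous_open_preimage[OF c(4) c(2) assms(2)] by simp
qed

lemma atlasD:
  assumes "complex_atlas A"
  shows "c \<in> A \<Longrightarrow> topological_chart c" "c \<in> A \<Longrightarrow> c' \<in> A \<Longrightarrow> holo_transition c c'"
    "\<exists>c\<in>A. x \<in> fst c"
  using assms unfolding complex_atlas_def holo_charts_def by auto

lemma smooth_fun_chart:
  assumes "smooth_fun A W f" "c \<in> A"
  shows "smooth_on (\<lambda>z. f (chart_inv c z)) (snd c ` (fst c \<inter> W))"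
  using assms by (simp add: smooth_fun_def o_def)

lemma continuous_on_chart_cover:
  assumes A: "complex_atlas A" and W: "open W"
    and f: "\<And>c. c \<in> A \<Longrightarrow> continuous_on (fst c \<inter> W) f"
  shows "continuous_on W f"
proof -
  have "continuous_on (\<Union>c\<in>A. fst c \<inter> W) f"
    using f W chartD(1)[OF atlasD(1)[OF A]] by (intro continuous_on_open_UN) auto
  moreover have "(\<Union>c\<in>A. fst c \<inter> W) = W" using atlasD(3)[OF A] by auto
  ultimately show ?thesis by simp
qed

lemma continuous_on_chart_compose:
  assumes "topological_chart c" "continuous_on (snd c ` (fst c \<inter> W)) f"
  shows "continuous_on (fst c \<inter> W) (\<lambda>x. f (snd c x))"
  by (rule continuous_on_compose2[OF assms(2)])
    (use continuous_on_subset[OF chartD(3)[OF assms(1)]] in auto)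

lemma smooth_fun_imp_continuous_on:
  assumes A: "complex_atlas A" and "smooth_fun A W f" and W: "open W"
  shows "continuous_on W f"
proof (rule continuous_on_chart_cover[OF A W])
  fix c assume c: "c \<in> A"
  have "continuous_on (fst c \<inter> W) (\<lambda>x. f (chart_inv c (snd c x)))"
    by (rule continuous_on_chart_compose[OF atlasD(1)[OF A c]
          smooth_on_imp_continuous_on[OF smooth_fun_chart[OF assms(2) c]]])
  then show "continuous_on (fst c \<inter> W) f"
    by (rule continuous_on_eq) (simp add: chartD(5)[OF atlasD(1)[OF A c]])
qed

text \<open>K is the preimage of a closed coordinate ball and N that of the open ball. Such K serve
  as supports of the weights and, on a compact manifold, to bound its volume.\<close>

lemma compact_chart_neighbourhood:
  assumes A: "complex_atlas A" and c: "c \<in> A" and W: "open W" and x: "x \<in> fst c \<inter> W"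
  obtains K N where "x \<in> N" "open N" "N \<subseteq> K" "compact K" "K \<subseteq> fst c \<inter> W"
proof -
  note cc = chartD[OF atlasD(1)[OF A c]]
  obtain r where r: "r > 0" "cball (snd c x) r \<subseteq> snd c ` (fst c \<inter> W)"
    using open_chart_image[OF atlasD(1)[OF A c] W] x open_contains_cball by blast
  let ?K = "chart_inv c ` cball (snd c x) r" and ?N = "fst c \<inter> snd c -` ball (snd c x) r"
  have "compact ?K"
    using r by (intro compact_continuous_image continuous_on_subset[OF cc(4)]) auto
  moreover have "open ?N" using continuous_open_preimage[OF cc(3) cc(1)] by blast
  moreover have "?N \<subseteq> ?K"
  proof
    fix y assume y: "y \<in> ?N"
    then have "y = chart_inv c (snd c y)" "snd c y \<in> cball (snd c x) r" using cc(5) by auto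
    then show "y \<in> ?K" by blast
  qed
  moreover have "?K \<subseteq> fst c \<inter> W"
  proof
    fix y assume "y \<in> ?K"
    then obtain z where "z \<in> cball (snd c x) r" "y = chart_inv c z" by blast
    then obtain y' where "y' \<in> fst c \<inter> W" "z = snd c y'" using r(2) by blast
    then show "y \<in> fst c \<inter> W" using cc(5) \<open>y = chart_inv c z\<close> by auto
  qed
  ultimately show ?thesis using r(1) x by (intro that[of ?N ?K]) auto
qed

section \<open>Products and slices\<close>

lemma prod_atlasI: "c \<in> A \<Longrightarrow> d \<in> B \<Longrightarrow> prod_chart c d \<in> prod_atlas A B"
  by (auto simp: prod_atlas_def)

lemma prod_chart_simps [simp]:
  "fst (prod_chart c d) = fst c \<times> fst d"
  "snd (prod_chart c d) (x, s) = vec_join (snd c x) (snd d s)"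
  by (simp_all add: prod_chart_def vec_join_def)

lemma inj_on_prod_chart:
  assumes "topological_chart c" "topological_chart d"
  shows "inj_on (snd (prod_chart c d)) (fst c \<times> fst d)"
  using chartD(8)[OF assms(1)] chartD(8)[OF assms(2)]
  by (auto simp: inj_on_def)

lemma chart_inv_prod_chart:
  assumes "topological_chart c" "topological_chart d" "z \<in> snd c ` fst c" "w \<in> snd d ` fst d"
  shows "chart_inv (prod_chart c d) (vec_join z w) = (chart_inv c z, chart_inv d w)"
proof -
  have "chart_inv (prod_chart c d) (vec_join z w) = inv_into (fst c \<times> fst d) (snd (prod_chart c d)) (vec_join z w)"
    by (simp add: chart_inv_def)
  also have "\<dots> = (chart_inv c z, chart_inv d w)"
    by (rule inv_into_f_eq[OF inj_on_prod_chart[OF assms(1,2)]])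
      (use chartD[OF assms(1)] chartD[OF assms(2)] assms(3,4) in auto)
  finally show ?thesis .
qed

abbreviation prod_image ::
  "('x, 'n::finite) chart \<Rightarrow> ('s, 'm::finite) chart \<Rightarrow> ('x \<times> 's) set \<Rightarrow> (complex^('n + 'm)) set" where
  "prod_image c d W \<equiv> snd (prod_chart c d) ` (fst (prod_chart c d) \<inter> W)"

lemma prod_chart_image:
  "vec_join z w \<in> prod_image c d W \<longleftrightarrow>
   (\<exists>x\<in>fst c. \<exists>s\<in>fst d. (x, s) \<in> W \<and> z = snd c x \<and> w = snd d s)"
  by (force simp: image_iff)

lemma prod_imageE:
  assumes "topological_chart c" "topological_chart d" "u \<in> prod_image c d W"
  obtains x s where "x \<in> fst c" "s \<in> fst d" "(x, s) \<in> W" "u = vec_join (snd c x) (snd d s)"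
    "chart_inv (prod_chart c d) u = (x, s)"
  using assms(3) chart_inv_prod_chart[OF assms(1,2)] chartD(5)[OF assms(1)] chartD(5)[OF assms(2)]
  by fastforce

text \<open>Membership can be read off after splitting the coordinates: the set is the preimage of W
  under the two inverse charts applied to the coordinate projections, a continuous map on the open
  set \<open>?V\<close>.\<close>

lemma open_prod_chart_image:
  fixes c :: "('x::topological_space, 'n::finite) chart" and d :: "('s::topological_space, 'm::finite) chart"
  assumes "topological_chart c" "topological_chart d" "open W"
  shows "open (snd (prod_chart c d) ` (fst (prod_chart c d) \<inter> W))"
proof -
  note c = chartD[OF assms(1)] and d = chartD[OF assms(2)]
  let ?p = "\<lambda>u :: complex^('n + 'm). \<chi> a. u $ Inl a" and ?q = "\<lambda>u :: complex^('n + 'm). \<chi> k. u $ Inr k"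
  let ?V = "?p -` (snd c ` fst c) \<inter> ?q -` (snd d ` fst d)"
  have p: "continuous_on U ?p" and q: "continuous_on U ?q" for U
    by (intro continuous_intros)+
  have j: "vec_join (?p u) (?q u) = u" for u
    by (auto simp: vec_eq_iff vec_join_def split: sum.splits)
  have V: "open ?V"
    using c(2) d(2) p q by (intro open_Int open_vimage) auto
  have "continuous_on ?V (\<lambda>u. (chart_inv c (?p u), chart_inv d (?q u)))"
    by (intro continuous_on_Pair continuous_on_compose2[OF c(4) p] continuous_on_compose2[OF d(4) q]) auto
  then have "open (?V \<inter> (\<lambda>u. (chart_inv c (?p u), chart_inv d (?q u))) -` W)"
    using continuous_open_preimage V assms(3) by blast
  moreover have "?V \<inter> (\<lambda>u. (chart_inv c (?p u), chart_inv d (?q u))) -` W = snd (prod_chart c d) ` (fst (prod_chart c d) \<inter> W)" (is "?L = ?R")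
  proof (rule set_eqI)
    fix u
    have "u \<in> ?R \<longleftrightarrow> (\<exists>x\<in>fst c. \<exists>s\<in>fst d. (x, s) \<in> W \<and> ?p u = snd c x \<and> ?q u = snd d s)"
      using prod_chart_image[of "?p u" "?q u" c d W] unfolding j .
    also have "\<dots> \<longleftrightarrow> u \<in> ?L"
      using c(5,6,7) d(5,6,7) by (auto simp: image_iff) metis+
    finally show "u \<in> ?L \<longleftrightarrow> u \<in> ?R" ..
  qed
  ultimately show ?thesis by simp
qed

lemma has_derivative_vec_join_left: "((\<lambda>z. vec_join z w) has_derivative (\<lambda>v. vec_join v 0)) (at z)"
proof -
  have "((\<lambda>z. (z, w)) has_derivative (\<lambda>v. (v, 0))) (at z)"
    by (rule has_derivative_Pair[OF has_derivative_ident has_derivative_const])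
  from bounded_linear.has_derivative[OF bounded_linear_vec_join this] show ?thesis by simp
qed

lemma wirtinger_vec_join_left:
  assumes "G differentiable (at (vec_join z w))"
  shows "wirtinger e k (\<lambda>z. G (vec_join z w)) z = wirtinger e (Inl k) G (vec_join z w)"
proof -
  have a: "vec_join (axis k c) 0 = axis (Inl k) c" for c
    by (auto simp: vec_eq_iff vec_join_def axis_def split: sum.splits)
  have "((\<lambda>z. G (vec_join z w)) has_derivative (\<lambda>v. fder G (vec_join z w) (vec_join v 0))) (at z)"
    using has_derivative_compose[OF has_derivative_vec_join_left] assms frechet_derivative_works by blast
  from wirtinger_eq[OF this] show ?thesis by (simp add: a wirtinger_def)
qed

lemma open_slice_left:
  assumes "open W"
  shows "open {x. (x, s) \<in> W}"
proof -
  have "continuous_on UNIV (\<lambda>x. (x, s))" by (intro continuous_intros)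
  from open_vimage[OF assms this] show ?thesis by (simp add: vimage_def)
qed

lemma open_slice_right:
  assumes "open W"
  shows "open {s. (x, s) \<in> W}"
proof -
  have "continuous_on UNIV (\<lambda>s. (x, s))" by (intro continuous_intros)
  from open_vimage[OF assms this] show ?thesis by (simp add: vimage_def)
qed

section \<open>Freezing one of the two variables\<close>

context
  fixes c :: "('x::topological_space, 'n::finite) chart" and d :: "('s::topological_space, 'm::finite) chart"
    and W :: "('x \<times> 's) set"
  assumes c: "topological_chart c" and d: "topological_chart d" and W: "open W"
begin

lemma open_image_left: "open (snd c ` (fst c \<inter> {x. (x, s) \<in> W}))"
  by (rule open_chart_image[OF c open_slice_left[OF W]])

lemma open_image_right: "open (snd d ` (fst d \<inter> {s. (x, s) \<in> W}))"
  by (rule open_chart_image[OF d open_slice_right[OF W]])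

lemma slice_left_image:
  "s \<in> fst d \<Longrightarrow> (\<lambda>z. vec_join z (snd d s)) ` snd c ` (fst c \<inter> {x. (x, s) \<in> W}) \<subseteq> prod_image c d W"
  by (simp only: image_subset_iff prod_chart_image) auto

lemma slice_right_image:
  "x \<in> fst c \<Longrightarrow> (\<lambda>w. vec_join (snd c x) w) ` snd d ` (fst d \<inter> {s. (x, s) \<in> W}) \<subseteq> prod_image c d W"
  by (simp only: image_subset_iff prod_chart_image) auto

lemma slice_left_inv:
  assumes "s \<in> fst d" "z \<in> snd c ` (fst c \<inter> {x. (x, s) \<in> W})"
  shows "chart_inv (prod_chart c d) (vec_join z (snd d s)) = (chart_inv c z, s)"
  using chart_inv_prod_chart[OF c d, of z "snd d s"] assms chartD(5)[OF d] by auto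

lemma slice_right_inv:
  assumes "x \<in> fst c" "w \<in> snd d ` (fst d \<inter> {s. (x, s) \<in> W})"
  shows "chart_inv (prod_chart c d) (vec_join (snd c x) w) = (x, chart_inv d w)"
  using chart_inv_prod_chart[OF c d, of "snd c x" w] assms chartD(5)[OF c] by auto

lemma smooth_on_slice_left:
  assumes H: "smooth_on (\<lambda>u. H (chart_inv (prod_chart c d) u)) (prod_image c d W)" and s: "s \<in> fst d"
  shows "smooth_on (\<lambda>z. H (chart_inv c z, s)) (snd c ` (fst c \<inter> {x. (x, s) \<in> W}))"
proof (rule smooth_on_cong[OF open_image_left])
  show "smooth_on (\<lambda>z. H (chart_inv (prod_chart c d) (vec_join z (snd d s)))) (snd c ` (fst c \<inter> {x. (x, s) \<in> W}))"
    by (rule smooth_on_compose[OF open_image_left open_prod_chart_image[OF c d W] smooth_on_vec_join_left[OF open_image_left] slice_left_image[OF s] H])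
  fix z assume "z \<in> snd c ` (fst c \<inter> {x. (x, s) \<in> W})"
  then show "H (chart_inv (prod_chart c d) (vec_join z (snd d s))) = H (chart_inv c z, s)" by (simp add: slice_left_inv[OF s])
qed

lemma smooth_on_slice_right:
  assumes H: "smooth_on (\<lambda>u. H (chart_inv (prod_chart c d) u)) (prod_image c d W)" and x: "x \<in> fst c"
  shows "smooth_on (\<lambda>w. H (x, chart_inv d w)) (snd d ` (fst d \<inter> {s. (x, s) \<in> W}))"
proof (rule smooth_on_cong[OF open_image_right])
  show "smooth_on (\<lambda>w. H (chart_inv (prod_chart c d) (vec_join (snd c x) w))) (snd d ` (fst d \<inter> {s. (x, s) \<in> W}))"
    by (rule smooth_on_compose[OF open_image_right open_prod_chart_image[OF c d W] smooth_on_vec_join_right[OF open_image_right] slice_right_image[OF x] H])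
  fix w assume "w \<in> snd d ` (fst d \<inter> {s. (x, s) \<in> W})"
  then show "H (chart_inv (prod_chart c d) (vec_join (snd c x) w)) = H (x, chart_inv d w)" by (simp add: slice_right_inv[OF x])
qed

lemma wirtinger_slice_left:
  fixes H :: "'x \<times> 's \<Rightarrow> complex"
  assumes H: "smooth_on (\<lambda>u. H (chart_inv (prod_chart c d) u)) (prod_image c d W)"
    and s: "s \<in> fst d" and z: "z \<in> snd c ` (fst c \<inter> {x. (x, s) \<in> W})"
  shows "wirtinger e k (\<lambda>z. H (chart_inv c z, s)) z =
    wirtinger e (Inl k) (\<lambda>u. H (chart_inv (prod_chart c d) u)) (vec_join z (snd d s))"
proof -
  have "wirtinger e k (\<lambda>z. H (chart_inv c z, s)) z =
      wirtinger e k (\<lambda>z. H (chart_inv (prod_chart c d) (vec_join z (snd d s)))) z"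
    by (rule wirtinger_cong[OF open_image_left z]) (simp add: slice_left_inv[OF s])
  also have "\<dots> = wirtinger e (Inl k) (\<lambda>u. H (chart_inv (prod_chart c d) u)) (vec_join z (snd d s))"
    using smooth_on_differentiable[OF H] slice_left_image[OF s] z by (intro wirtinger_vec_join_left) blast
  finally show ?thesis .
qed

lemma wirtinger_slice_right:
  fixes H :: "'x \<times> 's \<Rightarrow> complex"
  assumes H: "smooth_on (\<lambda>u. H (chart_inv (prod_chart c d) u)) (prod_image c d W)"
    and x: "x \<in> fst c" and w: "w \<in> snd d ` (fst d \<inter> {s. (x, s) \<in> W})"
  shows "wirtinger e k (\<lambda>w. H (x, chart_inv d w)) w =
    wirtinger e (Inr k) (\<lambda>u. H (chart_inv (prod_chart c d) u)) (vec_join (snd c x) w)"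
proof -
  have "wirtinger e k (\<lambda>w. H (x, chart_inv d w)) w =
      wirtinger e k (\<lambda>w. H (chart_inv (prod_chart c d) (vec_join (snd c x) w))) w"
    by (rule wirtinger_cong[OF open_image_right w]) (simp add: slice_right_inv[OF x])
  also have "\<dots> = wirtinger e (Inr k) (\<lambda>u. H (chart_inv (prod_chart c d) u)) (vec_join (snd c x) w)"
    using smooth_on_differentiable[OF H] slice_right_image[OF x] w by (intro wirtinger_vec_join) blast
  finally show ?thesis .
qed

end

lemma smooth_fun_slice:
  assumes A: "complex_atlas A" and B: "complex_atlas B" and f: "smooth_fun (prod_atlas A B) W f" and W: "open W"
  shows "smooth_fun A {x. (x, s) \<in> W} (\<lambda>x. f (x, s))"
  unfolding smooth_fun_def o_def
proof
  fix c assume c: "c \<in> A"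
  obtain d where d: "d \<in> B" "s \<in> fst d" using atlasD(3)[OF B] by blast
  have "prod_chart c d \<in> prod_atlas A B" by (rule prod_atlasI[OF c d(1)])
  from smooth_on_slice_left[OF atlasD(1)[OF A c] atlasD(1)[OF B d(1)] W smooth_fun_chart[OF f this] d(2)]
  show "smooth_on (\<lambda>z. f (chart_inv c z, s)) (snd c ` (fst c \<inter> {x. (x, s) \<in> W}))" .
qed

lemma holo_mat_fun_slice:
  assumes A: "complex_atlas A" and B: "complex_atlas B" and f: "holo_mat_fun (prod_atlas A B) W f" and W: "open W"
  shows "holo_mat_fun A {x. (x, s) \<in> W} (\<lambda>x. f (x, s))"
  unfolding holo_mat_fun_def
proof (intro ballI allI)
  fix c a b assume c: "c \<in> A"
  obtain d where d: "d \<in> B" "s \<in> fst d" using atlasD(3)[OF B] by blast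
  note cd = atlasD(1)[OF A c] atlasD(1)[OF B d(1)]
  have "prod_chart c d \<in> prod_atlas A B" by (rule prod_atlasI[OF c d(1)])
  then have h: "holo_on (\<lambda>u. f (chart_inv (prod_chart c d) u) $ a $ b)
      (snd (prod_chart c d) ` (fst (prod_chart c d) \<inter> W))"
    using f unfolding holo_mat_fun_def by blast
  show "holo_on (\<lambda>z. f (chart_inv c z, s) $ a $ b) (snd c ` (fst c \<inter> {x. (x, s) \<in> W}))"
    unfolding holo_on_def
  proof (intro conjI ballI allI)
    show "smooth_on (\<lambda>z. f (chart_inv c z, s) $ a $ b) (snd c ` (fst c \<inter> {x. (x, s) \<in> W}))"
      using smooth_on_slice_left[OF cd W _ d(2), of "\<lambda>p. f p $ a $ b"] h by (simp add: holo_on_def)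
    fix z j assume z: "z \<in> snd c ` (fst c \<inter> {x. (x, s) \<in> W})"
    have "vec_join z (snd d s) \<in> snd (prod_chart c d) ` (fst (prod_chart c d) \<inter> W)"
      using slice_left_image[OF cd W d(2)] z by blast
    then have "dzb (Inl j) (\<lambda>u. f (chart_inv (prod_chart c d) u) $ a $ b) (vec_join z (snd d s)) = 0"
      using h unfolding holo_on_def by blast
    then show "dzb j (\<lambda>z. f (chart_inv c z, s) $ a $ b) z = 0"
      using wirtinger_slice_left[OF cd W _ d(2) z, of "\<lambda>p. f p $ a $ b" \<i> j] h
      unfolding holo_on_def dzb_eq_wirtinger by simp
  qed
qed

section \<open>Bundles and metrics restricted to a slice\<close>

lemma slice_bundle_simps [simp]:
  "idx (slice_bundle F s) = idx F" "bdom (slice_bundle F s) i = {x. (x, s) \<in> bdom F i}"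
  "frame_change (slice_bundle F s) i j x = frame_change F i j (x, s)"
  by (simp_all add: slice_bundle_def)

lemma holo_bundleD:
  assumes "holo_bundle A E"
  shows "i \<in> idx E \<Longrightarrow> open (bdom E i)" "\<exists>i\<in>idx E. x \<in> bdom E i"
    "i \<in> idx E \<Longrightarrow> x \<in> bdom E i \<Longrightarrow> frame_change E i i x = mat 1"
    "i \<in> idx E \<Longrightarrow> j \<in> idx E \<Longrightarrow> k \<in> idx E \<Longrightarrow> x \<in> bdom E i \<inter> bdom E j \<inter> bdom E k \<Longrightarrow>
      frame_change E i j x ** frame_change E j k x = frame_change E i k x"
    "i \<in> idx E \<Longrightarrow> j \<in> idx E \<Longrightarrow> holo_mat_fun A (bdom E i \<inter> bdom E j) (frame_change E i j)"
  using assms unfolding holo_bundle_def by blast+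

lemma holo_bundle_slice:
  assumes A: "complex_atlas A" and B: "complex_atlas B" and F: "holo_bundle (prod_atlas A B) F"
  shows "holo_bundle A (slice_bundle F s)"
  unfolding holo_bundle_def
proof (intro conjI ballI)
  fix i j assume "i \<in> idx (slice_bundle F s)" "j \<in> idx (slice_bundle F s)"
  then show "holo_mat_fun A (bdom (slice_bundle F s) i \<inter> bdom (slice_bundle F s) j) (frame_change (slice_bundle F s) i j)"
    using holo_mat_fun_slice[OF A B holo_bundleD(5)[OF F, of i j], of s] holo_bundleD(1)[OF F]
    by (simp add: slice_bundle_def Collect_conj_eq open_Int)
next
  fix i assume "i \<in> idx (slice_bundle F s)"
  then show "open (bdom (slice_bundle F s) i)"
    using open_slice_left[OF holo_bundleD(1)[OF F]] by simp
next
  show "(\<Union>i\<in>idx (slice_bundle F s). bdom (slice_bundle F s) i) = UNIV"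
    using holo_bundleD(2)[OF F] by auto
qed (use holo_bundleD(3,4)[OF F] in auto)

lemma invertible_frame_change:
  assumes "holo_bundle A E" "i \<in> idx E" "j \<in> idx E" "x \<in> bdom E i \<inter> bdom E j"
  shows "invertible (frame_change E i j x)"
proof -
  have "frame_change E i j x ** frame_change E j i x = mat 1"
    using holo_bundleD(4)[OF assms(1-3), of i x] holo_bundleD(3)[OF assms(1,2), of x] assms by auto
  moreover have "frame_change E j i x ** frame_change E i j x = mat 1"
    using holo_bundleD(4)[OF assms(1,3,2), of j x] holo_bundleD(3)[OF assms(1,3), of x] assms by auto
  ultimately show ?thesis unfolding invertible_def by blast
qed

lemma metricD:
  assumes "hermitian_metric A E h"
  shows "i \<in> idx E \<Longrightarrow> smooth_fun A (bdom E i) (h i)"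
    "i \<in> idx E \<Longrightarrow> x \<in> bdom E i \<Longrightarrow> hermitian_pos_def (h i x)"
    "i \<in> idx E \<Longrightarrow> j \<in> idx E \<Longrightarrow> x \<in> bdom E i \<inter> bdom E j \<Longrightarrow>
      h i x = frame_change E i j x ** h j x ** ctranspose (frame_change E i j x)"
  using assms unfolding hermitian_metric_def by blast+

lemma hermitian_metric_slice:
  assumes A: "complex_atlas A" and B: "complex_atlas B" and F: "holo_bundle (prod_atlas A B) F"
    and h: "hermitian_metric (prod_atlas A B) F h"
  shows "hermitian_metric A (slice_bundle F s) (slice_metric h s)"
  unfolding hermitian_metric_def slice_metric_def slice_bundle_simps
proof (intro conjI ballI)
  fix i assume i: "i \<in> idx F"
  show "smooth_fun A {x. (x, s) \<in> bdom F i} (\<lambda>x. h i (x, s))"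
    by (rule smooth_fun_slice[OF A B metricD(1)[OF h i] holo_bundleD(1)[OF F i]])
  show "hermitian_pos_def (h i (x, s))" if "x \<in> {x. (x, s) \<in> bdom F i}" for x
    using metricD(2)[OF h i] that by blast
  show "h i (x, s) = frame_change F i j (x, s) ** h j (x, s) ** ctranspose (frame_change F i j (x, s))"
    if "j \<in> idx F" "x \<in> {x. (x, s) \<in> bdom F i} \<inter> {x. (x, s) \<in> bdom F j}" for j x
    using that by (intro metricD(3)[OF h i]) auto
qed

text \<open>On a single slice the factor \<open>exp (\<phi> s)\<close> is a positive constant, so
  this covers the restriction of the rescaled metric.\<close>

lemma hermitian_metric_scaleR:
  fixes E :: "('b::topological_space, 'i, 'r::finite) vbundle"
  assumes A: "complex_atlas A" and E: "holo_bundle A E" and h: "hermitian_metric A E h" and "0 < r"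
  shows "hermitian_metric A E (\<lambda>i x. r *\<^sub>R h i x)"
proof -
  have sm: "smooth_fun A (bdom E i) (\<lambda>x. r *\<^sub>R h i x)" if i: "i \<in> idx E" for i
    unfolding smooth_fun_def o_def
    by (intro ballI smooth_on_scaleR smooth_on_const smooth_fun_chart[OF metricD(1)[OF h i]]
        open_chart_image atlasD(1)[OF A] holo_bundleD(1)[OF E i])
  have *: "P ** (r *\<^sub>R M) ** N = r *\<^sub>R (P ** M ** N)" for P M N :: "complex^'r^'r"
    by (simp add: vec_eq_iff matrix_matrix_mult_def scaleR_conv_of_real[where 'a = complex]
        sum_distrib_left sum_distrib_right mult_ac)
  have "r *\<^sub>R h i x = frame_change E i j x ** (r *\<^sub>R h j x) ** ctranspose (frame_change E i j x)"
    if "i \<in> idx E" "j \<in> idx E" "x \<in> bdom E i \<inter> bdom E j" for i j x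
    unfolding * by (rule arg_cong[OF metricD(3)[OF h that]])
  then show ?thesis
    unfolding hermitian_metric_def
    by (intro conjI ballI sm hermitian_pos_def_scaleR[OF metricD(2)[OF h] \<open>0 < r\<close>])
qed

lemma slice_rescale_metric: "slice_metric (rescale_metric \<phi> h) s = (\<lambda>i x. exp (\<phi> s) *\<^sub>R slice_metric h s i x)"
  by (simp add: slice_metric_def rescale_metric_def)

section \<open>The pointwise inner products\<close>

text \<open>\<open>hform\<close> and \<open>form_norm\<close> are the integrands of
  \<open>End_inner\<close> and \<open>End_form_inner\<close> with point, chart and frame stripped
  off; independence of the choices then becomes matrix algebra.\<close>

definition hform :: "complex^'r::finite^'r \<Rightarrow> complex^'r^'r \<Rightarrow> complex^'r^'r \<Rightarrow> complex" where
  "hform H D E = trace (D ** H ** ctranspose E ** matrix_inv H)"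

definition form_norm ::
  "complex^'n::finite^'n \<Rightarrow> complex^'r::finite^'r \<Rightarrow> ('n \<Rightarrow> complex^'r^'r) \<Rightarrow> complex" where
  "form_norm G H \<eta> = (\<Sum>\<alpha>\<in>UNIV. \<Sum>\<beta>\<in>UNIV. matrix_inv G $ \<beta> $ \<alpha> * hform H (\<eta> \<beta>) (\<eta> \<alpha>))"

lemma matrix_mult_add_right: "(M + N) ** (P :: complex^'r^'r) = M ** P + N ** P"
  by (simp add: vec_eq_iff matrix_matrix_mult_def distrib_right sum.distrib)

lemma hform_add_left: "hform H (D + D') E = hform H D E + hform H D' E"
  by (simp add: hform_def matrix_mult_add_right trace_add)

lemma hform_add_right: "hform H D (E + E') = hform H D E + hform H D E'"
proof -
  have "ctranspose (E + E') = ctranspose E + ctranspose E'" by (simp add: vec_eq_iff)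
  then show ?thesis by (simp add: hform_def matrix_add_ldistrib matrix_mult_add_right trace_add)
qed

lemma trace_mat_mult: "trace (mat c ** M) = c * trace (M :: complex^'r^'r)"
  by (simp add: trace_def mat_mult_left sum_distrib_left)

lemma hform_scale_left: "hform H (mat c ** D) E = c * hform H D E"
  by (simp add: hform_def trace_mat_mult flip: matrix_mul_assoc)

lemma hform_scale_right:
  fixes H :: "complex^'r::finite^'r"
  shows "hform H D (mat c ** E) = cnj c * hform H D E"
proof -
  have "ctranspose (mat c ** E) = mat (cnj c) ** ctranspose E"
    by (simp add: vec_eq_iff mat_mult_left)
  moreover have "D ** H ** (mat (cnj c) ** X) ** Y = mat (cnj c) ** (D ** H ** X ** Y)" for X Y :: "complex^'r^'r"
    by (metis mat_mult_left mat_mult_right matrix_mul_assoc)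
  ultimately show ?thesis by (simp only: hform_def trace_mat_mult)
qed

lemma hform_0 [simp]: "hform H 0 E = 0" "hform H D 0 = 0"
  using hform_add_left[of H 0 0 E] hform_add_right[of H D 0 0] by simp_all

lemma hform_sum:
  "hform H (\<Sum>i\<in>I. mat (c i) ** D i) (\<Sum>j\<in>J. mat (e j) ** E j) =
   (\<Sum>i\<in>I. \<Sum>j\<in>J. c i * cnj (e j) * hform H (D i) (E j))"
proof -
  have l: "hform H (\<Sum>i\<in>I. mat (c i) ** D i) X = (\<Sum>i\<in>I. c i * hform H (D i) X)" for X
    by (induction I rule: infinite_finite_induct) (simp_all add: hform_add_left hform_scale_left)
  have r: "hform H X (\<Sum>j\<in>J. mat (e j) ** E j) = (\<Sum>j\<in>J. cnj (e j) * hform H X (E j))" for X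
    by (induction J rule: infinite_finite_induct) (simp_all add: hform_add_right hform_scale_right)
  show ?thesis unfolding l unfolding r sum_distrib_left by (simp only: mult.assoc)
qed

lemma hform_mat_right:
  assumes "invertible H"
  shows "hform H D (mat c) = cnj c * trace D"
proof -
  have "hform H D (mat 1) = trace (D ** (H ** matrix_inv H))"
    by (simp add: hform_def ctranspose_mat matrix_mul_assoc)
  then have "hform H D (mat 1) = trace D" by (simp add: matrix_inv_works[OF assms])
  then show ?thesis using hform_scale_right[of H D c "mat 1"] by simp
qed

text \<open>Writing H = R R^* and conjugating by R passes to an orthonormal frame, where the form is
  the sum of the squared moduli of the entries of Y = R^-1 D R.\<close>

lemma hform_self:
  assumes "hermitian_pos_def H"
  obtains t where "hform H D D = of_real t" "0 \<le> t" "t = 0 \<longrightarrow> D = 0"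
proof -
  obtain R where R: "invertible R" "H = R ** ctranspose R"
    using hermitian_pos_def_factor[OF assms] .
  define R' where "R' = matrix_inv R"
  have R': "R ** R' = mat 1" "R' ** R = mat 1" using matrix_inv_works[OF R(1)] by (simp_all add: R'_def)
  define Y where "Y = R' ** D ** R"
  have "matrix_inv H = ctranspose R' ** R'"
    using matrix_inv_mult[OF R(1) invertible_ctranspose[OF R(1)]] matrix_inv_ctranspose[OF R(1)]
    by (simp add: R(2) R'_def)
  then have "hform H D D = trace ((D ** R ** ctranspose R ** ctranspose D ** ctranspose R') ** R')"
    by (simp add: hform_def R(2) matrix_mul_assoc)
  also have "\<dots> = trace (Y ** ctranspose Y)"
    by (subst trace_mul_sym) (simp add: Y_def ctranspose_mult matrix_mul_assoc)
  also have "\<dots> = of_real (\<Sum>a\<in>UNIV. \<Sum>b\<in>UNIV. (cmod (Y $ a $ b))\<^sup>2)"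
    by (simp only: of_real_sum complex_norm_square) (simp add: trace_def matrix_matrix_mult_def)
  finally have eq: "hform H D D = of_real (\<Sum>a\<in>UNIV. \<Sum>b\<in>UNIV. (cmod (Y $ a $ b))\<^sup>2)" .
  have "D = 0" if "(\<Sum>a\<in>UNIV. \<Sum>b\<in>UNIV. (cmod (Y $ a $ b))\<^sup>2) = 0"
  proof -
    have "Y = 0" using that by (simp add: sum_nonneg_eq_0_iff sum_nonneg vec_eq_iff)
    have "D = R ** Y ** R'" using R' by (simp add: Y_def matrix_mul_assoc) (simp flip: matrix_mul_assoc)
    then show ?thesis using \<open>Y = 0\<close> by simp
  qed
  then show ?thesis
    using eq by (intro that[of "\<Sum>a\<in>UNIV. \<Sum>b\<in>UNIV. (cmod (Y $ a $ b))\<^sup>2"]) (auto intro!: sum_nonneg)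
qed

text \<open>The hypotheses say D = f D' f^-1 and E = f E' f^-1. After inserting H = f H' f^* all
  inner factors cancel, leaving a conjugate by f, and the trace ignores it.\<close>

lemma hform_change_frame:
  assumes f: "invertible f" and H': "invertible H'" and H: "H = f ** H' ** ctranspose f"
    and D: "D ** f = f ** D'" and E: "E ** f = f ** E'"
  shows "hform H D E = hform H' D' E'"
proof -
  define k where "k = matrix_inv f"
  have k: "f ** k = mat 1" "k ** f = mat 1" using matrix_inv_works[OF f] by (simp_all add: k_def)
  have ck: "ctranspose f ** ctranspose k = mat 1" using k(2) by (metis ctranspose_mult ctranspose_mat complex_cnj_one)
  have "D ** f ** k = D" "E ** f ** k = E" using k by (simp_all flip: matrix_mul_assoc)
  then have D': "D = f ** D' ** k" and E': "E = f ** E' ** k" using D E by simp_all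
  have iH: "matrix_inv H = ctranspose k ** matrix_inv H' ** k"
    using matrix_inv_mult[OF invertible_mult[OF f H'] invertible_ctranspose[OF f]]
      matrix_inv_mult[OF f H'] matrix_inv_ctranspose[OF f]
    by (simp add: H k_def matrix_mul_assoc)
  have "D ** H ** ctranspose E ** matrix_inv H =
     f ** D' ** (k ** f) ** H' ** (ctranspose f ** ctranspose k) ** ctranspose E' ** (ctranspose f ** ctranspose k) ** matrix_inv H' ** k"
    unfolding iH unfolding H D' E' by (simp add: ctranspose_mult matrix_mul_assoc)
  also have "\<dots> = f ** (D' ** H' ** ctranspose E' ** matrix_inv H') ** matrix_inv f"
    by (simp add: k ck k_def[symmetric] matrix_mul_assoc)
  finally show ?thesis by (simp add: hform_def trace_conj[OF f])
qed

text \<open>With G = P P^* and Q = P^-1 the inverse metric is Q^* Q. Hence the form is a sum of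
  \<open>hform H (Y m) (Y m)\<close>, where the Y m are the components in an orthonormal
  coframe.\<close>

lemma form_norm_self:
  assumes G: "hermitian_pos_def G" and H: "hermitian_pos_def H"
  obtains t where "form_norm G H \<eta> = of_real t" "0 \<le> t" "t = 0 \<longrightarrow> (\<forall>\<beta>. \<eta> \<beta> = 0)"
proof -
  obtain P where P: "invertible P" "G = P ** ctranspose P"
    using hermitian_pos_def_factor[OF G] .
  define Q where "Q = matrix_inv P"
  have Q: "P ** Q = mat 1" using matrix_inv_works[OF P(1)] by (simp add: Q_def)
  have iG: "matrix_inv G $ \<beta> $ \<alpha> = (\<Sum>m\<in>UNIV. cnj (Q $ m $ \<beta>) * Q $ m $ \<alpha>)" for \<alpha> \<beta>
    using matrix_inv_mult[OF P(1) invertible_ctranspose[OF P(1)]] matrix_inv_ctranspose[OF P(1)]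
    by (simp add: P(2) Q_def matrix_matrix_mult_def)
  define Y where "Y m = (\<Sum>\<beta>\<in>UNIV. mat (cnj (Q $ m $ \<beta>)) ** \<eta> \<beta>)" for m
  have "form_norm G H \<eta> = (\<Sum>\<alpha>\<in>UNIV. \<Sum>m\<in>UNIV. \<Sum>\<beta>\<in>UNIV. cnj (Q $ m $ \<beta>) * Q $ m $ \<alpha> * hform H (\<eta> \<beta>) (\<eta> \<alpha>))"
    unfolding form_norm_def iG sum_distrib_right by (rule sum.cong[OF refl], rule sum.swap)
  also have "\<dots> = (\<Sum>m\<in>UNIV. \<Sum>\<alpha>\<in>UNIV. \<Sum>\<beta>\<in>UNIV. cnj (Q $ m $ \<beta>) * Q $ m $ \<alpha> * hform H (\<eta> \<beta>) (\<eta> \<alpha>))"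
    by (rule sum.swap)
  also have "\<dots> = (\<Sum>m\<in>UNIV. hform H (Y m) (Y m))"
    unfolding Y_def hform_sum complex_cnj_cnj by (rule sum.cong[OF refl], rule sum.swap)
  finally have eq: "form_norm G H \<eta> = (\<Sum>m\<in>UNIV. hform H (Y m) (Y m))" .
  have "\<exists>t. hform H (Y m) (Y m) = of_real t \<and> 0 \<le> t \<and> (t = 0 \<longrightarrow> Y m = 0)" for m
    using hform_self[OF H, of "Y m"] by metis
  then obtain t where t: "\<And>m. hform H (Y m) (Y m) = of_real (t m)" "\<And>m. 0 \<le> t m" "\<And>m. t m = 0 \<Longrightarrow> Y m = 0"
    by metis
  have "\<eta> \<gamma> = 0" if "(\<Sum>m\<in>UNIV. t m) = 0" for \<gamma>
  proof -
    have Y0: "Y m = 0" for m using that t by (simp add: sum_nonneg_eq_0_iff)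
    have "\<eta> \<gamma> $ a $ b = 0" for a b
    proof -
      \<comment> \<open>The fixed entry (a, b), conjugated and collected over all \<beta>, gives a
        vector whose image under Q consists of entries of the vanishing Y m; invertibility of Q
        kills it.\<close>
      define v where "v = (\<chi> \<beta>. cnj (\<eta> \<beta> $ a $ b))"
      have "(Q *v v) $ m = cnj (Y m $ a $ b)" for m
        by (simp add: matrix_vector_mult_def v_def Y_def mat_mult_left)
      then have "Q *v v = 0" by (simp add: vec_eq_iff Y0)
      then have "P *v (Q *v v) = 0" by simp
      then have "v = 0" by (simp add: matrix_vector_mul_assoc Q)
      then show ?thesis by (auto simp: v_def vec_eq_iff)
    qed
    then show ?thesis by (simp add: vec_eq_iff)
  qed
  then show ?thesis
    using eq t(1,2) by (intro that[of "\<Sum>m\<in>UNIV. t m"]) (auto intro!: sum_nonneg)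
qed

lemma sum_swap4:
  "(\<Sum>a\<in>A. \<Sum>b\<in>B. \<Sum>c\<in>C. \<Sum>d\<in>D. f a b c d) = (\<Sum>c\<in>C. \<Sum>d\<in>D. \<Sum>a\<in>A. \<Sum>b\<in>B. f a b c d)"
proof -
  have "(\<Sum>a\<in>A. \<Sum>b\<in>B. \<Sum>c\<in>C. \<Sum>d\<in>D. f a b c d) = (\<Sum>a\<in>A. \<Sum>c\<in>C. \<Sum>b\<in>B. \<Sum>d\<in>D. f a b c d)"
    by (rule sum.cong[OF refl], rule sum.swap)
  also have "\<dots> = (\<Sum>c\<in>C. \<Sum>a\<in>A. \<Sum>d\<in>D. \<Sum>b\<in>B. f a b c d)"
    by (subst sum.swap) (intro sum.cong refl sum.swap)
  also have "\<dots> = (\<Sum>c\<in>C. \<Sum>d\<in>D. \<Sum>a\<in>A. \<Sum>b\<in>B. f a b c d)"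
    by (rule sum.cong[OF refl], rule sum.swap)
  finally show ?thesis .
qed

text \<open>The coefficients of a (0,1)-form change by the conjugate of J and the metric by J and
  J^*, so the inverse metric absorbs both Jacobians.\<close>

lemma form_norm_change_chart:
  assumes J: "invertible J" and G': "invertible G'" and G: "G = J ** G' ** ctranspose J"
    and \<eta>: "\<And>\<beta>. \<eta> \<beta> = (\<Sum>\<gamma>\<in>UNIV. mat (cnj (J $ \<beta> $ \<gamma>)) ** \<eta>' \<gamma>)"
  shows "form_norm G H \<eta> = form_norm G' H \<eta>'"
proof -
  define k where "k = matrix_inv J"
  have k: "J ** k = mat 1" "k ** J = mat 1" using matrix_inv_works[OF J] by (simp_all add: k_def)
  have ck: "ctranspose J ** ctranspose k = mat 1" using k(2) by (metis ctranspose_mult ctranspose_mat complex_cnj_one)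
  have iG: "matrix_inv G = ctranspose k ** matrix_inv G' ** k"
    using matrix_inv_mult[OF invertible_mult[OF J G'] invertible_ctranspose[OF J]]
      matrix_inv_mult[OF J G'] matrix_inv_ctranspose[OF J]
    by (simp add: G k_def matrix_mul_assoc)
  have "ctranspose J ** matrix_inv G ** J = (ctranspose J ** ctranspose k) ** matrix_inv G' ** (k ** J)"
    by (simp add: iG matrix_mul_assoc)
  then have iG': "matrix_inv G' = ctranspose J ** matrix_inv G ** J" by (simp add: k ck)
  have e: "matrix_inv G' $ \<gamma> $ \<delta> = (\<Sum>\<alpha>\<in>UNIV. \<Sum>\<beta>\<in>UNIV. cnj (J $ \<beta> $ \<gamma>) * matrix_inv G $ \<beta> $ \<alpha> * J $ \<alpha> $ \<delta>)" for \<gamma> \<delta>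
    by (simp add: iG' matrix_matrix_mult_def sum_distrib_right)
  let ?s = "\<lambda>\<alpha> \<beta> \<gamma> \<delta>. matrix_inv G $ \<beta> $ \<alpha> * (cnj (J $ \<beta> $ \<gamma>) * J $ \<alpha> $ \<delta> * hform H (\<eta>' \<gamma>) (\<eta>' \<delta>))"
  have "form_norm G H \<eta> = (\<Sum>\<alpha>\<in>UNIV. \<Sum>\<beta>\<in>UNIV. \<Sum>\<gamma>\<in>UNIV. \<Sum>\<delta>\<in>UNIV. ?s \<alpha> \<beta> \<gamma> \<delta>)"
    unfolding form_norm_def \<eta> hform_sum complex_cnj_cnj sum_distrib_left ..
  also have "\<dots> = (\<Sum>\<gamma>\<in>UNIV. \<Sum>\<delta>\<in>UNIV. \<Sum>\<alpha>\<in>UNIV. \<Sum>\<beta>\<in>UNIV. ?s \<alpha> \<beta> \<gamma> \<delta>)"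
    by (rule sum_swap4)
  also have "\<dots> = (\<Sum>\<gamma>\<in>UNIV. \<Sum>\<delta>\<in>UNIV. matrix_inv G' $ \<gamma> $ \<delta> * hform H (\<eta>' \<gamma>) (\<eta>' \<delta>))"
    unfolding e sum_distrib_right by (intro sum.cong refl) (simp only: mult_ac)
  also have "\<dots> = form_norm G' H \<eta>'"
    unfolding form_norm_def by (rule sum.swap)
  finally show ?thesis .
qed

lemma dzb_mat_mult:
  fixes M N :: "complex^'n::finite \<Rightarrow> complex^'r::finite^'r"
  assumes "\<And>a b. (\<lambda>z. M z $ a $ b) differentiable (at z)" "\<And>a b. (\<lambda>z. N z $ a $ b) differentiable (at z)"
  shows "dzb_mat j (\<lambda>z. M z ** N z) z = dzb_mat j M z ** N z + M z ** dzb_mat j N z"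
proof -
  have "dzb j (\<lambda>z. (M z ** N z) $ a $ b) z =
      (\<Sum>k\<in>UNIV. dzb j (\<lambda>z. M z $ a $ k) z * N z $ k $ b + M z $ a $ k * dzb j (\<lambda>z. N z $ k $ b) z)" for a b
  proof -
    have "dzb j (\<lambda>z. (M z ** N z) $ a $ b) z = dzb j (\<lambda>z. \<Sum>k\<in>UNIV. M z $ a $ k * N z $ k $ b) z"
      by (simp add: matrix_matrix_mult_def)
    also have "\<dots> = (\<Sum>k\<in>UNIV. dzb j (\<lambda>z. M z $ a $ k * N z $ k $ b) z)"
      unfolding dzb_eq_wirtinger by (intro wirtinger_sum differentiable_mult assms)
    also have "\<dots> = (\<Sum>k\<in>UNIV. dzb j (\<lambda>z. M z $ a $ k) z * N z $ k $ b + M z $ a $ k * dzb j (\<lambda>z. N z $ k $ b) z)"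
      unfolding dzb_eq_wirtinger by (intro sum.cong refl wirtinger_mult assms)
    finally show ?thesis .
  qed
  then show ?thesis by (simp add: vec_eq_iff dzb_mat_def matrix_matrix_mult_def sum.distrib)
qed

lemma dzb_mat_cong:
  assumes "open V" "z \<in> V" "\<And>y. y \<in> V \<Longrightarrow> M y = N y"
  shows "dzb_mat j M z = dzb_mat j N z"
proof -
  have "dzb j (\<lambda>y. M y $ a $ b) z = dzb j (\<lambda>y. N y $ a $ b) z" for a b
    unfolding dzb_eq_wirtinger by (rule wirtinger_cong[OF assms(1,2)]) (simp add: assms(3))
  then show ?thesis by (simp add: dzb_mat_def)
qed

section \<open>Harmonic endomorphisms of a simple bundle\<close>

lemma smooth_on_nth:
  fixes f :: "'a::real_normed_vector \<Rightarrow> complex^'r::finite^'q::finite"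
  assumes "open V" "smooth_on f V"
  shows "smooth_on (\<lambda>x. f x $ a $ b) V"
proof -
  have "bounded_linear (\<lambda>M :: complex^'r^'q. M $ a $ b)"
    using bounded_linear_compose[OF bounded_linear_vec_nth bounded_linear_vec_nth] .
  from smooth_on_bounded_linear_comp[OF this assms] show ?thesis .
qed

lemma continuous_on_matrix_mult:
  fixes f g :: "'a::topological_space \<Rightarrow> complex^'r::finite^'r"
  assumes "continuous_on V f" "continuous_on V g"
  shows "continuous_on V (\<lambda>x. f x ** g x)"
  unfolding matrix_matrix_mult_def by (intro continuous_intros assms)

lemma continuous_on_ctranspose:
  fixes f :: "'a::topological_space \<Rightarrow> complex^'r::finite^'r"
  assumes "continuous_on V f"
  shows "continuous_on V (\<lambda>x. ctranspose (f x))"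
  unfolding ctranspose_def by (intro continuous_intros assms)

lemma continuous_on_hform:
  fixes H :: "'a::topological_space \<Rightarrow> complex^'r::finite^'r"
  assumes "continuous_on V H" "continuous_on V D" "continuous_on V E" "\<And>x. x \<in> V \<Longrightarrow> invertible (H x)"
  shows "continuous_on V (\<lambda>x. hform (H x) (D x) (E x))"
proof -
  have "continuous_on V (\<lambda>x. D x ** H x ** ctranspose (E x) ** matrix_inv (H x))"
    by (intro continuous_on_matrix_mult continuous_on_ctranspose continuous_on_matrix_inv assms)
  then show ?thesis unfolding hform_def trace_def by (intro continuous_intros)
qed

lemma continuous_on_form_norm:
  fixes H :: "'a::topological_space \<Rightarrow> complex^'r::finite^'r"
  assumes "continuous_on V G" "continuous_on V H" "\<And>\<beta>. continuous_on V (\<lambda>x. \<eta> x \<beta>)"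
    "\<And>x. x \<in> V \<Longrightarrow> invertible (G x)" "\<And>x. x \<in> V \<Longrightarrow> invertible (H x)"
  shows "continuous_on V (\<lambda>x. form_norm (G x) (H x) (\<eta> x))"
  unfolding form_norm_def
  by (intro continuous_on_sum continuous_on_mult continuous_on_component continuous_on_matrix_inv
      continuous_on_hform assms)

lemma frame_at:
  assumes "holo_bundle A E"
  shows "frame_at E x \<in> idx E" "x \<in> bdom E (frame_at E x)"
  unfolding frame_at_def using someI_ex[of "\<lambda>i. i \<in> idx E \<and> x \<in> bdom E i"] holo_bundleD(2)[OF assms] by blast+

lemma chart_at:
  assumes "complex_atlas A"
  shows "chart_at A x \<in> A" "x \<in> fst (chart_at A x)"
  unfolding chart_at_def using someI_ex[of "\<lambda>c. c \<in> A \<and> x \<in> fst c"] atlasD(3)[OF assms] by blast+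

lemma End_sectionsD:
  assumes "T \<in> End_sections A E"
  shows "i \<in> idx E \<Longrightarrow> smooth_fun A (bdom E i) (T i)"
    "i \<in> idx E \<Longrightarrow> j \<in> idx E \<Longrightarrow> x \<in> bdom E i \<inter> bdom E j \<Longrightarrow>
       T i x ** frame_change E i j x = frame_change E i j x ** T j x"
    "\<not> (i \<in> idx E \<and> x \<in> bdom E i) \<Longrightarrow> T i x = 0"
  using assms unfolding End_sections_def by blast+

lemma End_sections_chart_smooth:
  assumes A: "complex_atlas A" and E: "holo_bundle A E" and T: "T \<in> End_sections A E"
    and c: "c \<in> A" and i: "i \<in> idx E"
  shows "smooth_on (\<lambda>z. T i (chart_inv c z) $ a $ b) (snd c ` (fst c \<inter> bdom E i))"
  by (rule smooth_on_nth[OF open_chart_image[OF atlasD(1)[OF A c] holo_bundleD(1)[OF E i]]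
        smooth_fun_chart[OF End_sectionsD(1)[OF T i] c]])

text \<open>Differentiating T_i f = f T_j produces no derivative of f, because the frame change is
  holomorphic. Thus \<open>dbar T\<close> transforms as an endomorphism.\<close>

lemma dbar_change_frame:
  assumes A: "complex_atlas A" and E: "holo_bundle A E" and T: "T \<in> End_sections A E"
    and c: "c \<in> A" "x \<in> fst c" and i: "i \<in> idx E" "x \<in> bdom E i" and j: "j \<in> idx E" "x \<in> bdom E j"
  shows "dbar T c i \<beta> x ** frame_change E i j x = frame_change E i j x ** dbar T c j \<beta> x"
proof -
  let ?W = "bdom E i \<inter> bdom E j" and ?z = "snd c x"
  let ?V = "snd c ` (fst c \<inter> ?W)"
  let ?f = "\<lambda>z. frame_change E i j (chart_inv c z)"
  note cc = chartD[OF atlasD(1)[OF A c(1)]]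
  have V: "open ?V" "?z \<in> ?V"
    using open_chart_image[OF atlasD(1)[OF A c(1)], of ?W] holo_bundleD(1)[OF E] c i j by auto
  have s: "smooth_on (\<lambda>z. T k (chart_inv c z) $ a $ b) ?V" if "k \<in> {i, j}" for k a b
    using End_sections_chart_smooth[OF A E T c(1)] i j that by (auto intro: smooth_on_subset)
  have f: "holo_on (\<lambda>z. ?f z $ a $ b) ?V" for a b
    using holo_bundleD(5)[OF E i(1) j(1)] c(1) unfolding holo_mat_fun_def by blast
  note dT = smooth_on_differentiable[OF s V(2)]
  have df: "(\<lambda>z. ?f z $ a $ b) differentiable (at ?z)" for a b
    using f V(2) unfolding holo_on_def by (blast intro: smooth_on_differentiable)
  have f0: "dzb_mat \<beta> ?f ?z = 0"
  proof -
    have "dzb \<beta> (\<lambda>z. ?f z $ a $ b) ?z = 0" for a b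
      using f[of a b] V(2) unfolding holo_on_def by blast
    then show ?thesis by (simp add: dzb_mat_def vec_eq_iff)
  qed
  have "dzb_mat \<beta> (\<lambda>z. T i (chart_inv c z) ** ?f z) ?z = dzb_mat \<beta> (\<lambda>z. ?f z ** T j (chart_inv c z)) ?z"
  proof (rule dzb_mat_cong[OF V])
    fix z assume "z \<in> ?V"
    then have "chart_inv c z \<in> ?W" using cc(5) by auto
    then show "T i (chart_inv c z) ** ?f z = ?f z ** T j (chart_inv c z)"
      by (rule End_sectionsD(2)[OF T i(1) j(1)])
  qed
  then show ?thesis
    using dT df f0 cc(5)[OF c(2)] by (simp add: dzb_mat_mult dbar_def o_def)
qed

text \<open>The chain rule for the holomorphic transition map; its Jacobian is the frame change of
  the tangent bundle.\<close>

lemma dbar_change_chart: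
  assumes A: "complex_atlas A" and E: "holo_bundle A E" and T: "T \<in> End_sections A E"
    and c: "c \<in> A" "x \<in> fst c" and c': "c' \<in> A" "x \<in> fst c'" and i: "i \<in> idx E" "x \<in> bdom E i"
  shows "dbar T c i \<beta> x =
    (\<Sum>\<gamma>\<in>UNIV. mat (cnj (frame_change (tangent_bundle A) c c' x $ \<beta> $ \<gamma>)) ** dbar T c' i \<gamma> x)"
proof -
  note cc = chartD[OF atlasD(1)[OF A c(1)]]
  note cc' = chartD[OF atlasD(1)[OF A c'(1)]]
  let ?z = "snd c x" and ?\<tau> = "\<lambda>z. snd c' (chart_inv c z)"
  let ?V = "snd c ` (fst c \<inter> fst c')"
  have V: "open ?V" "?z \<in> ?V"
    using open_chart_image[OF atlasD(1)[OF A c(1)] cc'(1)] c c' by auto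
  have \<tau>z: "?\<tau> ?z = snd c' x" using cc(5)[OF c(2)] by simp
  have tr: "holo_on (\<lambda>z. ?\<tau> z $ \<gamma>) ?V" for \<gamma>
    using atlasD(2)[OF A c(1) c'(1)] by (simp add: holo_transition_def)
  have d\<tau>: "(\<lambda>z. ?\<tau> z $ \<gamma>) differentiable (at ?z)" "dzb \<beta> (\<lambda>z. ?\<tau> z $ \<gamma>) ?z = 0" for \<gamma>
    using tr V(2) smooth_on_differentiable unfolding holo_on_def by blast+
  have "dbar T c i \<beta> x $ a $ b =
      (\<Sum>\<gamma>\<in>UNIV. cnj (dz \<beta> (\<lambda>z. ?\<tau> z $ \<gamma>) ?z) * dbar T c' i \<gamma> x $ a $ b)" for a b
  proof -
    have "dzb \<beta> (\<lambda>z. T i (chart_inv c z) $ a $ b) ?z = dzb \<beta> (\<lambda>z. T i (chart_inv c' (?\<tau> z)) $ a $ b) ?z"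
      unfolding dzb_eq_wirtinger by (rule wirtinger_cong[OF V]) (use cc(5) cc'(5) in auto)
    also have "\<dots> = (\<Sum>\<gamma>\<in>UNIV. cnj (dz \<beta> (\<lambda>z. ?\<tau> z $ \<gamma>) ?z) * dzb \<gamma> (\<lambda>z. T i (chart_inv c' z) $ a $ b) (?\<tau> ?z))"
    proof (rule dzb_compose_holo[OF _ d\<tau>])
      show "(\<lambda>z. T i (chart_inv c' z) $ a $ b) differentiable (at (?\<tau> ?z))"
        using End_sections_chart_smooth[OF A E T c'(1) i(1)] c' i \<tau>z
        by (intro smooth_on_differentiable) auto
    qed
    finally show ?thesis by (simp add: dbar_def dzb_mat_def \<tau>z)
  qed
  then show ?thesis
    by (simp add: vec_eq_iff mat_mult_left tangent_bundle_def)
qed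

section \<open>The volume measure of the compact base manifold\<close>

context
  fixes A :: "('x::{t2_space,second_countable_topology}, 'n::finite) chart set"
    and g :: "('x, 'n) chart \<Rightarrow> 'x \<Rightarrow> complex^'n^'n" and vol :: "'x measure"
  assumes A: "complex_atlas A" and X: "compact (UNIV :: 'x set)"
    and g: "hermitian_metric A (tangent_bundle A) g" and vol: "kaehler_volume A g vol"
begin

lemma metric_pos_def: "c \<in> A \<Longrightarrow> x \<in> fst c \<Longrightarrow> hermitian_pos_def (g c x)"
  using metricD(2)[OF g, of c x] by (simp add: tangent_bundle_def)

lemma metric_change:
  "c \<in> A \<Longrightarrow> c' \<in> A \<Longrightarrow> x \<in> fst c \<Longrightarrow> x \<in> fst c' \<Longrightarrow>
    g c x = frame_change (tangent_bundle A) c c' x ** g c' x ** ctranspose (frame_change (tangent_bundle A) c c' x)"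
  using metricD(3)[OF g, of c c' x] by (simp add: tangent_bundle_def)

lemma continuous_on_metric: "c \<in> A \<Longrightarrow> continuous_on (fst c) (g c)"
  using smooth_fun_imp_continuous_on[OF A metricD(1)[OF g, of c]] chartD(1)[OF atlasD(1)[OF A]]
  by (simp add: tangent_bundle_def)

lemma sets_vol: "sets vol = sets borel" and space_vol: "space vol = UNIV"
  using vol sets_eq_imp_space_eq[of vol borel] by (auto simp: kaehler_volume_def)

lemma emeasure_vol:
  "c \<in> A \<Longrightarrow> K \<in> sets borel \<Longrightarrow> K \<subseteq> fst c \<Longrightarrow>
    emeasure vol K = (\<integral>\<^sup>+z\<in>snd c ` K. ennreal (2 ^ CARD('n) * Re (det (g c (chart_inv c z)))) \<partial>lborel)"
  using vol unfolding kaehler_volume_def by blast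

lemma continuous_on_density:
  assumes "c \<in> A"
  shows "continuous_on (snd c ` fst c) (\<lambda>z. 2 ^ CARD('n) * Re (det (g c (chart_inv c z))))"
proof -
  note cc = chartD[OF atlasD(1)[OF A assms]]
  have "continuous_on (snd c ` fst c) (\<lambda>z. g c (chart_inv c z))"
    using cc(6) by (intro continuous_on_compose2[OF continuous_on_metric[OF assms] cc(4)]) auto
  then show ?thesis by (intro continuous_intros continuous_on_det)
qed

lemma emeasure_vol_compact_finite:
  assumes c: "c \<in> A" and K: "compact K" "K \<subseteq> fst c"
  shows "emeasure vol K < \<infinity>"
proof -
  note cc = chartD[OF atlasD(1)[OF A c]]
  have cK: "compact (snd c ` K)"
    using K by (intro compact_continuous_image continuous_on_subset[OF cc(3)])
  let ?f = "\<lambda>z. 2 ^ CARD('n) * Re (det (g c (chart_inv c z)))"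
  have "continuous_on (snd c ` K) ?f"
    by (rule continuous_on_subset[OF continuous_on_density[OF c]]) (use K in auto)
  then have "bounded (?f ` snd c ` K)"
    by (intro compact_imp_bounded compact_continuous_image cK)
  then obtain C where C: "\<And>z. z \<in> snd c ` K \<Longrightarrow> norm (?f z) \<le> C" unfolding bounded_iff by auto
  have "emeasure vol K = (\<integral>\<^sup>+z\<in>snd c ` K. ennreal (?f z) \<partial>lborel)"
    using K by (intro emeasure_vol[OF c] borel_compact) auto
  also have "\<dots> \<le> (\<integral>\<^sup>+z. ennreal C * indicator (snd c ` K) z \<partial>lborel)"
    using C by (intro nn_integral_mono) (auto split: split_indicator simp: abs_le_iff intro!: ennreal_leI)
  also have "\<dots> = ennreal C * emeasure lborel (snd c ` K)"
    using cK by (intro nn_integral_cmult_indicator) (auto intro: borel_compact)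
  also have "\<dots> < \<infinity>"
    using emeasure_compact_finite[OF cK] by (simp add: ennreal_mult_less_top)
  finally show ?thesis .
qed

text \<open>Every point has an open neighbourhood inside a compact subset of a chart, where the
  density is bounded; finitely many of these cover X.\<close>

lemma finite_measure_vol: "finite_measure vol"
proof
  have "\<exists>N. x \<in> N \<and> open N \<and> emeasure vol N < \<infinity>" for x
  proof -
    obtain c where c: "c \<in> A" "x \<in> fst c" using atlasD(3)[OF A] by blast
    obtain K N where KN: "x \<in> N" "open N" "N \<subseteq> K" "compact K" "K \<subseteq> fst c \<inter> UNIV"
      by (rule compact_chart_neighbourhood[OF A c(1) open_UNIV IntI[OF c(2) UNIV_I]])
    have "emeasure vol N \<le> emeasure vol K"
      using KN borel_compact[of K] by (intro emeasure_mono) (auto simp: sets_vol)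
    also have "\<dots> < \<infinity>" using emeasure_vol_compact_finite[OF c(1) KN(4)] KN(5) by simp
    finally show ?thesis using KN by blast
  qed
  then obtain N where N: "\<And>x. x \<in> N x" "\<And>x. open (N x)" "\<And>x. emeasure vol (N x) < \<infinity>"
    by metis
  have "UNIV \<subseteq> (\<Union>x\<in>UNIV. N x)" using N(1) by auto
  then obtain P where P: "finite P" "UNIV \<subseteq> (\<Union>x\<in>P. N x)"
    using compactE_image[OF X, of UNIV N] N(2) by auto
  have "(UNIV :: 'x set) = (\<Union>x\<in>P. N x)" using P(2) by blast
  then have "emeasure vol UNIV = emeasure vol (\<Union>x\<in>P. N x)" by (rule arg_cong)
  also have "\<dots> \<le> (\<Sum>x\<in>P. emeasure vol (N x))"
    using N(2) by (intro emeasure_subadditive_finite P) (auto simp: sets_vol)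
  also have "\<dots> < \<infinity>" using N(3) P(1) by simp
  finally show "emeasure vol (space vol) \<noteq> \<infinity>" by (simp add: space_vol)
qed

text \<open>The density is strictly positive, so a null open set would have Lebesgue null image in a
  chart, impossible for a nonempty open image. This separates continuous functions and makes the
  total volume nonzero.\<close>

lemma emeasure_vol_open_pos:
  assumes U: "open U" "x \<in> U"
  shows "emeasure vol U \<noteq> 0"
proof
  assume 0: "emeasure vol U = 0"
  obtain c where c: "c \<in> A" "x \<in> fst c" using atlasD(3)[OF A] by blast
  note cc = chartD[OF atlasD(1)[OF A c(1)]]
  let ?f = "\<lambda>z. 2 ^ CARD('n) * Re (det (g c (chart_inv c z)))"
  let ?V = "snd c ` (fst c \<inter> U)"
  have V: "open ?V" by (rule open_chart_image[OF atlasD(1)[OF A c(1)] U(1)])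
  have fpos: "0 < ?f z" if "z \<in> ?V" for z
    using that cc(5) hermitian_pos_def_det(1)[OF metric_pos_def[OF c(1)]] by auto
  have "emeasure vol (fst c \<inter> U) \<le> emeasure vol U"
    using U cc(1) by (intro emeasure_mono) (auto simp: sets_vol)
  then have "(\<integral>\<^sup>+z. ennreal (?f z) * indicator ?V z \<partial>lborel) = 0"
    using 0 U cc(1) emeasure_vol[OF c(1), of "fst c \<inter> U"] by auto
  moreover have "(\<lambda>z. ennreal (?f z) * indicator ?V z) \<in> borel_measurable lborel"
  proof -
    have "(\<lambda>z. indicator ?V z *\<^sub>R ?f z) \<in> borel_measurable borel"
      by (intro borel_measurable_continuous_on_indicator continuous_on_subset[OF continuous_on_density[OF c(1)]])
        (use V in auto)
    then have "(\<lambda>z. ennreal (indicator ?V z *\<^sub>R ?f z)) \<in> borel_measurable lborel" by simp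
    moreover have "(\<lambda>z. ennreal (indicator ?V z *\<^sub>R ?f z)) = (\<lambda>z. ennreal (?f z) * indicator ?V z)"
      by (auto split: split_indicator)
    ultimately show ?thesis by simp
  qed
  ultimately have "AE z in lborel. ennreal (?f z) * indicator ?V z = 0"
    by (subst (asm) nn_integral_0_iff_AE) auto
  then have "AE z in lborel. z \<notin> ?V"
    by (rule AE_mp) (use fpos in \<open>auto intro!: AE_I2 split: split_indicator simp: ennreal_eq_0_iff\<close>, force)
  then have "emeasure lborel ?V = 0"
    using V by (subst (asm) AE_iff_measurable[OF _ refl]) auto
  then have "?V \<in> null_sets lborel" using V by auto
  then have "?V = {}" using open_not_negligible[OF V] negligible_iff_null_sets null_sets_completionI by blast
  then show False using c U by auto
qed

lemma integrable_vol:
  fixes f :: "'x \<Rightarrow> 'b::{banach, second_countable_topology}"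
  assumes "continuous_on UNIV f"
  shows "integrable vol f"
proof -
  interpret finite_measure vol by (rule finite_measure_vol)
  show ?thesis
    using integrable_weight[OF sets_vol X closed_UNIV _ _ assms, of "\<lambda>_. 1"] by simp
qed

text \<open>The integral gives vanishing almost everywhere; the set where f is nonzero is open, so
  being null it is empty.\<close>

lemma integral_vol_eq_0:
  fixes f :: "'x \<Rightarrow> real"
  assumes f: "continuous_on UNIV f" "\<And>x. 0 \<le> f x" and 0: "(LINT x|vol. f x) = 0"
  shows "f x = 0"
proof (rule ccontr)
  assume "f x \<noteq> 0"
  have "AE x in vol. f x = 0"
    using 0 integral_nonneg_eq_0_iff_AE[OF integrable_vol[OF f(1)]] f(2) by simp
  moreover have o: "open {x. f x \<noteq> 0}"
    using f(1) by (intro open_Collect_neq) auto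
  ultimately have "emeasure vol {x. f x \<noteq> 0} = 0"
    using sets_vol by (subst (asm) AE_iff_measurable[OF _ refl]) (auto simp: space_vol)
  then show False using emeasure_vol_open_pos[OF o] \<open>f x \<noteq> 0\<close> by blast
qed

section \<open>Harmonic sections and the harmonic projection\<close>

context
  fixes E :: "('x, 'i, 'r::finite) vbundle" and h :: "'i \<Rightarrow> 'x \<Rightarrow> complex^'r^'r"
  assumes E: "holo_bundle A E" and h: "hermitian_metric A E h"
begin

text \<open>\<open>End_form_inner\<close> uses chart and frame chosen separately at every point,
  with no continuity. Invariance allows one chart and one frame to be kept on a whole neighbourhood,
  and so yields continuity of the energy density.\<close>

lemma dbar_norm_invariant:
  assumes T: "T \<in> End_sections A E" and c: "c \<in> A" "x \<in> fst c" and c': "c' \<in> A" "x \<in> fst c'"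
    and i: "i \<in> idx E" "x \<in> bdom E i" and j: "j \<in> idx E" "x \<in> bdom E j"
  shows "form_norm (g c x) (h i x) (\<lambda>\<beta>. dbar T c i \<beta> x) =
    form_norm (g c' x) (h j x) (\<lambda>\<beta>. dbar T c' j \<beta> x)"
proof -
  let ?J = "frame_change (tangent_bundle A) c c' x"
  have inv: "invertible (g c x)" "invertible (g c' x)" "invertible (h j x)"
    using metric_pos_def c c' metricD(2)[OF h j] hermitian_pos_def_invertible by blast+
  have J: "invertible ?J"
    using inv(1) metric_change[OF c(1) c'(1) c(2) c'(2)] by (auto simp: invertible_det_nz det_mul)
  have "form_norm (g c x) (h i x) (\<lambda>\<beta>. dbar T c i \<beta> x) =
      form_norm (g c' x) (h i x) (\<lambda>\<beta>. dbar T c' i \<beta> x)"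
    by (rule form_norm_change_chart[OF J inv(2) metric_change[OF c(1) c'(1) c(2) c'(2)]
          dbar_change_chart[OF A E T c c' i]])
  also have "\<dots> = form_norm (g c' x) (h j x) (\<lambda>\<beta>. dbar T c' j \<beta> x)"
    unfolding form_norm_def
    using hform_change_frame[OF invertible_frame_change[OF E i(1) j(1)] inv(3) metricD(3)[OF h i(1) j(1)]
        dbar_change_frame[OF A E T c' i j] dbar_change_frame[OF A E T c' i j]] i j by simp
  finally show ?thesis .
qed

lemma End_form_inner_dbar:
  assumes T: "T \<in> End_sections A E" and c: "c \<in> A" "x \<in> fst c" and i: "i \<in> idx E" "x \<in> bdom E i"
  shows "End_form_inner A g E h (dbar T) (dbar T) x =
    form_norm (g c x) (h i x) (\<lambda>\<beta>. dbar T c i \<beta> x)"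
  using dbar_norm_invariant[OF T chart_at[OF A] c frame_at[OF E] i]
  by (simp add: End_form_inner_def Let_def form_norm_def hform_def)

lemma continuous_on_dbar_energy:
  assumes T: "T \<in> End_sections A E"
  shows "continuous_on UNIV (End_form_inner A g E h (dbar T) (dbar T))" (is "continuous_on UNIV ?q")
proof (rule continuous_on_chart_cover[OF A open_UNIV], unfold Int_UNIV_right)
  fix c assume c: "c \<in> A"
  note cc = chartD[OF atlasD(1)[OF A c]]
  have "continuous_on (\<Union>i\<in>idx E. fst c \<inter> bdom E i) ?q"
  proof (rule continuous_on_open_UN)
    fix i assume i: "i \<in> idx E"
    show "open (fst c \<inter> bdom E i)" using cc(1) holo_bundleD(1)[OF E i] by blast
    have dT: "continuous_on (fst c \<inter> bdom E i) (\<lambda>x. dbar T c i \<beta> x)" for \<beta>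
    proof -
      have V: "open (snd c ` (fst c \<inter> bdom E i))"
        by (rule open_chart_image[OF atlasD(1)[OF A c] holo_bundleD(1)[OF E i]])
      have "continuous_on (snd c ` (fst c \<inter> bdom E i)) (\<lambda>z. dzb_mat \<beta> (\<lambda>z. T i (chart_inv c z)) z)"
        unfolding dzb_mat_def dzb_eq_wirtinger
        by (intro continuous_on_vec_lambda smooth_on_imp_continuous_on smooth_on_wirtinger[OF V]
            End_sections_chart_smooth[OF A E T c i])
      from continuous_on_chart_compose[OF atlasD(1)[OF A c] this]
      show ?thesis by (simp add: dbar_def o_def)
    qed
    have "continuous_on (fst c \<inter> bdom E i)
        (\<lambda>x. form_norm (g c x) (h i x) (\<lambda>\<beta>. dbar T c i \<beta> x))"
    proof (rule continuous_on_form_norm[OF _ _ dT])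
      show "continuous_on (fst c \<inter> bdom E i) (g c)"
        by (rule continuous_on_subset[OF continuous_on_metric[OF c]]) simp
      show "continuous_on (fst c \<inter> bdom E i) (h i)"
        by (rule continuous_on_subset[OF smooth_fun_imp_continuous_on[OF A metricD(1)[OF h i] holo_bundleD(1)[OF E i]]]) simp
    qed (use metric_pos_def[OF c] metricD(2)[OF h i] hermitian_pos_def_invertible in auto)
    then show "continuous_on (fst c \<inter> bdom E i) ?q"
      by (rule continuous_on_eq) (use End_form_inner_dbar[OF T c _ i] in auto)
  qed
  moreover have "(\<Union>i\<in>idx E. fst c \<inter> bdom E i) = fst c" using holo_bundleD(2)[OF E] by auto
  ultimately show "continuous_on (fst c) ?q" by simp
qed

lemma End_L2_0: "End_L2 vol E h T (\<lambda>i x. 0) = 0"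
proof -
  have "End_inner E h T (\<lambda>i x. 0) x = 0" for x
    using hform_0(2) by (simp add: End_inner_def Let_def hform_def)
  then show ?thesis by (simp add: End_L2_def)
qed

text \<open>Testing the adjoint relation with T itself gives energy 0. The energy density is
  continuous, non-negative and definite, so \<open>dbar T\<close> vanishes at every point and not
  only almost everywhere.\<close>

lemma harmonic_imp_dbar_eq_0:
  assumes T: "T \<in> harmonic_End_sections A g vol E h"
    and c: "c \<in> A" "x \<in> fst c" and i: "i \<in> idx E" "x \<in> bdom E i"
  shows "dbar T c i \<beta> x = 0"
proof -
  let ?q = "End_form_inner A g E h (dbar T) (dbar T)"
  have TE: "T \<in> End_sections A E" using T by (simp add: harmonic_End_sections_def)
  have "End_form_L2 A g vol E h (dbar T) (dbar T) = End_L2 vol E h T (\<lambda>i x. 0)"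
    using T TE unfolding harmonic_End_sections_def dbar_adjoint_def by blast
  then have int: "(LINT x|vol. ?q x) = 0" by (simp add: End_form_L2_def End_L2_0)
  have q: "\<exists>t. ?q x = of_real t \<and> 0 \<le> t \<and> (t = 0 \<longrightarrow> (\<forall>\<beta>. dbar T c i \<beta> x = 0))"
    if c: "c \<in> A" "x \<in> fst c" and i: "i \<in> idx E" "x \<in> bdom E i" for x c i
    using form_norm_self[OF metric_pos_def[OF c] metricD(2)[OF h i], of "\<lambda>\<beta>. dbar T c i \<beta> x"]
    unfolding End_form_inner_dbar[OF TE c i] by metis
  have nonneg: "0 \<le> Re (?q x)" for x
    using q[OF chart_at[OF A] frame_at[OF E]] by (metis Re_complex_of_real)
  have cont: "continuous_on UNIV (\<lambda>x. Re (?q x))"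
    by (intro continuous_intros continuous_on_dbar_energy TE)
  have "(LINT x|vol. Re (?q x)) = 0"
    using integral_Re[OF integrable_vol[OF continuous_on_dbar_energy[OF TE]]] int by simp
  then have "Re (?q x) = 0" by (rule integral_vol_eq_0[OF cont nonneg])
  then show ?thesis using q[OF c i] by auto
qed

lemma harmonic_imp_scalar:
  assumes simple: "simple_bundle A E" and T: "T \<in> harmonic_End_sections A g vol E h"
  obtains \<mu> where "\<And>i x. i \<in> idx E \<Longrightarrow> x \<in> bdom E i \<Longrightarrow> T i x = mat \<mu>"
proof -
  have TE: "T \<in> End_sections A E" using T by (simp add: harmonic_End_sections_def)
  have "holo_mat_fun A (bdom E i) (T i)" if i: "i \<in> idx E" for i
    unfolding holo_mat_fun_def holo_on_def
  proof (intro ballI allI conjI)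
    fix c a b assume c: "c \<in> A"
    show "smooth_on (\<lambda>z. T i (chart_inv c z) $ a $ b) (snd c ` (fst c \<inter> bdom E i))"
      by (rule End_sections_chart_smooth[OF A E TE c i])
    fix z j assume "z \<in> snd c ` (fst c \<inter> bdom E i)"
    then obtain x where x: "x \<in> fst c" "x \<in> bdom E i" "z = snd c x" by auto
    have "dbar T c i j x $ a $ b = 0" using harmonic_imp_dbar_eq_0[OF T c x(1) i x(2)] by simp
    then show "dzb j (\<lambda>z. T i (chart_inv c z) $ a $ b) z = 0"
      by (simp add: dbar_def dzb_mat_def x(3))
  qed
  then show ?thesis using simple TE that unfolding simple_bundle_def by blast
qed

lemma zero_harmonic: "(\<lambda>i x. 0) \<in> harmonic_End_sections A g vol E h"
proof -
  have 0: "(\<lambda>i x. 0) \<in> End_sections A E"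
    by (auto simp: End_sections_def smooth_fun_def o_def smooth_on_const)
  have d0: "dbar (\<lambda>i x. 0) c i \<beta> x = 0" for c :: "('x, 'n) chart" and i :: 'i and \<beta> x
    by (simp add: dbar_def dzb_mat_def dzb_eq_wirtinger o_def wirtinger_const vec_eq_iff)
  have "End_form_inner A g E h (dbar T') (dbar (\<lambda>i x. 0)) x = 0" for T' x
    unfolding End_form_inner_def Let_def hform_def[symmetric] by (simp add: d0)
  then have "End_form_L2 A g vol E h (dbar T') (dbar (\<lambda>i x. 0)) = 0" for T'
    by (simp add: End_form_L2_def)
  then show ?thesis
    using 0 by (simp add: harmonic_End_sections_def dbar_adjoint_def End_L2_0)
qed

text \<open>All harmonic sections are scalars, and pairing with a scalar sees only the trace. The
  definite description requires both that 0 qualifies and that every candidate is 0.\<close>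

lemma harmonic_projection_eq_0:
  assumes simple: "simple_bundle A E"
    and int: "integrable vol (\<lambda>x. trace (R (frame_at E x) x))"
    and 0: "(LINT x|vol. trace (R (frame_at E x) x)) = 0"
  shows "harmonic_projection A g vol E h R = (\<lambda>i x. 0)"
proof -
  interpret finite_measure vol by (rule finite_measure_vol)
  \<comment> \<open>One formula serves both halves: \<mu> = 0 gives existence, and Q = P with \<nu>
    = \<mu> gives uniqueness.\<close>
  have L2: "End_L2 vol E h (\<lambda>i x. R i x - P i x) Q = - (cnj \<nu> * of_nat CARD('r) * \<mu> * of_real (measure vol UNIV))"
    if P: "\<And>i x. i \<in> idx E \<Longrightarrow> x \<in> bdom E i \<Longrightarrow> P i x = mat \<mu>"
      and Q: "\<And>i x. i \<in> idx E \<Longrightarrow> x \<in> bdom E i \<Longrightarrow> Q i x = mat \<nu>" for P Q \<mu> \<nu>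
  proof -
    have tr: "trace (mat \<mu> :: complex^'r^'r) = of_nat CARD('r) * \<mu>" by (simp add: trace_def mat_def)
    have "End_inner E h (\<lambda>i x. R i x - P i x) Q x = cnj \<nu> * (trace (R (frame_at E x) x) - of_nat CARD('r) * \<mu>)" for x
      unfolding End_inner_def Let_def hform_def[symmetric] Q[OF frame_at[OF E]] P[OF frame_at[OF E]]
      by (simp add: hform_mat_right[OF hermitian_pos_def_invertible[OF metricD(2)[OF h frame_at[OF E]]]]
          trace_sub tr)
    then have "End_L2 vol E h (\<lambda>i x. R i x - P i x) Q =
        (LINT x|vol. cnj \<nu> * (trace (R (frame_at E x) x) - of_nat CARD('r) * \<mu>))"
      by (simp add: End_L2_def)
    also have "\<dots> = cnj \<nu> * (0 - of_nat CARD('r) * \<mu> * of_real (measure vol UNIV))"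
      using int 0 by (simp add: space_vol scaleR_conv_of_real mult.commute)
    finally show ?thesis by simp
  qed
  have pos: "measure vol UNIV \<noteq> 0"
    using emeasure_vol_open_pos[OF open_UNIV UNIV_I] by (simp add: emeasure_eq_measure)
  show ?thesis
    unfolding harmonic_projection_def
  proof (rule the_equality)
    have "End_L2 vol E h (\<lambda>i x. R i x - 0) Q = 0" if "Q \<in> harmonic_End_sections A g vol E h" for Q
      using L2[of "\<lambda>i x. 0" 0 Q] harmonic_imp_scalar[OF simple that] by (metis mat_0 mult_zero_right mult_zero_left minus_zero)
    then show "(\<lambda>i x. 0) \<in> harmonic_End_sections A g vol E h \<and>
        (\<forall>Q\<in>harmonic_End_sections A g vol E h. End_L2 vol E h (\<lambda>i x. R i x - (\<lambda>i x. 0) i x) Q = 0)"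
      using zero_harmonic by simp
  next
    fix P assume P: "P \<in> harmonic_End_sections A g vol E h \<and>
        (\<forall>Q\<in>harmonic_End_sections A g vol E h. End_L2 vol E h (\<lambda>i x. R i x - P i x) Q = 0)"
    obtain \<mu> where \<mu>: "\<And>i x. i \<in> idx E \<Longrightarrow> x \<in> bdom E i \<Longrightarrow> P i x = mat \<mu>"
      using harmonic_imp_scalar[OF simple] P by blast
    have "cnj \<mu> * of_nat CARD('r) * \<mu> * of_real (measure vol UNIV) = 0"
      using L2[of P \<mu> P \<mu>, OF \<mu> \<mu>] P by simp
    then have "\<mu> = 0" using pos by simp
    \<comment> \<open>Outside the frame domains sections are 0 by convention, which upgrades
      vanishing of the section to equality of functions.\<close>
    then have "P i x = 0" for i x
      using \<mu> End_sectionsD(3)[of P A E i x] P by (cases "i \<in> idx E \<and> x \<in> bdom E i")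
        (auto simp: harmonic_End_sections_def mat_0)
    then show "P = (\<lambda>i x. 0)" by (simp add: fun_eq_iff)
  qed
qed

end

end

section \<open>The trace of the curvature\<close>

lemma dz_mat_nth [simp]: "dz_mat j M z $ a $ b = dz j (\<lambda>w. M w $ a $ b) z"
  by (simp add: dz_mat_def)

lemma dzb_mat_nth [simp]: "dzb_mat j M z $ a $ b = dzb j (\<lambda>w. M w $ a $ b) z"
  by (simp add: dzb_mat_def)

lemma smooth_on_connection:
  fixes M :: "complex^'n::finite \<Rightarrow> complex^'r::finite^'r"
  assumes V: "open V" and M: "smooth_on M V" and inv: "\<And>z. z \<in> V \<Longrightarrow> invertible (M z)"
  shows "smooth_on (\<lambda>z. (dz_mat k M z ** matrix_inv (M z)) $ a $ b) V"
proof -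
  have "smooth_on (\<lambda>z. \<Sum>i\<in>UNIV. dz k (\<lambda>w. M w $ a $ i) z * matrix_inv (M z) $ i $ b) V"
    unfolding dz_eq_wirtinger
    by (intro smooth_on_sum smooth_on_mult smooth_on_wirtinger smooth_on_matrix_inv smooth_on_nth V M inv)
  then show ?thesis by (simp add: matrix_matrix_mult_def)
qed

text \<open>Both derivatives in this component are along S, so x can be frozen: the component is the
  curvature over S of the metric \<open>H (x, _)\<close>.\<close>

lemma curvature_prod_chart:
  fixes c :: "('x::topological_space, 'n::finite) chart" and d :: "('s::topological_space, 'm::finite) chart"
    and H :: "'x \<times> 's \<Rightarrow> complex^'r::finite^'r"
  assumes c: "topological_chart c" and d: "topological_chart d" and W: "open W"
    and H: "smooth_on (\<lambda>u. H (chart_inv (prod_chart c d) u)) (prod_image c d W)"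
    and inv: "\<And>p. p \<in> W \<Longrightarrow> invertible (H p)"
    and x: "x \<in> fst c" and s: "s \<in> fst d" "(x, s) \<in> W"
  shows "curvature (prod_chart c d) H (Inr k) (Inr l) (x, s) = curvature d (\<lambda>s. H (x, s)) k l s"
proof -
  let ?P = "prod_chart c d" and ?w = "snd d s"
  let ?V = "snd d ` (fst d \<inter> {s. (x, s) \<in> W})"
  define N where "N u = dz_mat (Inr k) (H \<circ> chart_inv ?P) u ** matrix_inv (H (chart_inv ?P u))" for u
  define N' where "N' w = dz_mat k ((\<lambda>s. H (x, s)) \<circ> chart_inv d) w ** matrix_inv (H (x, chart_inv d w))" for w
  note O = open_prod_chart_image[OF c d W]
  have V: "open ?V" "?w \<in> ?V" using open_image_right[OF c d W] s by auto
  have invP: "invertible (H (chart_inv ?P u))" if "u \<in> prod_image c d W" for u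
    using prod_imageE[OF c d that] inv by metis
  have sN: "smooth_on (\<lambda>u. N u $ a $ b) (prod_image c d W)" for a b
    unfolding N_def using smooth_on_connection[OF O H invP] by (simp add: o_def)
  have Hs: "smooth_on (\<lambda>u. H (chart_inv ?P u) $ a $ b) (prod_image c d W)" for a b
    by (rule smooth_on_nth[OF O H])
  have NN: "N (vec_join (snd c x) w) = N' w" if w: "w \<in> ?V" for w
  proof -
    have "dz k (\<lambda>w. H (x, chart_inv d w) $ a $ b) w = dz (Inr k) (\<lambda>u. H (chart_inv ?P u) $ a $ b) (vec_join (snd c x) w)" for a b
      unfolding dz_eq_wirtinger
      using wirtinger_slice_right[OF c d W, of "\<lambda>p. H p $ a $ b", OF Hs x w] by simp
    then have "dz_mat (Inr k) (H \<circ> chart_inv ?P) (vec_join (snd c x) w) = dz_mat k ((\<lambda>s. H (x, s)) \<circ> chart_inv d) w"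
      by (simp add: vec_eq_iff)
    then show ?thesis using slice_right_inv[OF c d W x w] by (simp add: N_def N'_def)
  qed
  have w: "vec_join (snd c x) ?w \<in> prod_image c d W" using slice_right_image[OF c d W x] V(2) by blast
  have "dzb (Inr l) (\<lambda>u. N u $ a $ b) (vec_join (snd c x) ?w) = dzb l (\<lambda>w. N' w $ a $ b) ?w" for a b
  proof -
    have "dzb (Inr l) (\<lambda>u. N u $ a $ b) (vec_join (snd c x) ?w) = dzb l (\<lambda>w. N (vec_join (snd c x) w) $ a $ b) ?w"
      unfolding dzb_eq_wirtinger
      by (rule wirtinger_vec_join[symmetric], rule smooth_on_differentiable[OF sN w])
    also have "\<dots> = dzb l (\<lambda>w. N' w $ a $ b) ?w"
      unfolding dzb_eq_wirtinger by (rule wirtinger_cong[OF V]) (simp add: NN)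
    finally show ?thesis .
  qed
  then have "dzb_mat (Inr l) N (snd ?P (x, s)) = dzb_mat l N' ?w" by (simp add: vec_eq_iff)
  then show ?thesis unfolding curvature_def N_def N'_def by simp
qed

text \<open>Jacobi's formula divided by the determinant: ln det is a potential for the trace of the
  connection form.\<close>

lemma of_real_ln_det:
  fixes M :: "complex^'n::finite \<Rightarrow> complex^'r::finite^'r"
  assumes V: "open V" "z \<in> V" and M: "smooth_on M V" and pos: "\<And>z. z \<in> V \<Longrightarrow> hermitian_pos_def (M z)"
  shows "dz k (\<lambda>z. of_real (ln (Re (det (M z))))) z = trace (dz_mat k M z ** matrix_inv (M z))"
proof -
  have sm: "smooth_on (\<lambda>z. M z $ a $ b) V" for a b by (rule smooth_on_nth[OF V(1) M])
  have det: "smooth_on (\<lambda>z. det (M z)) V" by (rule smooth_on_det[OF V(1) sm])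
  have "dz k (\<lambda>z. of_real (ln (Re (det (M z))))) z = dz k (\<lambda>z. of_real (Re (det (M z)))) z / of_real (Re (det (M z)))"
    unfolding dz_eq_wirtinger
    by (rule wirtinger_of_real_ln[OF smooth_on_differentiable[OF smooth_on_bounded_linear_comp[OF bounded_linear_Re V(1) det] V(2)]
          hermitian_pos_def_det(1)[OF pos[OF V(2)]]])
  also have "dz k (\<lambda>z. of_real (Re (det (M z)))) z = dz k (\<lambda>z. det (M z)) z"
    unfolding dz_eq_wirtinger by (rule wirtinger_cong[OF V]) (rule hermitian_pos_def_det(2)[OF pos, symmetric])
  also have "of_real (Re (det (M z))) = det (M z)" by (rule hermitian_pos_def_det(2)[OF pos[OF V(2)], symmetric])
  also have "dz k (\<lambda>z. det (M z)) z = trace (dz_mat k M z ** matrix_inv (M z)) * det (M z)"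
    unfolding dz_mat_def dz_eq_wirtinger
    by (rule wirtinger_det[OF smooth_on_differentiable[OF sm V(2)] hermitian_pos_def_invertible[OF pos[OF V(2)]]])
  finally show ?thesis
    using hermitian_pos_def_invertible[OF pos[OF V(2)]] by (simp add: invertible_det_nz)
qed

lemma dzb_dz_add:
  assumes "open V" "smooth_on f V" "smooth_on f' V" "w \<in> V"
  shows "dzb l (dz k (\<lambda>w. f w + f' w)) w = dzb l (dz k f) w + dzb l (dz k f') w"
proof -
  have "dzb l (dz k (\<lambda>w. f w + f' w)) w = dzb l (\<lambda>w. dz k f w + dz k f' w) w"
    unfolding dz_dzb_eq using assms
    by (intro wirtinger_cong[OF assms(1,4)] wirtinger_add) (auto intro: smooth_on_differentiable)
  also have "\<dots> = dzb l (dz k f) w + dzb l (dz k f') w"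
    unfolding dz_dzb_eq using assms
    by (intro wirtinger_add smooth_on_differentiable[OF smooth_on_wirtinger]) auto
  finally show ?thesis .
qed

lemma dzb_dz_cmult:
  assumes "open V" "smooth_on f V" "w \<in> V"
  shows "dzb l (dz k (\<lambda>w. c * f w)) w = c * dzb l (dz k f) w"
proof -
  have "dzb l (dz k (\<lambda>w. c * f w)) w = dzb l (\<lambda>w. c * dz k f w) w"
    unfolding dz_dzb_eq using assms
    by (intro wirtinger_cong[OF assms(1,3)] wirtinger_cmult) (auto intro: smooth_on_differentiable)
  also have "\<dots> = c * dzb l (dz k f) w"
    unfolding dz_dzb_eq using assms
    by (intro wirtinger_cmult smooth_on_differentiable[OF smooth_on_wirtinger]) auto
  finally show ?thesis .
qed

lemma det_scaleR: "det (c *\<^sub>R M) = of_real (c ^ CARD('r)) * det (M :: complex^'r::finite^'r)"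
  by (simp add: det_def scaleR_conv_of_real[where 'a = complex] prod.distrib sum_distrib_left mult_ac)

lemma smooth_on_of_real:
  fixes f :: "'b::real_normed_vector \<Rightarrow> real"
  shows "open V \<Longrightarrow> smooth_on f V \<Longrightarrow> smooth_on (\<lambda>w. complex_of_real (f w)) V"
  by (rule smooth_on_bounded_linear_comp[OF bounded_linear_of_real])

lemma dzb_dz_sum:
  assumes "open V" "\<And>i. i \<in> I \<Longrightarrow> smooth_on (f i) V" "w \<in> V"
  shows "dzb l (dz k (\<lambda>w. \<Sum>i\<in>I. f i w)) w = (\<Sum>i\<in>I. dzb l (dz k (f i)) w)"
  using assms(2)
proof (induction I rule: infinite_finite_induct)
  case (insert i I)
  then show ?case
    using dzb_dz_add[OF assms(1) _ smooth_on_sum[OF assms(1)] assms(3), of "f i" I f l k] by simp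
qed (simp_all add: dz_dzb_eq wirtinger_const[abs_def])

section \<open>The trace of the curvature along S through its logarithmic potential\<close>

context
  fixes d :: "('s::topological_space, 'm::finite) chart" and U :: "'s set"
  assumes d: "topological_chart d" and U: "open U"
begin

text \<open>The trace commutes with \<open>dzb\<close>, and the trace of the connection matrix is
  the derivative of ln det H on the whole open set, so it may be replaced under the outer
  derivative.\<close>

lemma trace_curvature:
  fixes H :: "'s \<Rightarrow> complex^'r::finite^'r"
  assumes H: "smooth_on (\<lambda>w. H (chart_inv d w)) (snd d ` (fst d \<inter> U))"
    and pos: "\<And>s. s \<in> U \<Longrightarrow> hermitian_pos_def (H s)" and s: "s \<in> fst d" "s \<in> U"
  shows "trace (curvature d H k l s) = - dzb l (dz k (\<lambda>w. of_real (ln (Re (det (H (chart_inv d w))))))) (snd d s)"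
proof -
  let ?V = "snd d ` (fst d \<inter> U)" and ?M = "\<lambda>w. H (chart_inv d w)"
  have V: "open ?V" "snd d s \<in> ?V" using open_chart_image[OF d U] s by auto
  have posM: "hermitian_pos_def (?M w)" if "w \<in> ?V" for w
    using that pos chartD(5)[OF d] by auto
  let ?N = "\<lambda>w. dz_mat k ?M w ** matrix_inv (?M w)"
  have N: "smooth_on (\<lambda>w. ?N w $ a $ b) ?V" for a b
    by (rule smooth_on_connection[OF V(1) H hermitian_pos_def_invertible[OF posM]])
  have "trace (curvature d H k l s) = - (\<Sum>a\<in>UNIV. dzb l (\<lambda>w. ?N w $ a $ a) (snd d s))"
    by (simp add: curvature_def trace_def o_def sum_negf)
  also have "(\<Sum>a\<in>UNIV. dzb l (\<lambda>w. ?N w $ a $ a) (snd d s)) = dzb l (\<lambda>w. trace (?N w)) (snd d s)"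
    unfolding trace_def dzb_eq_wirtinger
    by (rule wirtinger_sum[symmetric], rule smooth_on_differentiable[OF N V(2)])
  also have "\<dots> = dzb l (dz k (\<lambda>w. of_real (ln (Re (det (?M w)))))) (snd d s)"
    unfolding dzb_eq_wirtinger
    by (rule wirtinger_cong[OF V]) (rule of_real_ln_det[OF V(1) _ H posM, symmetric])
  finally show ?thesis .
qed

lemma smooth_on_ln_det:
  fixes H :: "'s \<Rightarrow> complex^'r::finite^'r"
  assumes H: "smooth_on (\<lambda>w. H (chart_inv d w)) (snd d ` (fst d \<inter> U))"
    and pos: "\<And>s. s \<in> U \<Longrightarrow> hermitian_pos_def (H s)"
  shows "smooth_on (\<lambda>w. ln (Re (det (H (chart_inv d w))))) (snd d ` (fst d \<inter> U))"
proof -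
  note V = open_chart_image[OF d U]
  show ?thesis
  proof (intro smooth_on_ln V smooth_on_bounded_linear_comp[OF bounded_linear_Re] smooth_on_det smooth_on_nth H)
    fix w assume "w \<in> snd d ` (fst d \<inter> U)"
    then show "0 < Re (det (H (chart_inv d w)))"
      using hermitian_pos_def_det(1)[OF pos] chartD(5)[OF d] by auto
  qed
qed

text \<open>The determinant of an r by r matrix scales by the r-th power, so the potential gains r
  \<phi>; this is the origin of the factor \<open>CARD('r)\<close>.\<close>

lemma trace_curvature_rescale:
  fixes H :: "'s \<Rightarrow> complex^'r::finite^'r"
  assumes H: "smooth_on (\<lambda>w. H (chart_inv d w)) (snd d ` (fst d \<inter> U))"
    and pos: "\<And>s. s \<in> U \<Longrightarrow> hermitian_pos_def (H s)"
    and \<phi>: "smooth_on (\<lambda>w. \<phi> (chart_inv d w)) (snd d ` (fst d \<inter> U))" and s: "s \<in> fst d" "s \<in> U"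
  shows "trace (curvature d (\<lambda>s. exp (\<phi> s) *\<^sub>R H s) k l s) =
    trace (curvature d H k l s) - of_nat CARD('r) * dzb l (dz k (\<lambda>w. of_real (\<phi> (chart_inv d w)))) (snd d s)"
proof -
  let ?V = "snd d ` (fst d \<inter> U)"
  have V: "open ?V" "snd d s \<in> ?V" using open_chart_image[OF d U] s by auto
  have H': "smooth_on (\<lambda>w. exp (\<phi> (chart_inv d w)) *\<^sub>R H (chart_inv d w)) ?V"
    by (intro smooth_on_scaleR smooth_on_exp V \<phi> H)
  let ?p = "\<lambda>w. complex_of_real (\<phi> (chart_inv d w))" and ?q = "\<lambda>w. complex_of_real (ln (Re (det (H (chart_inv d w)))))"
  have sp: "smooth_on ?p ?V" and sq: "smooth_on ?q ?V"
    by (intro smooth_on_of_real V \<phi> smooth_on_ln_det[OF H pos], assumption?)+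
  have "complex_of_real (ln (Re (det (exp (\<phi> (chart_inv d w)) *\<^sub>R H (chart_inv d w))))) = of_nat CARD('r) * ?p w + ?q w"
    if "w \<in> ?V" for w
  proof -
    have "0 < Re (det (H (chart_inv d w)))"
      using that hermitian_pos_def_det(1)[OF pos] chartD(5)[OF d] by auto
    then show ?thesis by (simp add: det_scaleR ln_mult ln_realpow flip: exp_of_nat_mult of_real_power)
  qed
  then have "dzb l (dz k (\<lambda>w. complex_of_real (ln (Re (det (exp (\<phi> (chart_inv d w)) *\<^sub>R H (chart_inv d w))))))) (snd d s) =
      dzb l (dz k (\<lambda>w. of_nat CARD('r) * ?p w + ?q w)) (snd d s)"
    unfolding dz_dzb_eq
    by (intro wirtinger_cong[OF V] wirtinger_cong[OF V(1)]) auto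
  also have "\<dots> = of_nat CARD('r) * dzb l (dz k ?p) (snd d s) + dzb l (dz k ?q) (snd d s)"
    using dzb_dz_add[OF V(1) smooth_on_mult[OF V(1) smooth_on_const sp] sq V(2)] dzb_dz_cmult[OF V(1) sp V(2)] by simp
  finally show ?thesis
    using trace_curvature[OF H' _ s, of k l] trace_curvature[OF H pos s, of k l] hermitian_pos_def_scaleR[OF pos]
    by simp
qed

text \<open>The two potentials differ by \<open>ln \<bar>det f\<bar>\<^sup>2\<close>, which is pluriharmonic.\<close>

lemma trace_curvature_change_frame:
  fixes H H' f :: "'s \<Rightarrow> complex^'r::finite^'r"
  assumes H: "smooth_on (\<lambda>w. H (chart_inv d w)) (snd d ` (fst d \<inter> U))" "\<And>s. s \<in> U \<Longrightarrow> hermitian_pos_def (H s)"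
    and H': "smooth_on (\<lambda>w. H' (chart_inv d w)) (snd d ` (fst d \<inter> U))" "\<And>s. s \<in> U \<Longrightarrow> hermitian_pos_def (H' s)"
    and f: "\<And>a b. holo_on (\<lambda>w. f (chart_inv d w) $ a $ b) (snd d ` (fst d \<inter> U))" "\<And>s. s \<in> U \<Longrightarrow> invertible (f s)"
    and eq: "\<And>s. s \<in> U \<Longrightarrow> H s = f s ** H' s ** ctranspose (f s)" and s: "s \<in> fst d" "s \<in> U"
  shows "trace (curvature d H k l s) = trace (curvature d H' k l s)"
proof -
  let ?V = "snd d ` (fst d \<inter> U)"
  have V: "open ?V" "snd d s \<in> ?V" using open_chart_image[OF d U] s by auto
  have inU: "chart_inv d w \<in> U" if "w \<in> ?V" for w using that chartD(5)[OF d] by auto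
  define F where "F w = det (f (chart_inv d w))" for w
  have fs: "smooth_on (\<lambda>w. f (chart_inv d w) $ a $ b) ?V" for a b using f(1) holo_on_def by blast
  have sF: "smooth_on F ?V" unfolding F_def by (rule smooth_on_det[OF V(1) fs])
  have F0: "F w \<noteq> 0" if "w \<in> ?V" for w
    using f(2)[OF inU[OF that]] by (simp add: F_def invertible_det_nz)
  \<comment> \<open>Jacobi's formula with every entry killed by \<open>dzb\<close> shows that the
    determinant is holomorphic.\<close>
  have hF: "dzb j F w = 0" if w: "w \<in> ?V" for j w
  proof -
    have "dzb j (\<lambda>w. f (chart_inv d w) $ a $ b) w = 0" for a b using f(1) w unfolding holo_on_def by blast
    then have "(\<chi> a b. dzb j (\<lambda>w. f (chart_inv d w) $ a $ b) w) = (0 :: complex^'r^'r)" by (simp add: vec_eq_iff)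
    then show ?thesis
      using wirtinger_det[OF smooth_on_differentiable[OF fs w] f(2)[OF inU[OF w]], of \<i> j]
      unfolding F_def dzb_eq_wirtinger by (simp add: trace_def)
  qed
  let ?q = "\<lambda>w. complex_of_real (ln (Re (det (H' (chart_inv d w)))))" and ?p = "\<lambda>w. complex_of_real (ln ((cmod (F w))\<^sup>2))"
  have cF: "smooth_on (\<lambda>w. cnj (F w)) ?V"
    by (rule smooth_on_bounded_linear_comp[OF bounded_linear_cnj V(1) sF])
  have nF: "smooth_on (\<lambda>w. (cmod (F w))\<^sup>2) ?V"
  proof (rule smooth_on_cong[OF V(1)])
    show "smooth_on (\<lambda>w. Re (F w * cnj (F w))) ?V"
      by (intro smooth_on_bounded_linear_comp[OF bounded_linear_Re] smooth_on_mult V sF cF)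
  qed (simp add: complex_mult_cnj cmod_power2)
  have sp: "smooth_on ?p ?V"
    by (intro smooth_on_of_real smooth_on_ln V nF) (use F0 in auto)
  have sq: "smooth_on ?q ?V" by (rule smooth_on_of_real[OF V(1) smooth_on_ln_det[OF H']])
  \<comment> \<open>Of the two product terms in |F|^2 = F \<open>cnj F\<close> only the derivative
    of F survives, and the factor \<open>cnj F\<close> cancels. The quotient left over is
    holomorphic.\<close>
  have dp: "dz k ?p w = dz k F w * inverse (F w)" if w: "w \<in> ?V" for w
  proof -
    have "dz k ?p w = dz k (\<lambda>w. of_real ((cmod (F w))\<^sup>2)) w / of_real ((cmod (F w))\<^sup>2)"
      unfolding dz_eq_wirtinger by (rule wirtinger_of_real_ln[OF smooth_on_differentiable[OF nF w]]) (use F0[OF w] in auto)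
    also have "dz k (\<lambda>w. of_real ((cmod (F w))\<^sup>2)) w = dz k (\<lambda>w. F w * cnj (F w)) w"
      unfolding complex_norm_square ..
    also have "\<dots> = dz k F w * cnj (F w) + F w * dz k (\<lambda>w. cnj (F w)) w"
      unfolding dz_eq_wirtinger by (rule wirtinger_mult[OF smooth_on_differentiable[OF sF w] smooth_on_differentiable[OF cF w]])
    also have "dz k (\<lambda>w. cnj (F w)) w = cnj (dzb k F w)"
      unfolding dz_dzb_eq using wirtinger_cnj[OF smooth_on_differentiable[OF sF w]] by simp
    finally have "dz k ?p w = dz k F w * cnj (F w) / (F w * cnj (F w))"
      by (simp only: complex_norm_square hF[OF w] complex_cnj_zero mult_zero_right add_0_right)
    then show ?thesis using F0[OF w] by (simp add: field_simps)
  qed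
  \<comment> \<open>In the product rule the inverse contributes nothing. The other term vanishes
    after commuting the derivatives, because \<open>dzb l F\<close> is 0 on the whole
    neighbourhood.\<close>
  have "dzb l (dz k ?p) (snd d s) = dzb l (\<lambda>w. dz k F w * inverse (F w)) (snd d s)"
    unfolding dzb_eq_wirtinger by (rule wirtinger_cong[OF V dp])
  also have "\<dots> = dzb l (dz k F) (snd d s) * inverse (F (snd d s)) + dz k F (snd d s) * dzb l (\<lambda>w. inverse (F w)) (snd d s)"
    unfolding dz_dzb_eq
    by (intro wirtinger_mult smooth_on_differentiable[OF _ V(2)] smooth_on_wirtinger smooth_on_inverse V sF F0)
  also have "dzb l (\<lambda>w. inverse (F w)) (snd d s) = 0"
    using wirtinger_inverse[OF smooth_on_differentiable[OF sF V(2)] F0[OF V(2)], of \<i> l] hF[OF V(2), of l]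
    by (simp add: dzb_eq_wirtinger)
  also have "dzb l (dz k F) (snd d s) = dz k (dzb l F) (snd d s)"
    unfolding dz_dzb_eq by (rule wirtinger_commute[OF V(1) sF V(2)])
  also have "dz k (dzb l F) (snd d s) = dz k (\<lambda>w. 0) (snd d s)"
    unfolding dz_eq_wirtinger by (rule wirtinger_cong[OF V hF])
  finally have p0: "dzb l (dz k ?p) (snd d s) = 0" by (simp add: dz_eq_wirtinger wirtinger_const)
  have "complex_of_real (ln (Re (det (H (chart_inv d w))))) = ?p w + ?q w" if w: "w \<in> ?V" for w
  proof -
    note h' = hermitian_pos_def_det[OF H'(2)[OF inU[OF w]]]
    have "det (H (chart_inv d w)) = F w * cnj (F w) * of_real (Re (det (H' (chart_inv d w))))"
      using h'(2) by (simp add: eq[OF inU[OF w]] det_mul det_ctranspose F_def)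
    also have "\<dots> = of_real ((cmod (F w))\<^sup>2 * Re (det (H' (chart_inv d w))))"
      by (simp only: complex_norm_square of_real_mult)
    finally show ?thesis using h'(1) F0[OF w] by (simp add: ln_mult)
  qed
  then have "dzb l (dz k (\<lambda>w. complex_of_real (ln (Re (det (H (chart_inv d w))))))) (snd d s) =
      dzb l (dz k (\<lambda>w. ?p w + ?q w)) (snd d s)"
    unfolding dz_dzb_eq
    by (intro wirtinger_cong[OF V] wirtinger_cong[OF V(1)]) auto
  also have "\<dots> = dzb l (dz k ?q) (snd d s)"
    using dzb_dz_add[OF V(1) sp sq V(2)] p0 by simp
  finally show ?thesis
    using trace_curvature[OF H s, of k l] trace_curvature[OF H' s, of k l] by simp
qed

end

section \<open>Averaging the local potentials over X\<close>

context
  fixes c :: "('x::topological_space, 'n::finite) chart" and d :: "('s::topological_space, 'm::finite) chart"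
    and W :: "('x \<times> 's) set" and H :: "'x \<times> 's \<Rightarrow> complex^'r::finite^'r"
    and M :: "'x measure" and K :: "'x set" and U :: "'s set" and \<eta> :: "'x \<Rightarrow> real"
  assumes c: "topological_chart c" and d: "topological_chart d" and W: "open W"
    and H: "smooth_on (\<lambda>u. H (chart_inv (prod_chart c d) u)) (prod_image c d W)"
    and pos: "\<And>p. p \<in> W \<Longrightarrow> hermitian_pos_def (H p)"
    and M: "sets M = sets borel" and K: "compact K" "closed K" "K \<subseteq> fst c" and U: "open U" and KU: "K \<times> U \<subseteq> W"
    and \<eta>: "integrable M \<eta>" "\<And>x. x \<notin> K \<Longrightarrow> \<eta> x = 0"
begin

text \<open>A summand of the function \<Phi> of the overview, without a choice of coordinates on S.
  For s in U the support of the weight stays inside W, where the determinant is positive.\<close>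

definition "averaged_potential s = (LINT x|M. \<eta> x *\<^sub>R ln (Re (det (H (x, s)))))"

lemma smooth_on_potential:
  "smooth_on (\<lambda>u. ln (Re (det (H (chart_inv (prod_chart c d) u))))) (prod_image c d W)"
proof -
  note O = open_prod_chart_image[OF c d W]
  show ?thesis
  proof (intro smooth_on_ln O smooth_on_bounded_linear_comp[OF bounded_linear_Re] smooth_on_det smooth_on_nth H)
    fix u assume "u \<in> prod_image c d W"
    then show "0 < Re (det (H (chart_inv (prod_chart c d) u)))"
      by (rule prod_imageE[OF c d]) (simp add: hermitian_pos_def_det(1)[OF pos])
  qed
qed

text \<open>The facts needed to use the parameter integrals with the coordinate map of X as \<zeta>
  and the chart image of U as parameter set.\<close>

lemma potential_param:
  "continuous_on K (snd c)" "open (snd d ` (fst d \<inter> U))"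
  "\<And>x w. x \<in> K \<Longrightarrow> w \<in> snd d ` (fst d \<inter> U) \<Longrightarrow> vec_join (snd c x) w \<in> prod_image c d W"
  "\<And>x w. x \<in> K \<Longrightarrow> w \<in> snd d ` (fst d \<inter> U) \<Longrightarrow>
     chart_inv (prod_chart c d) (vec_join (snd c x) w) = (x, chart_inv d w)"
proof -
  show "continuous_on K (snd c)" by (rule continuous_on_subset[OF chartD(3)[OF c] K(3)])
  show "open (snd d ` (fst d \<inter> U))" by (rule open_chart_image[OF d U])
  fix x w assume x: "x \<in> K" and w: "w \<in> snd d ` (fst d \<inter> U)"
  have w': "w \<in> snd d ` (fst d \<inter> {s. (x, s) \<in> W})" using w x KU by auto
  show "vec_join (snd c x) w \<in> prod_image c d W"
    using slice_right_image[OF c d W, of x] x K(3) w' by blast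
  show "chart_inv (prod_chart c d) (vec_join (snd c x) w) = (x, chart_inv d w)"
    using slice_right_inv[OF c d W _ w'] x K(3) by blast
qed

text \<open>Brings the integrand into product coordinates. Off K, where the chart of X need not make
  sense, the zero weight hides the difference.\<close>

lemma averaged_potential_eq:
  assumes "w \<in> snd d ` (fst d \<inter> U)"
  shows "averaged_potential (chart_inv d w) =
    (LINT x|M. \<eta> x *\<^sub>R ln (Re (det (H (chart_inv (prod_chart c d) (vec_join (snd c x) w))))))"
  unfolding averaged_potential_def
proof (rule Bochner_Integration.integral_cong[OF refl])
  fix x
  show "\<eta> x *\<^sub>R ln (Re (det (H (x, chart_inv d w)))) =
      \<eta> x *\<^sub>R ln (Re (det (H (chart_inv (prod_chart c d) (vec_join (snd c x) w)))))"
    using potential_param(4)[OF _ assms] \<eta>(2) by (cases "x \<in> K") auto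
qed

lemma smooth_on_averaged_potential:
  "smooth_on (\<lambda>w. averaged_potential (chart_inv d w)) (snd d ` (fst d \<inter> U))"
  by (rule smooth_on_cong[OF potential_param(2) averaged_potential_eq[symmetric]
        smooth_on_param_integral[OF M K(1,2) \<eta> potential_param(1,2) open_prod_chart_image[OF c d W]
          potential_param(3) smooth_on_potential]])

text \<open>Two differentiations under the integral move the mixed derivative onto ln det H, and for
  frozen x in K that is minus the trace of the curvature.\<close>

lemma dzb_dz_averaged_potential:
  assumes s: "s \<in> fst d" "s \<in> U"
  shows "integrable M (\<lambda>x. \<eta> x *\<^sub>R trace (curvature d (\<lambda>s. H (x, s)) k l s))" (is ?int)
    and "dzb l (dz k (\<lambda>w. of_real (averaged_potential (chart_inv d w)))) (snd d s) =
      - (LINT x|M. \<eta> x *\<^sub>R trace (curvature d (\<lambda>s. H (x, s)) k l s))" (is ?eq)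
proof -
  let ?V = "snd d ` (fst d \<inter> U)" and ?w = "snd d s"
  note O = open_prod_chart_image[OF c d W]
  have V: "open ?V" "?w \<in> ?V" using potential_param(2) s by auto
  define G where "G u = complex_of_real (ln (Re (det (H (chart_inv (prod_chart c d) u)))))" for u
  have G: "smooth_on G (prod_image c d W)"
    unfolding G_def by (rule smooth_on_bounded_linear_comp[OF bounded_linear_of_real O smooth_on_potential])
  note sw = smooth_on_wirtinger[OF O G, of "- \<i>" "Inr k"]
  note sww = smooth_on_wirtinger[OF O sw, of \<i> "Inr l"]
  note param = M K(1,2) \<eta> potential_param(1,2) O potential_param(3)
  have pot: "complex_of_real (averaged_potential (chart_inv d w)) = (LINT x|M. \<eta> x *\<^sub>R G (vec_join (snd c x) w))"
    if "w \<in> ?V" for w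
  proof -
    have "\<eta> x *\<^sub>R G u = complex_of_real (\<eta> x *\<^sub>R ln (Re (det (H (chart_inv (prod_chart c d) u)))))" for x u
      by (simp add: G_def scaleR_conv_of_real)
    then show ?thesis unfolding averaged_potential_eq[OF that] by (simp only: integral_complex_of_real)
  qed
  have tr: "\<eta> x *\<^sub>R wirtinger \<i> (Inr l) (wirtinger (- \<i>) (Inr k) G) (vec_join (snd c x) ?w) =
      - (\<eta> x *\<^sub>R trace (curvature d (\<lambda>s. H (x, s)) k l s))" for x
  proof (cases "x \<in> K")
    case True
    let ?S = "{s. (x, s) \<in> W}"
    let ?Vx = "snd d ` (fst d \<inter> ?S)"
    have xc: "x \<in> fst c" using True K(3) by blast
    have wV: "open ?Vx" "?w \<in> ?Vx" using open_image_right[OF c d W] True KU s by auto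
    have 1: "wirtinger (- \<i>) k (\<lambda>w. complex_of_real (ln (Re (det (H (x, chart_inv d w)))))) w =
        wirtinger (- \<i>) (Inr k) G (vec_join (snd c x) w)" if "w \<in> ?Vx" for w
      unfolding G_def
      by (rule wirtinger_slice_right[OF c d W, of "\<lambda>p. complex_of_real (ln (Re (det (H p))))", OF G[unfolded G_def] xc that])
    have "wirtinger \<i> (Inr l) (wirtinger (- \<i>) (Inr k) G) (vec_join (snd c x) ?w) =
        wirtinger \<i> l (\<lambda>w. wirtinger (- \<i>) (Inr k) G (vec_join (snd c x) w)) ?w"
      by (rule wirtinger_vec_join[symmetric], rule smooth_on_differentiable[OF sw], rule potential_param(3)[OF True V(2)])
    also have "\<dots> = wirtinger \<i> l (wirtinger (- \<i>) k (\<lambda>w. complex_of_real (ln (Re (det (H (x, chart_inv d w))))))) ?w"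
      by (rule wirtinger_cong[OF wV]) (simp add: 1)
    also have "\<dots> = - trace (curvature d (\<lambda>s. H (x, s)) k l s)"
      using trace_curvature[OF d open_slice_right[OF W, of x] smooth_on_slice_right[OF c d W H xc], of s k l] pos s True KU
      by (auto simp: dz_dzb_eq)
    finally show ?thesis by simp
  qed (simp add: \<eta>(2))
  have "integrable M (\<lambda>x. \<eta> x *\<^sub>R wirtinger \<i> (Inr l) (wirtinger (- \<i>) (Inr k) G) (vec_join (snd c x) ?w))"
    by (rule integrable_vec_join[OF param sww V(2)])
  then show ?int unfolding tr by simp
  have "dzb l (dz k (\<lambda>w. of_real (averaged_potential (chart_inv d w)))) ?w =
      wirtinger \<i> l (\<lambda>w. LINT x|M. \<eta> x *\<^sub>R wirtinger (- \<i>) (Inr k) G (vec_join (snd c x) w)) ?w"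
    unfolding dz_dzb_eq
  proof (rule wirtinger_cong[OF V])
    fix w assume w: "w \<in> ?V"
    have "wirtinger (- \<i>) k (\<lambda>w. complex_of_real (averaged_potential (chart_inv d w))) w =
        wirtinger (- \<i>) k (\<lambda>w. LINT x|M. \<eta> x *\<^sub>R G (vec_join (snd c x) w)) w"
      by (rule wirtinger_cong[OF V(1) w pot])
    also have "\<dots> = (LINT x|M. \<eta> x *\<^sub>R wirtinger (- \<i>) (Inr k) G (vec_join (snd c x) w))"
      by (rule wirtinger_param_integral[OF param G w])
    finally show "wirtinger (- \<i>) k (\<lambda>w. complex_of_real (averaged_potential (chart_inv d w))) w =
        (LINT x|M. \<eta> x *\<^sub>R wirtinger (- \<i>) (Inr k) G (vec_join (snd c x) w))" .
  qed
  also have "\<dots> = (LINT x|M. \<eta> x *\<^sub>R wirtinger \<i> (Inr l) (wirtinger (- \<i>) (Inr k) G) (vec_join (snd c x) ?w))"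
    by (rule wirtinger_param_integral[OF param sw V(2)])
  also have "\<dots> = - (LINT x|M. \<eta> x *\<^sub>R trace (curvature d (\<lambda>s. H (x, s)) k l s))"
    unfolding tr by simp
  finally show ?eq .
qed

end

section \<open>Rescaling\<close>

lemma holo_on_cong:
  assumes "open V" "\<And>z. z \<in> V \<Longrightarrow> f z = g z" "holo_on f V"
  shows "holo_on g V"
  unfolding holo_on_def dzb_eq_wirtinger
proof (intro conjI ballI allI)
  show "smooth_on g V"
    using assms(3) by (intro smooth_on_cong[OF assms(1,2)]) (simp_all add: holo_on_def)
  show "wirtinger \<i> j g z = 0" if "z \<in> V" for z j
    using wirtinger_cong[of V z f g \<i> j, OF assms(1) that assms(2)] assms(3) that
    by (simp add: holo_on_def dzb_eq_wirtinger)
qed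

lemma holo_on_subset: "holo_on f V \<Longrightarrow> W \<subseteq> V \<Longrightarrow> holo_on f W"
  by (auto simp: holo_on_def intro: smooth_on_subset)

text \<open>\<open>chart_inv\<close> is an \<open>inv_into\<close> over the domain, so shrinking the
  domain changes it as a function. Only on the smaller image do the two inverses agree, and all
  transfer lemmas below rest on that.\<close>

lemma chart_inv_restrict:
  assumes "inj_on (snd c) (fst c)" "U \<subseteq> fst c" "z \<in> snd c ` U"
  shows "chart_inv (U, snd c) z = chart_inv c z"
proof -
  obtain x where x: "x \<in> U" "z = snd c x" using assms(3) by blast
  have "inj_on (snd c) U" using assms(1,2) inj_on_subset by blast
  then show ?thesis using x assms(1,2) by (simp add: chart_inv_def inv_into_f_f subset_iff)
qed

lemma topological_chart_restrict:
  assumes c: "topological_chart c" and U: "open U" "U \<subseteq> fst c"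
  shows "topological_chart (U, snd c)"
proof -
  note cc = chartD[OF c]
  have eq: "chart_inv (U, snd c) z = chart_inv c z" if "z \<in> snd c ` U" for z
    by (rule chart_inv_restrict[OF cc(8) U(2) that])
  have "open (snd c ` U)" using open_chart_image[OF c U(1)] U(2) by (simp add: Int_absorb1)
  moreover have "continuous_on (snd c ` U) (chart_inv (U, snd c))"
    by (rule continuous_on_eq[OF continuous_on_subset[OF cc(4)]]) (use U eq in auto)
  moreover have "chart_inv (U, snd c) (snd c x) = x" if "x \<in> U" for x
    using eq[of "snd c x"] cc(5)[of x] U that by auto
  ultimately show ?thesis
    using U continuous_on_subset[OF cc(3) U(2)]
    by (auto simp: topological_chart_def homeomorphism_def image_iff)
qed

text \<open>The atlas need not be maximal, so the shrunk chart may lie outside \<open>B\<close>; its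
  transitions are restrictions of those of d and hence still holomorphic.\<close>

lemma holo_charts_restrict:
  assumes B: "complex_atlas B" and d: "d \<in> B" and U: "open U" "U \<subseteq> fst d"
  shows "(U, snd d) \<in> holo_charts B"
  unfolding holo_charts_def
proof (intro CollectI conjI ballI)
  note dd = chartD[OF atlasD(1)[OF B d]]
  show top: "topological_chart (U, snd d)" by (rule topological_chart_restrict[OF atlasD(1)[OF B d] U])
  fix c assume c: "c \<in> B"
  note cc = chartD[OF atlasD(1)[OF B c]]
  show "holo_transition (U, snd d) c"
    unfolding holo_transition_def fst_conv snd_conv
  proof
    fix j
    have o: "open (snd d ` (U \<inter> fst c))"
      using open_chart_image[OF top cc(1)] by simp
    have h: "holo_on (\<lambda>z. snd c (chart_inv d z) $ j) (snd d ` (U \<inter> fst c))"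
      using atlasD(2)[OF B d c] U(2) unfolding holo_transition_def by (blast intro: holo_on_subset)
    show "holo_on (\<lambda>z. snd c (chart_inv (U, snd d) z) $ j) (snd d ` (U \<inter> fst c))"
      by (rule holo_on_cong[OF o _ h]) (use chart_inv_restrict[OF dd(8) U(2)] in auto)
  qed
  show "holo_transition c (U, snd d)"
    using atlasD(2)[OF B c d] U(2) unfolding holo_transition_def fst_conv snd_conv
    by (blast intro: holo_on_subset)
qed

lemma prod_chart_restrict: "prod_chart c (U, snd d) = (fst c \<times> U, snd (prod_chart c d))"
  unfolding prod_chart_def fst_conv snd_conv ..

lemma chart_inv_prod_chart_restrict:
  assumes "topological_chart c" "topological_chart d" "U \<subseteq> fst d" "u \<in> prod_image c (U, snd d) W"
  shows "chart_inv (prod_chart c (U, snd d)) u = chart_inv (prod_chart c d) u"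
  unfolding prod_chart_restrict
  using inj_on_prod_chart[OF assms(1,2)] assms(3,4)
  by (intro chart_inv_restrict) (auto simp: prod_chart_restrict)

lemma prod_image_restrict_subset: "U \<subseteq> fst d \<Longrightarrow> prod_image c (U, snd d) W \<subseteq> prod_image c d W"
  by (auto simp: prod_chart_restrict)

lemma smooth_on_prod_chart_restrict:
  assumes f: "smooth_fun (prod_atlas A B) W f" and W: "open W" and A: "complex_atlas A" and B: "complex_atlas B"
    and c: "c \<in> A" and d: "d \<in> B" and U: "open U" "U \<subseteq> fst d"
  shows "smooth_on (\<lambda>u. f (chart_inv (prod_chart c (U, snd d)) u)) (prod_image c (U, snd d) W)"
proof (rule smooth_on_cong)
  note cd = atlasD(1)[OF A c] atlasD(1)[OF B d]
  show "open (prod_image c (U, snd d) W)"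
    by (rule open_prod_chart_image[OF cd(1) topological_chart_restrict[OF cd(2) U] W])
  have "prod_chart c d \<in> prod_atlas A B" using c d by (simp add: prod_atlasI)
  from smooth_on_subset[OF smooth_fun_chart[OF f this] prod_image_restrict_subset[OF U(2)]]
  show "smooth_on (\<lambda>u. f (chart_inv (prod_chart c d) u)) (prod_image c (U, snd d) W)" .
  show "f (chart_inv (prod_chart c d) u) = f (chart_inv (prod_chart c (U, snd d)) u)"
    if "u \<in> prod_image c (U, snd d) W" for u
    using chart_inv_prod_chart_restrict[OF cd U(2) that] by simp
qed

lemma holo_on_slice_restrict:
  assumes f: "holo_mat_fun (prod_atlas A B) W f" and W: "open W" and A: "complex_atlas A" and B: "complex_atlas B"
    and d: "d \<in> B" and U: "open U" "U \<subseteq> fst d"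
  shows "holo_on (\<lambda>w. f (x, chart_inv (U, snd d) w) $ a $ b) (snd d ` (U \<inter> {s. (x, s) \<in> W}))"
proof -
  obtain c where c: "c \<in> A" "x \<in> fst c" using atlasD(3)[OF A] by blast
  note cd = atlasD(1)[OF A c(1)] atlasD(1)[OF B d]
  note dU = topological_chart_restrict[OF cd(2) U]
  let ?d = "(U, snd d)"
  have "prod_chart c d \<in> prod_atlas A B" using c d by (simp add: prod_atlasI)
  then have "holo_on (\<lambda>u. f (chart_inv (prod_chart c d) u) $ a $ b) (prod_image c d W)"
    using f unfolding holo_mat_fun_def by blast
  then have h: "holo_on (\<lambda>u. f (chart_inv (prod_chart c ?d) u) $ a $ b) (prod_image c ?d W)"
    by (intro holo_on_cong[OF open_prod_chart_image[OF cd(1) dU W] _ holo_on_subset[OF _ prod_image_restrict_subset[OF U(2)]]])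
      (simp_all add: chart_inv_prod_chart_restrict[OF cd U(2)] del: prod_chart_simps)
  show ?thesis
    unfolding holo_on_def
  proof (intro conjI ballI allI)
    have s: "smooth_on (\<lambda>u. f (chart_inv (prod_chart c ?d) u) $ a $ b) (prod_image c ?d W)"
      using h holo_on_def by blast
    show "smooth_on (\<lambda>w. f (x, chart_inv ?d w) $ a $ b) (snd d ` (U \<inter> {s. (x, s) \<in> W}))"
      using smooth_on_slice_right[OF cd(1) dU W, of "\<lambda>p. f p $ a $ b", OF s c(2)] by simp
    fix w j assume w: "w \<in> snd d ` (U \<inter> {s. (x, s) \<in> W})"
    then have w': "w \<in> snd ?d ` (fst ?d \<inter> {s. (x, s) \<in> W})" by simp
    have "vec_join (snd c x) w \<in> prod_image c ?d W"
      using slice_right_image[OF cd(1) dU W c(2)] w' by blast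
    then have "dzb (Inr j) (\<lambda>u. f (chart_inv (prod_chart c ?d) u) $ a $ b) (vec_join (snd c x) w) = 0"
      using h unfolding holo_on_def by blast
    then show "dzb j (\<lambda>w. f (x, chart_inv ?d w) $ a $ b) w = 0"
      using wirtinger_slice_right[OF cd(1) dU W, of "\<lambda>p. f p $ a $ b", OF s c(2) w', of \<i> j]
      unfolding dzb_eq_wirtinger by simp
  qed
qed

text \<open>In product coordinates the factor depends only on the last block \<open>?q\<close>, so
  it is the coordinate expression of \<phi> composed with a linear projection.\<close>

lemma smooth_on_rescale:
  fixes c :: "('x::topological_space, 'n::finite) chart" and d :: "('s::topological_space, 'm::finite) chart"
    and H :: "'x \<times> 's \<Rightarrow> complex^'r::finite^'r"
  assumes c: "topological_chart c" and d: "topological_chart d" and W: "open W"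
    and H: "smooth_on (\<lambda>u. H (chart_inv (prod_chart c d) u)) (prod_image c d W)"
    and \<phi>: "smooth_on (\<lambda>w. \<phi> (chart_inv d w)) (snd d ` fst d)"
  shows "smooth_on (\<lambda>u. (\<lambda>(x, s). exp (\<phi> s) *\<^sub>R H (x, s)) (chart_inv (prod_chart c d) u)) (prod_image c d W)"
proof -
  note O = open_prod_chart_image[OF c d W]
  let ?q = "\<lambda>u :: complex^('n + 'm). \<chi> k. u $ Inr k"
  have "linear ?q" by (rule linearI) (simp_all add: vec_eq_iff)
  then have q: "smooth_on ?q (prod_image c d W)"
    by (intro smooth_on_bounded_linear O) (simp add: linear_conv_bounded_linear)
  have qV: "?q ` prod_image c d W \<subseteq> snd d ` fst d"
    by (auto simp: prod_chart_def)
  have "smooth_on (\<lambda>u. exp (\<phi> (chart_inv d (?q u))) *\<^sub>R H (chart_inv (prod_chart c d) u)) (prod_image c d W)"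
    by (intro smooth_on_scaleR smooth_on_exp O H smooth_on_compose[OF O chartD(2)[OF d] q qV \<phi>])
  then show ?thesis
  proof (rule smooth_on_cong[OF O, rotated])
    fix u assume "u \<in> prod_image c d W"
    then obtain y t where yt: "u = vec_join (snd c y) (snd d t)" "chart_inv (prod_chart c d) u = (y, t)" "t \<in> fst d"
      by (rule prod_imageE[OF c d])
    have "?q u = snd d t" by (simp add: yt(1) vec_eq_iff)
    then show "exp (\<phi> (chart_inv d (?q u))) *\<^sub>R H (chart_inv (prod_chart c d) u) =
        (\<lambda>(x, s). exp (\<phi> s) *\<^sub>R H (x, s)) (chart_inv (prod_chart c d) u)"
      using chartD(5)[OF d yt(3)] by (simp add: yt(2))
  qed
qed

text \<open>The domain of a frame contains an open box around (x, s0); its X-side is shrunk to a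
  compact set inside a chart so that it can carry a weight.\<close>

lemma frame_box:
  fixes F :: "('x::{t2_space,second_countable_topology} \<times> 's::topological_space, 'i, 'r::finite) vbundle"
    and A :: "('x, 'n::finite) chart set" and B :: "('s, 'm::finite) chart set"
  assumes A: "complex_atlas A" and F: "holo_bundle (prod_atlas A B) F"
  obtains i c V N K where "i \<in> idx F" "c \<in> A" "open V" "s\<^sub>0 \<in> V" "x \<in> N" "open N" "N \<subseteq> K" "compact K"
    "K \<subseteq> fst c" "K \<times> V \<subseteq> bdom F i"
proof -
  obtain i where i: "i \<in> idx F" "(x, s\<^sub>0) \<in> bdom F i" using holo_bundleD(2)[OF F] by blast
  obtain W V where WV: "open W" "open V" "(x, s\<^sub>0) \<in> W \<times> V" "W \<times> V \<subseteq> bdom F i"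
    using open_prod_elim[OF holo_bundleD(1)[OF F i(1)] i(2)] by metis
  obtain c where c: "c \<in> A" "x \<in> fst c" using atlasD(3)[OF A] by blast
  have "x \<in> fst c \<inter> W" using c WV by blast
  then obtain K N where KN: "x \<in> N" "open N" "N \<subseteq> K" "compact K" "K \<subseteq> fst c \<inter> W"
    by (rule compact_chart_neighbourhood[OF A c(1) WV(1)])
  show ?thesis
    by (rule that[OF i(1) c(1) WV(2) _ KN(1-4)]) (use KN(5) WV in auto)
qed

text \<open>\<open>rho\<close> is evaluated in whichever frame and chart were chosen at x, while the
  potential uses the frame j of a covering set. Freezing x, rescaling and changing the frame bridges
  the two.\<close>

lemma trace_rho_rescale:
  fixes A :: "('x::{t2_space,second_countable_topology}, 'n::finite) chart set"
    and B :: "('s::{t2_space,second_countable_topology}, 'm::finite) chart set"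
    and F :: "('x \<times> 's, 'i, 'r::finite) vbundle"
  assumes A: "complex_atlas A" and B: "complex_atlas B" and F: "holo_bundle (prod_atlas A B) F"
    and h: "hermitian_metric (prod_atlas A B) F h"
    and d: "d \<in> B" and U: "open U" "U \<subseteq> fst d" and s: "s \<in> U"
    and \<phi>: "smooth_on (\<lambda>w. \<phi> (chart_inv (U, snd d) w)) (snd d ` U)"
    and i: "i \<in> idx F" "(x, s) \<in> bdom F i" and j: "j \<in> idx F" "(x, s) \<in> bdom F j"
  shows "trace (rho A (U, snd d) F (rescale_metric \<phi> h) k l s i x) =
    trace (curvature (U, snd d) (\<lambda>s. h j (x, s)) k l s)
    - of_nat CARD('r) * dzb l (dz k (\<lambda>w. of_real (\<phi> (chart_inv (U, snd d) w)))) (snd d s)"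
proof -
  let ?d = "(U, snd d)" and ?c = "chart_at A x"
  have c: "?c \<in> A" "x \<in> fst ?c" by (rule chart_at[OF A])+
  note cd = atlasD(1)[OF A c(1)] topological_chart_restrict[OF atlasD(1)[OF B d] U]
  have hs: "smooth_on (\<lambda>u. h i (chart_inv (prod_chart ?c ?d) u)) (prod_image ?c ?d (bdom F i))" if "i \<in> idx F" for i
    by (rule smooth_on_prod_chart_restrict[OF metricD(1)[OF h that] holo_bundleD(1)[OF F that] A B c(1) d U])
  have H: "rescale_metric \<phi> h i = (\<lambda>(x, s). exp (\<phi> s) *\<^sub>R h i (x, s))"
    by (simp add: rescale_metric_def fun_eq_iff)
  have pos: "hermitian_pos_def (rescale_metric \<phi> h i p)" if "p \<in> bdom F i" for p
    using hermitian_pos_def_scaleR[OF metricD(2)[OF h i(1) that]] by (simp add: H case_prod_unfold)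
  have \<phi>': "smooth_on (\<lambda>w. \<phi> (chart_inv ?d w)) (snd ?d ` fst ?d)" using \<phi> by simp
  have sm: "smooth_on (\<lambda>u. rescale_metric \<phi> h i (chart_inv (prod_chart ?c ?d) u)) (prod_image ?c ?d (bdom F i))"
    unfolding H by (rule smooth_on_rescale[OF cd holo_bundleD(1)[OF F i(1)] hs[OF i(1)] \<phi>'])
  have "rho A ?d F (rescale_metric \<phi> h) k l s i x = curvature (prod_chart ?c ?d) (rescale_metric \<phi> h i) (Inr k) (Inr l) (x, s)"
    using i by (simp add: rho_def)
  also have "\<dots> = curvature ?d (\<lambda>s. exp (\<phi> s) *\<^sub>R h i (x, s)) k l s"
    using curvature_prod_chart[OF cd holo_bundleD(1)[OF F i(1)] sm hermitian_pos_def_invertible[OF pos] c(2) _ i(2)] s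
    by (simp add: H)
  finally have 1: "rho A ?d F (rescale_metric \<phi> h) k l s i x = curvature ?d (\<lambda>s. exp (\<phi> s) *\<^sub>R h i (x, s)) k l s" .
  have 2: "trace (curvature ?d (\<lambda>s. exp (\<phi> s) *\<^sub>R h i (x, s)) k l s) = trace (curvature ?d (\<lambda>s. h i (x, s)) k l s)
      - of_nat CARD('r) * dzb l (dz k (\<lambda>w. of_real (\<phi> (chart_inv ?d w)))) (snd ?d s)"
  proof (rule trace_curvature_rescale[OF cd(2) open_slice_right[OF holo_bundleD(1)[OF F i(1)], of x]
        smooth_on_slice_right[OF cd holo_bundleD(1)[OF F i(1)] hs[OF i(1)] c(2)]])
    show "hermitian_pos_def (h i (x, s))" if "s \<in> {s. (x, s) \<in> bdom F i}" for s
      using metricD(2)[OF h i(1)] that by blast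
    show "smooth_on (\<lambda>w. \<phi> (chart_inv ?d w)) (snd ?d ` (fst ?d \<inter> {s. (x, s) \<in> bdom F i}))"
      by (rule smooth_on_subset[OF \<phi>']) auto
  qed (use s i in auto)
  let ?W = "bdom F i \<inter> bdom F j"
  have W: "open ?W" using holo_bundleD(1)[OF F] i j by blast
  have 3: "trace (curvature ?d (\<lambda>s. h i (x, s)) k l s) = trace (curvature ?d (\<lambda>s. h j (x, s)) k l s)"
  proof (rule trace_curvature_change_frame[OF cd(2) open_slice_right[OF W, of x], where f = "\<lambda>s. frame_change F i j (x, s)"])
    show "smooth_on (\<lambda>w. h i (x, chart_inv ?d w)) (snd ?d ` (fst ?d \<inter> {s. (x, s) \<in> ?W}))"
      by (rule smooth_on_subset[OF smooth_on_slice_right[OF cd holo_bundleD(1)[OF F i(1)] hs[OF i(1)] c(2)]]) auto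
    show "smooth_on (\<lambda>w. h j (x, chart_inv ?d w)) (snd ?d ` (fst ?d \<inter> {s. (x, s) \<in> ?W}))"
      by (rule smooth_on_subset[OF smooth_on_slice_right[OF cd holo_bundleD(1)[OF F j(1)] hs[OF j(1)] c(2)]]) auto
    show "holo_on (\<lambda>w. frame_change F i j (x, chart_inv ?d w) $ a $ b) (snd ?d ` (fst ?d \<inter> {s. (x, s) \<in> ?W}))" for a b
      using holo_on_slice_restrict[OF holo_bundleD(5)[OF F i(1) j(1)] W A B d U] by simp
    fix s assume s: "s \<in> {s. (x, s) \<in> ?W}"
    show "hermitian_pos_def (h i (x, s))" "hermitian_pos_def (h j (x, s))"
      using s metricD(2)[OF h] i j by auto
    show "invertible (frame_change F i j (x, s))"
      by (rule invertible_frame_change[OF F i(1) j(1)]) (use s in auto)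
    show "h i (x, s) = frame_change F i j (x, s) ** h j (x, s) ** ctranspose (frame_change F i j (x, s))"
      by (rule metricD(3)[OF h i(1) j(1)]) (use s in auto)
  qed (use s i j in auto)
  show ?thesis using 1 2 3 by simp
qed

section \<open>Construction of the rescaling function\<close>

theorem proposition1:
  fixes A :: "('x::{t2_space,second_countable_topology}, 'n::finite) chart set"
    and g :: "('x, 'n) chart \<Rightarrow> 'x \<Rightarrow> complex^'n^'n"
    and vol :: "'x measure"
    and B :: "('s::{t2_space,second_countable_topology}, 'm::finite) chart set"
    and F :: "('x \<times> 's, 'i, 'r::finite) vbundle"
    and h :: "'i \<Rightarrow> 'x \<times> 's \<Rightarrow> complex^'r^'r"
    and L :: "('x, 'j, 1) vbundle"
  assumes "complex_atlas A" and "compact (UNIV :: 'x set)"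
    and "kaehler_metric A g" and "kaehler_volume A g vol"
    and "complex_atlas B"
    and "holo_bundle (prod_atlas A B) F" and "hermitian_metric (prod_atlas A B) F h"
    and "\<And>s. simple_bundle A (slice_bundle F s)"
    and "\<And>s. hermite_einstein A g (slice_bundle F s) (slice_metric h s)"
    and "holo_bundle A L"
    and "\<And>s. bundle_iso A (det_bundle (slice_bundle F s)) L"
  shows "\<forall>s\<^sub>0. \<exists>d\<in>holo_charts B. s\<^sub>0 \<in> fst d \<and>
    (\<exists>\<phi>. smooth_fun B (fst d) \<phi> \<and>
      (\<forall>s\<in>fst d. \<forall>k l.
        harmonic_projection A g vol (slice_bundle F s) (slice_metric (rescale_metric \<phi> h) s)
          (rho A d F (rescale_metric \<phi> h) k l s) = (\<lambda>i x. 0)))"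
proof
  fix s\<^sub>0
  note A = assms(1) and X = assms(2) and vol = assms(4) and B = assms(5) and F = assms(6) and h = assms(7)
  have g: "hermitian_metric A (tangent_bundle A) g" using assms(3) by (simp add: kaehler_metric_def)
  interpret finite_measure vol by (rule finite_measure_vol[OF A X g vol])
  have sv: "sets vol = sets borel" and spv: "space vol = UNIV"
    by (rule sets_vol[OF A X g vol], rule space_vol[OF A X g vol])
  define v where "v = measure vol UNIV"
  have v: "v \<noteq> 0"
    using emeasure_vol_open_pos[OF A X g vol open_UNIV UNIV_I] by (simp add: v_def emeasure_eq_measure)
  obtain d\<^sub>0 where d0: "d\<^sub>0 \<in> B" "s\<^sub>0 \<in> fst d\<^sub>0" using atlasD(3)[OF B] by blast
  \<comment> \<open>The five pieces of data at each point are packed into a tuple so that a single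
    choice function provides them.\<close>
  have "\<forall>x. \<exists>b. case b of (i, c, V, N, K) \<Rightarrow> i \<in> idx F \<and> c \<in> A \<and> open V \<and> s\<^sub>0 \<in> V \<and> x \<in> N \<and> open N \<and> N \<subseteq> K \<and>
      compact K \<and> K \<subseteq> fst c \<and> K \<times> V \<subseteq> bdom F i" (is "\<forall>x. \<exists>b. ?Q x b")
  proof
    fix x
    show "\<exists>b. ?Q x b"
      by (rule frame_box[OF A F, of s\<^sub>0 x], rule exI[of _ "(_, _, _, _, _)"]) simp
  qed
  then obtain b where b: "\<And>x. ?Q x (b x)" using choice[of ?Q] by blast
  define i where "i p = fst (b p)" for p
  define c where "c p = fst (snd (b p))" for p
  define V where "V p = fst (snd (snd (b p)))" for p
  define N where "N p = fst (snd (snd (snd (b p))))" for p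
  define K where "K p = snd (snd (snd (snd (b p))))" for p
  have i: "i p \<in> idx F" and c: "c p \<in> A" and V: "open (V p)" "s\<^sub>0 \<in> V p" and N: "p \<in> N p" "open (N p)" "N p \<subseteq> K p"
    and K: "compact (K p)" "K p \<subseteq> fst (c p)" "K p \<times> V p \<subseteq> bdom F (i p)" for p
    using b[of p] by (auto simp: i_def c_def V_def N_def K_def case_prod_unfold)
  obtain P where P: "finite P" "UNIV \<subseteq> (\<Union>p\<in>P. N p)"
  proof (rule compactE_image[OF X, of UNIV N])
    show "UNIV \<subseteq> (\<Union>p\<in>UNIV. N p)" using N(1) by blast
  qed (use N(2) in auto)
  \<comment> \<open>Finiteness of P keeps this intersection open, and it makes each
    \<open>K p \<times> U\<close> lie in the domain of the frame \<open>i p\<close>.\<close>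
  define U where "U = fst d\<^sub>0 \<inter> (\<Inter>p\<in>P. V p)"
  have U: "open U" "U \<subseteq> fst d\<^sub>0"
    unfolding U_def using chartD(1)[OF atlasD(1)[OF B d0(1)]] V(1) P(1) by auto
  have UV: "U \<subseteq> V p" if "p \<in> P" for p using that by (auto simp: U_def)
  have KU: "K p \<times> U \<subseteq> bdom F (i p)" if "p \<in> P" for p using UV[OF that] K(3)[of p] by blast
  have "s\<^sub>0 \<in> U" using d0 V(2) by (auto simp: U_def)
  \<comment> \<open>Counts the chosen sets that contain x, at least one by the covering. Dividing by
    it normalizes the indicators to weights with sum 1.\<close>
  define n where "n x = (\<Sum>p\<in>P. indicator (N p) x :: real)" for x
  have n: "n x > 0" for x
  proof -
    obtain p where "p \<in> P" "x \<in> N p" using P(2) by blast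
    then show ?thesis unfolding n_def by (intro sum_pos2[OF P(1), of p]) auto
  qed
  define \<eta> where "\<eta> p x = indicator (N p) x / n x" for p x
  have \<eta>0: "\<eta> p x = 0" if "x \<notin> N p" for p x using that by (simp add: \<eta>_def)
  have \<eta>K: "\<eta> p x = 0" if "x \<notin> K p" for p x using that \<eta>0 N(3) by blast
  have \<eta>1: "(\<Sum>p\<in>P. \<eta> p x) = 1" for x
    using n[of x] by (simp add: \<eta>_def n_def flip: sum_divide_distrib)
  have \<eta>int: "integrable vol (\<eta> p)" if p: "p \<in> P" for p
  proof (rule integrable_const_bound)
    have [measurable]: "N q \<in> sets vol" for q using N(2) by (simp add: sv)
    show "\<eta> p \<in> borel_measurable vol" unfolding \<eta>_def[abs_def] n_def by measurable
    have "0 \<le> \<eta> q x" for q x using n[of x] by (simp add: \<eta>_def)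
    then show "AE x in vol. norm (\<eta> p x) \<le> 1"
      using \<eta>1 member_le_sum[OF p, of "\<lambda>p. \<eta> p _"] P(1) by (auto intro!: AE_I2)
  qed
  let ?d = "(U, snd d\<^sub>0)"
  define \<Phi> where "\<Phi> p = averaged_potential (h (i p)) vol (\<eta> p)" for p
  have topd: "topological_chart ?d" by (rule topological_chart_restrict[OF atlasD(1)[OF B d0(1)] U])
  have smd: "smooth_on (\<lambda>u. h (i p) (chart_inv (prod_chart (c p) ?d) u)) (prod_image (c p) ?d (bdom F (i p)))" for p
    by (rule smooth_on_prod_chart_restrict[OF metricD(1)[OF h i] holo_bundleD(1)[OF F i] A B c d0(1) U])
  note closedK = compact_imp_closed[OF K(1)]
  have \<Phi>d: "smooth_on (\<lambda>w. \<Phi> p (chart_inv ?d w)) (snd d\<^sub>0 ` U)" if "p \<in> P" for p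
    using smooth_on_averaged_potential[OF atlasD(1)[OF A c] topd holo_bundleD(1)[OF F i] smd
        metricD(2)[OF h i] sv K(1) closedK K(2) U(1) KU[OF that] \<eta>int[OF that] \<eta>K]
    by (simp add: \<Phi>_def)
  \<comment> \<open>Here \<open>r\<close> is the coefficient of the potentials, not the rank. It is
    chosen so that rank times volume times the mixed derivative of \<phi> equals the integral of the
    unscaled trace.\<close>
  define r where "r = - 1 / (real CARD('r) * v)"
  define \<phi> where "\<phi> s = (\<Sum>p\<in>P. r * \<Phi> p s)" for s
  have "smooth_fun B U \<phi>"
    unfolding smooth_fun_def o_def \<phi>_def
  proof
    \<comment> \<open>Smoothness of \<phi> is tested in the charts of \<open>B\<close> itself,
      whereas \<open>\<Phi>d\<close> concerns the shrunk chart; the averaging lemma is therefore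
      applied a second time.\<close>
    fix d assume d: "d \<in> B"
    have O: "open (snd d ` (fst d \<inter> U))" by (rule open_chart_image[OF atlasD(1)[OF B d] U(1)])
    have "smooth_on (\<lambda>w. \<Phi> p (chart_inv d w)) (snd d ` (fst d \<inter> U))" if "p \<in> P" for p
    proof -
      have "prod_chart (c p) d \<in> prod_atlas A B" by (rule prod_atlasI[OF c d])
      from smooth_fun_chart[OF metricD(1)[OF h i] this]
      show ?thesis
        unfolding \<Phi>_def
        by (rule smooth_on_averaged_potential[OF atlasD(1)[OF A c] atlasD(1)[OF B d] holo_bundleD(1)[OF F i] _
              metricD(2)[OF h i] sv K(1) closedK K(2) U(1) KU[OF that] \<eta>int[OF that] \<eta>K])
    qed
    then show "smooth_on (\<lambda>w. \<Sum>p\<in>P. r * \<Phi> p (chart_inv d w)) (snd d ` (fst d \<inter> U))"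
      by (intro smooth_on_sum smooth_on_mult smooth_on_const O)
  qed
  moreover have "harmonic_projection A g vol (slice_bundle F s) (slice_metric (rescale_metric \<phi> h) s)
      (rho A ?d F (rescale_metric \<phi> h) k l s) = (\<lambda>i x. 0)" if s: "s \<in> U" for s k l
  proof -
    let ?w = "snd d\<^sub>0 s" and ?E = "slice_bundle F s"
    have O: "open (snd d\<^sub>0 ` U)" "?w \<in> snd d\<^sub>0 ` U" using chartD(2)[OF topd] s by auto
    have E: "holo_bundle A ?E" by (rule holo_bundle_slice[OF A B F])
    have hE: "hermitian_metric A ?E (slice_metric (rescale_metric \<phi> h) s)"
      unfolding slice_rescale_metric by (rule hermitian_metric_scaleR[OF A E hermitian_metric_slice[OF A B F h]]) simp
    define t where "t p x = trace (curvature ?d (\<lambda>s. h (i p) (x, s)) k l s)" for p x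
    have tint: "integrable vol (\<lambda>x. \<eta> p x *\<^sub>R t p x)"
      and dd\<Phi>: "dzb l (dz k (\<lambda>w. of_real (\<Phi> p (chart_inv ?d w)))) ?w = - (LINT x|vol. \<eta> p x *\<^sub>R t p x)" if "p \<in> P" for p
      using dzb_dz_averaged_potential[OF atlasD(1)[OF A c] topd holo_bundleD(1)[OF F i] smd
          metricD(2)[OF h i] sv K(1) closedK K(2) U(1) KU[OF that] \<eta>int[OF that] \<eta>K, where s = s and k = k and l = l] s
      by (simp_all add: \<Phi>_def t_def)
    define D where "D = dzb l (dz k (\<lambda>w. complex_of_real (\<phi> (chart_inv ?d w)))) ?w"
    have \<phi>d: "smooth_on (\<lambda>w. \<phi> (chart_inv ?d w)) (snd d\<^sub>0 ` U)"
      unfolding \<phi>_def by (intro smooth_on_sum smooth_on_mult smooth_on_const O \<Phi>d)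
    have "D = dzb l (dz k (\<lambda>w. \<Sum>p\<in>P. of_real r * complex_of_real (\<Phi> p (chart_inv ?d w)))) ?w"
      by (simp add: D_def \<phi>_def)
    also have "\<dots> = (\<Sum>p\<in>P. dzb l (dz k (\<lambda>w. of_real r * complex_of_real (\<Phi> p (chart_inv ?d w)))) ?w)"
      by (intro dzb_dz_sum[OF O(1) _ O(2)] smooth_on_mult smooth_on_const smooth_on_of_real O \<Phi>d)
    also have "\<dots> = (\<Sum>p\<in>P. of_real r * dzb l (dz k (\<lambda>w. complex_of_real (\<Phi> p (chart_inv ?d w)))) ?w)"
      by (intro sum.cong refl dzb_dz_cmult[OF O(1) _ O(2)] smooth_on_of_real O \<Phi>d)
    also have "\<dots> = - of_real r * (\<Sum>p\<in>P. LINT x|vol. \<eta> p x *\<^sub>R t p x)"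
      by (simp add: dd\<Phi> sum_distrib_left sum_negf)
    finally have D: "of_nat CARD('r) * D * of_real v = (\<Sum>p\<in>P. LINT x|vol. \<eta> p x *\<^sub>R t p x)"
      using v by (simp add: r_def)
    \<comment> \<open>Where the weight \<open>\<eta> p\<close> is nonzero, x lies in
      \<open>N p\<close>, so the trace may be computed in the frame \<open>i p\<close>. Since the
      weights add up to 1, the weighted sum recovers the trace in the frame chosen at x.\<close>
    have tr: "trace (rho A ?d F (rescale_metric \<phi> h) k l s (frame_at ?E x) x) =
        (\<Sum>p\<in>P. \<eta> p x *\<^sub>R t p x) - of_nat CARD('r) * D" for x
    proof -
      let ?f = "frame_at ?E x"
      have f: "?f \<in> idx F" "(x, s) \<in> bdom F ?f" using frame_at[OF E, of x] by auto
      let ?\<rho> = "trace (rho A ?d F (rescale_metric \<phi> h) k l s ?f x)"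
      have "\<eta> p x *\<^sub>R t p x = \<eta> p x *\<^sub>R (?\<rho> + of_nat CARD('r) * D)" if p: "p \<in> P" for p
      proof (cases "x \<in> N p")
        case True
        then have "(x, s) \<in> bdom F (i p)" using N(3)[of p] KU[OF p] s by blast
        from trace_rho_rescale[OF A B F h d0(1) U s \<phi>d f i this, of k l]
        show ?thesis by (simp add: t_def D_def)
      qed (simp add: \<eta>0)
      then have "(\<Sum>p\<in>P. \<eta> p x *\<^sub>R t p x) = (\<Sum>p\<in>P. \<eta> p x) *\<^sub>R (?\<rho> + of_nat CARD('r) * D)"
        unfolding scaleR_sum_left by (rule sum.cong[OF refl])
      then show ?thesis by (simp add: \<eta>1)
    qed
    have tsum: "integrable vol (\<lambda>x. \<Sum>p\<in>P. \<eta> p x *\<^sub>R t p x)"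
      using tint by (rule Bochner_Integration.integrable_sum)
    show ?thesis
    proof (rule harmonic_projection_eq_0[OF A X g vol E hE assms(8)])
      show "integrable vol (\<lambda>x. trace (rho A ?d F (rescale_metric \<phi> h) k l s (frame_at ?E x) x))"
        unfolding tr using tsum by simp
      \<comment> \<open>The correction by rescaling is constant on X, so integrating multiplies it
        by the volume, and \<open>D\<close> cancels the rest.\<close>
      have "(LINT x|vol. (\<Sum>p\<in>P. \<eta> p x *\<^sub>R t p x) - of_nat CARD('r) * D) =
          (\<Sum>p\<in>P. LINT x|vol. \<eta> p x *\<^sub>R t p x) - of_nat CARD('r) * D * of_real v"
        using tsum tint by (simp add: spv v_def scaleR_conv_of_real mult.commute)
      then show "(LINT x|vol. trace (rho A ?d F (rescale_metric \<phi> h) k l s (frame_at ?E x) x)) = 0"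
        unfolding tr by (simp only: D diff_self)
    qed
  qed
  ultimately show "\<exists>d\<in>holo_charts B. s\<^sub>0 \<in> fst d \<and>
    (\<exists>\<phi>. smooth_fun B (fst d) \<phi> \<and>
      (\<forall>s\<in>fst d. \<forall>k l.
        harmonic_projection A g vol (slice_bundle F s) (slice_metric (rescale_metric \<phi> h) s)
          (rho A d F (rescale_metric \<phi> h) k l s) = (\<lambda>i x. 0)))"
    using \<open>s\<^sub>0 \<in> U\<close> holo_charts_restrict[OF B d0(1) U] by (intro bexI[of _ ?d]) auto
qed

end
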